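(* Let $R$ be a field with $\operatorname{char}R>2n$, let $\mathbf u=(u_1,\dots,u_r)\in R^r$ be generic for $\mathscr W_{r,n}(\mathbf u)$, and let $\Omega\subseteq R$ be $\mathbf u$-admissible. Let $\lambda$ be an $r$-multipartition of $n-2m$, where $0\le m\le\lfloor n/2\rfloor$, and assume that the root conditions hold in $R$. Let $\Delta(\lambda)$ be the $R$-vector space with basis $\{v_{\mathfrak t}\mid\mathfrak t\in\mathscr T^{ud}_n(\lambda)\}$. Then $\Delta(\lambda)$ becomes a $\mathscr W_{r,n}(\mathbf u)$-module via $$S_kv_{\mathfrak t}=\begin{cases}\sum_{\mathfrak u\overset{k}{\sim}\mathfrak t}s_{\mathfrak t\mathfrak u}(k)v_{\mathfrak u},&\text{if }\mathfrak t_{k-1}=\mathfrak t_{k+1},\\ a_{\mathfrak t}(k)v_{\mathfrak t}+b_{\mathfrak t}(k)v_{S_k\mathfrak t},&\text{if }\mathfrak t_{k-1}\ne\mathfrak t_{k+1},\end{cases}$$ $$E_kv_{\mathfrak t}=\begin{cases}\sum_{\mathfrak u\overset{k}{\sim}\mathfrak t}e_{\mathfrak t\mathfrak u}(k)v_{\mathfrak u},&\text{if }\mathfrak t_{k-1}=\mathfrak t_{k+1},\\0,&\text{if }\mathfrak t_{k-1}\neq\mathfrak t_{k+1},\end{cases}\qquad X_jv_{\mathfrak t}=c_{\mathfrak t}(j)v_{\mathfrak t},$$ for $1\le k<n$ and $1\le j\le n$, where $v_{S_k\mathfrak t}=0$ if $S_k\mathfrak t$ is not defined.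
   Context: Affine Wenzl algebra. Let $R$ be a commutative ring with $1$ in which $2$ is invertible and $\Omega=\{\omega_a\mid a\ge0\}\subseteq R$. The affine Wenzl algebra $\mathscr W_n^{\mathrm{aff}}(\Omega)$ is the unital associative $R$-algebra with generators $S_i,E_i$ ($1\le i<n$) and $X_j$ ($1\le j\le n$) and relations (for all indices for which they make sense): (a) $S_i^2=1$; (b) $S_iS_j=S_jS_i$ if $|i-j|>1$; $S_iS_{i+1}S_i=S_{i+1}S_iS_{i+1}$; $S_iX_j=X_jS_i$ if $j\ne i,i+1$; (c) $E_i^2=\omega_0E_i$; (d) $S_iE_j=E_jS_i$ and $E_iE_j=E_jE_i$ if $|i-j|>1$; $E_iX_j=X_jE_i$ if $j\neq i,i+1$; $X_iX_j=X_jX_i$; (e) $S_iX_i-X_{i+1}S_i=E_i-1$ and $X_iS_i-S_iX_{i+1}=E_i-1$; (f) $E_1X_1^aE_1=\omega_aE_1$ for $a>0$; (g) $E_iS_i=E_i=S_iE_i$; $S_iE_{i+1}E_i=S_{i+1}E_i$; $E_{i+1}E_iS_{i+1}=E_{i+1}S_i$; (h) $E_{i+1}E_iE_{i+1}=E_{i+1}$ and $E_iE_{i+1}E_i=E_i$; (i) $E_i(X_i+X_{i+1})=0=(X_i+X_{i+1})E_i$. $\mathscr W_{r,n}(\mathbf u)=\mathscr W_n^{\mathrm{aff}}(\Omega)/\langle (X_1-u_1)\cdots(X_1-u_r)\rangle$. $\mathbf u$-admissibility. Define $q_a(\mathbf u)$ by $\prod_{i=1}^r\frac{1+u_iy}{1-u_iy}=\sum_{a\ge0}q_a(\mathbf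 u)y^a$. $\Omega$ is $\mathbf u$-admissible if $\omega_a=q_{a+1}(\mathbf u)-\frac12(-1)^rq_a(\mathbf u)+\frac12\delta_{a0}$ for all $a\ge0$. Characteristic $0$ is regarded as $>2n$. $\mathbf u$ is generic for $\mathscr W_{r,n}(\mathbf u)$ if whenever $d\in\mathbb Z$ is such that either $u_i\pm u_j=d\cdot1_R$ with $i\ne j$, or $2u_i=d\cdot1_R$, then $|d|\ge2n$. Updown tableaux. An $r$-multipartition of $m$ is an $r$-tuple $\lambda=(\lambda^{(1)},\dots,\lambda^{(r)})$ of partitions with $\sum_s|\lambda^{(s)}|=m$. If $\mu$ is obtained from $\lambda$ by adding one box (so $\mu^{(s)}_i=\lambda^{(s)}_i+1$ for one pair $(i,s)$, all other parts equal), write $\lambda\subset\mu$ and $\mu\setminus\lambda=(i,\mu_i^{(s)},s)$; this node is an addable node of $\lambda$ and a removable node of $\mu$, and $\lambda$ is obtained from $\mu$ by removing a box. For $\lambda\vdash n-2m$, $\mathscr T^{ud}_n(\lambda)$ is the set of sequences $\mathfrak t=(\mathfrak t_1,\dots,\mathfrak t_n)$ of multipartitions with $\mathfrak t_n=\lambda$ and such that $\mathfrak t_i$ is obtained from $\mathfrak t_{i-1}$ by adding or removing a box for $1\le i\le n$, where $\mathfrak t_0=\emptyset$. Write $\mathfrak u\overset{k}{\sim}\mathfrak t$ if $\mathfrak u_j=\mathfrak t_j$ for all $j\neq k$. If $\mu,\nu$ differ by one box, $\mu\ominus\nu$ denotes that box. Contents. $c_{\mathfrak t}(k)=u_s+j-i$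 if $\mathfrak t_k\setminus\mathfrak t_{k-1}=(i,j,s)$, and $c_{\mathfrak t}(k)=-(u_s+j-i)$ if $\mathfrak t_{k-1}\setminus\mathfrak t_k=(i,j,s)$. For a node $\alpha=(i,j,s)$ of a multipartition put $c(\alpha)=u_s+j-i$ if $\alpha$ is addable and $c(\alpha)=-(u_s+j-i)$ if $\alpha$ is removable. Coefficients. $W_k(y,\mathfrak t)=\frac12-y+\big(y-\frac12(-1)^r\big)\prod_\alpha\frac{y+c(\alpha)}{y-c(\alpha)}$, where $\alpha$ runs over the addable and removable nodes of $\mathfrak t_{k-1}$. Let $1\le k<n$. If $\mathfrak t_{k-1}=\mathfrak t_{k+1}$: $e_{\mathfrak t\mathfrak t}(k)=\operatorname{Res}_{y=c_{\mathfrak t}(k)}\frac{W_k(y,\mathfrak t)}y$; if $\mathfrak u\overset k\sim\mathfrak t$, $\mathfrak u\ne\mathfrak t$, then $e_{\mathfrak t\mathfrak u}(k)=\sqrt{e_{\mathfrak t\mathfrak t}(k)}\sqrt{e_{\mathfrak u\mathfrak u}(k)}$; and for $\mathfrak u\overset k\sim\mathfrak t$, $s_{\mathfrak t\mathfrak u}(k)=\frac{e_{\mathfrak t\mathfrak u}(k)-\delta_{\mathfrak t\mathfrak u}}{c_{\mathfrak t}(k)+c_{\mathfrak u}(k)}$. If $\mathfrak t_{k-1}\ne\mathfrak t_{k+1}$: $a_{\mathfrak t}(k)=\frac1{c_{\mathfrak t}(k+1)-c_{\mathfrak t}(k)}$, $b_{\mathfrak t}(k)=\sqrt{1-a_{\mathfrak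 t}(k)^2}$. In this case, if $\mathfrak t_k\ominus\mathfrak t_{k-1}$ and $\mathfrak t_{k+1}\ominus\mathfrak t_k$ are in different rows and different columns (nodes in different components always are), $S_k\mathfrak t$ is the updown tableau obtained from $\mathfrak t$ by replacing $\mathfrak t_k$ with the unique multipartition $\mu$ such that $\mu\ominus\mathfrak t_{k+1}=\mathfrak t_{k-1}\ominus\mathfrak t_k$ and $\mathfrak t_{k-1}\ominus\mu=\mathfrak t_k\ominus\mathfrak t_{k+1}$; otherwise $S_k\mathfrak t$ is not defined. Root conditions. All the square roots $\sqrt{e_{\mathfrak t\mathfrak t}(k)}$ (when $\mathfrak t_{k-1}=\mathfrak t_{k+1}$) and $b_{\mathfrak t}(k)=\sqrt{1-a_{\mathfrak t}(k)^2}$ (when $\mathfrak t_{k-1}\neq\mathfrak t_{k+1}$) exist in $R$, and are chosen (one choice for each $\mathfrak t\in\mathscr T^{ud}_n(\lambda)$ and $1\le k<n$) so that, for all $\mathfrak t,\mathfrak u,\mathfrak w\in\mathscr T^{ud}_n(\lambda)$ and all indices for which the quantities involved are defined: (a) if $\mathfrak t_{k-1}\ne\mathfrak t_{k+1}$ and $S_k\mathfrak t$ is defined then $b_{S_k\mathfrak t}(k)=b_{\mathfrak t}(k)$; (b) if $\mathfrak t_{k-1}\neq\mathfrak t_{k+1}$ and $\mathfrak t\overset l\sim\mathfrak u$ with $|k-l|>1$ then $b_{\mathfrak t}(k)=b_{\mathfrak u}(k)$; (c) if $\mathfrak t_{k-1}\ne\mathfrak t_{k+1}$, $\mathfrak t_k\neq\mathfrak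 t_{k+2}$ and $S_k\mathfrak t$, $S_{k+1}\mathfrak t$ are both defined then $b_{S_{k+1}\mathfrak t}(k)=b_{S_k\mathfrak t}(k+1)$; (d) if $\mathfrak t_{k-1}=\mathfrak t_{k+1}$ and $\mathfrak t_k=\mathfrak t_{k+2}$ then $\sqrt{e_{\mathfrak t\mathfrak t}(k)}\sqrt{e_{\mathfrak t\mathfrak t}(k+1)}=1$; (e) if $\mathfrak t_{k-1}=\mathfrak t_{k+1}$, $\mathfrak u_{k-1}=\mathfrak u_{k+1}$ and $e_{\mathfrak t\mathfrak t}(k)=e_{\mathfrak u\mathfrak u}(k)$ then $\sqrt{e_{\mathfrak t\mathfrak t}(k)}=\sqrt{e_{\mathfrak u\mathfrak u}(k)}$; (f) if $\mathfrak t_{k-1}=\mathfrak t_{k+1}$, $\mathfrak t_k=\mathfrak t_{k+2}$, $\mathfrak u\overset{k+1}\sim\mathfrak t$, $\mathfrak w\overset k\sim\mathfrak t$, with $S_k\mathfrak u$ and $S_{k+1}\mathfrak w$ both defined and $S_k\mathfrak u=S_{k+1}\mathfrak w$, then $b_{\mathfrak u}(k)\sqrt{e_{\mathfrak u\mathfrak u}(k+1)}=b_{\mathfrak w}(k+1)\sqrt{e_{\mathfrak w\mathfrak w}(k)}$. *)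

theory Defs
  imports
    "HOL-Algebra.QuotRing"
    "HOL-Library.Poly_Mapping"
    "HOL-Computational_Algebra.Formal_Laurent_Series"
begin

text \<open>
  Words form a monoid under concatenation, so that the convolution product of
  \<^theory>\<open>HOL-Library.Poly_Mapping\<close> turns the finitely supported functions on words into the
  free associative algebra.
\<close>

instantiation list :: (type) monoid_add
begin

definition zero_list :: "'a list" where "zero_list = []"

definition plus_list :: "'a list \<Rightarrow> 'a list \<Rightarrow> 'a list" where "plus_list = append"

instance by standard (simp_all add: zero_list_def plus_list_def)

end

definition free_algebra :: "'g set \<Rightarrow> ('g list \<Rightarrow>\<^sub>0 'a::field) ring" where
  "free_algebra G = \<lparr>carrier = {f. Poly_Mapping.keys f \<subseteq> lists G}, monoid.mult = (*), one = 1, zero = 0, add = (+)\<rparr>"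

definition free_const :: "'a \<Rightarrow> 'g list \<Rightarrow>\<^sub>0 'a::field" where
  "free_const c = Poly_Mapping.single [] c"

definition free_gen :: "'g \<Rightarrow> 'g list \<Rightarrow>\<^sub>0 'a::field" where
  "free_gen g = Poly_Mapping.single [g] 1"

text \<open>Unital left modules; the module locales of the libraries require a commutative ring of scalars.\<close>

locale left_module = ring A for A (structure) +
  fixes V :: "'v::ab_group_add set" and act :: "'b \<Rightarrow> 'v \<Rightarrow> 'v"
  assumes zero_mem: "0 \<in> V"
    and add_mem: "\<lbrakk>v \<in> V; w \<in> V\<rbrakk> \<Longrightarrow> v + w \<in> V"
    and uminus_mem: "v \<in> V \<Longrightarrow> - v \<in> V"
    and act_mem: "\<lbrakk>x \<in> carrier A; v \<in> V\<rbrakk> \<Longrightarrow> act x v \<in> V"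
    and act_add_right: "\<lbrakk>x \<in> carrier A; v \<in> V; w \<in> V\<rbrakk> \<Longrightarrow> act x (v + w) = act x v + act x w"
    and act_add_left: "\<lbrakk>x \<in> carrier A; y \<in> carrier A; v \<in> V\<rbrakk> \<Longrightarrow> act (x \<oplus> y) v = act x v + act y v"
    and act_mult: "\<lbrakk>x \<in> carrier A; y \<in> carrier A; v \<in> V\<rbrakk> \<Longrightarrow> act (x \<otimes> y) v = act x (act y v)"
    and act_one: "v \<in> V \<Longrightarrow> act \<one> v = v"

datatype wgen = GS nat | GE nat | GX nat

definition wgens :: "nat \<Rightarrow> wgen set" where
  "wgens n = GS ` {1..<n} \<union> GE ` {1..<n} \<union> GX ` {1..n}"

abbreviation fS :: "nat \<Rightarrow> wgen list \<Rightarrow>\<^sub>0 'a::field" where "fS i \<equiv> free_gen (GS i)"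
abbreviation fE :: "nat \<Rightarrow> wgen list \<Rightarrow>\<^sub>0 'a::field" where "fE i \<equiv> free_gen (GE i)"
abbreviation fX :: "nat \<Rightarrow> wgen list \<Rightarrow>\<^sub>0 'a::field" where "fX j \<equiv> free_gen (GX j)"

inductive wenzl_rel ::
  "nat \<Rightarrow> (nat \<Rightarrow> 'a::field) \<Rightarrow> (wgen list \<Rightarrow>\<^sub>0 'a) \<Rightarrow> (wgen list \<Rightarrow>\<^sub>0 'a) \<Rightarrow> bool"
  for n :: nat and \<omega> :: "nat \<Rightarrow> 'a" where
  SS: "i \<in> {1..<n} \<Longrightarrow> wenzl_rel n \<omega> (fS i ^ 2) 1"
| SS_comm: "\<lbrakk>i \<in> {1..<n}; j \<in> {1..<n}; i + 1 < j \<or> j + 1 < i\<rbrakk>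
    \<Longrightarrow> wenzl_rel n \<omega> (fS i * fS j) (fS j * fS i)"
| SS_braid: "\<lbrakk>i \<in> {1..<n}; i + 1 \<in> {1..<n}\<rbrakk>
    \<Longrightarrow> wenzl_rel n \<omega> (fS i * fS (i + 1) * fS i) (fS (i + 1) * fS i * fS (i + 1))"
| SX_comm: "\<lbrakk>i \<in> {1..<n}; j \<in> {1..n}; j \<noteq> i; j \<noteq> i + 1\<rbrakk>
    \<Longrightarrow> wenzl_rel n \<omega> (fS i * fX j) (fX j * fS i)"
| EE: "i \<in> {1..<n} \<Longrightarrow> wenzl_rel n \<omega> (fE i ^ 2) (free_const (\<omega> 0) * fE i)"
| SE_comm: "\<lbrakk>i \<in> {1..<n}; j \<in> {1..<n}; i + 1 < j \<or> j + 1 < i\<rbrakk>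
    \<Longrightarrow> wenzl_rel n \<omega> (fS i * fE j) (fE j * fS i)"
| EE_comm: "\<lbrakk>i \<in> {1..<n}; j \<in> {1..<n}; i + 1 < j \<or> j + 1 < i\<rbrakk>
    \<Longrightarrow> wenzl_rel n \<omega> (fE i * fE j) (fE j * fE i)"
| EX_comm: "\<lbrakk>i \<in> {1..<n}; j \<in> {1..n}; j \<noteq> i; j \<noteq> i + 1\<rbrakk>
    \<Longrightarrow> wenzl_rel n \<omega> (fE i * fX j) (fX j * fE i)"
| XX_comm: "\<lbrakk>i \<in> {1..n}; j \<in> {1..n}\<rbrakk> \<Longrightarrow> wenzl_rel n \<omega> (fX i * fX j) (fX j * fX i)"
| skein_SX: "i \<in> {1..<n} \<Longrightarrow> wenzl_rel n \<omega> (fS i * fX i - fX (i + 1) * fS i) (fE i - 1)"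
| skein_XS: "i \<in> {1..<n} \<Longrightarrow> wenzl_rel n \<omega> (fX i * fS i - fS i * fX (i + 1)) (fE i - 1)"
| EXE: "\<lbrakk>1 \<in> {1..<n}; a > 0\<rbrakk>
    \<Longrightarrow> wenzl_rel n \<omega> (fE 1 * fX 1 ^ a * fE 1) (free_const (\<omega> a) * fE 1)"
| ES: "i \<in> {1..<n} \<Longrightarrow> wenzl_rel n \<omega> (fE i * fS i) (fE i)"
| SE: "i \<in> {1..<n} \<Longrightarrow> wenzl_rel n \<omega> (fS i * fE i) (fE i)"
| SEE: "\<lbrakk>i \<in> {1..<n}; i + 1 \<in> {1..<n}\<rbrakk>
    \<Longrightarrow> wenzl_rel n \<omega> (fS i * fE (i + 1) * fE i) (fS (i + 1) * fE i)"
| EES: "\<lbrakk>i \<in> {1..<n}; i + 1 \<in> {1..<n}\<rbrakk>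
    \<Longrightarrow> wenzl_rel n \<omega> (fE (i + 1) * fE i * fS (i + 1)) (fE (i + 1) * fS i)"
| EEE_down: "\<lbrakk>i \<in> {1..<n}; i + 1 \<in> {1..<n}\<rbrakk>
    \<Longrightarrow> wenzl_rel n \<omega> (fE (i + 1) * fE i * fE (i + 1)) (fE (i + 1))"
| EEE_up: "\<lbrakk>i \<in> {1..<n}; i + 1 \<in> {1..<n}\<rbrakk>
    \<Longrightarrow> wenzl_rel n \<omega> (fE i * fE (i + 1) * fE i) (fE i)"
| EX_anti: "i \<in> {1..<n} \<Longrightarrow> wenzl_rel n \<omega> (fE i * (fX i + fX (i + 1))) 0"
| XE_anti: "i \<in> {1..<n} \<Longrightarrow> wenzl_rel n \<omega> ((fX i + fX (i + 1)) * fE i) 0"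

definition affine_ideal :: "nat \<Rightarrow> (nat \<Rightarrow> 'a::field) \<Rightarrow> (wgen list \<Rightarrow>\<^sub>0 'a) set" where
  "affine_ideal n \<omega> = Idl\<^bsub>free_algebra (wgens n)\<^esub> {x - y |x y. wenzl_rel n \<omega> x y}"

definition affine_wenzl :: "nat \<Rightarrow> (nat \<Rightarrow> 'a::field) \<Rightarrow> (wgen list \<Rightarrow>\<^sub>0 'a) set ring" where
  "affine_wenzl n \<omega> = free_algebra (wgens n) Quot affine_ideal n \<omega>"

definition affine_elem :: "nat \<Rightarrow> (nat \<Rightarrow> 'a::field) \<Rightarrow> (wgen list \<Rightarrow>\<^sub>0 'a) \<Rightarrow> (wgen list \<Rightarrow>\<^sub>0 'a) set" where
  "affine_elem n \<omega> x = affine_ideal n \<omega> +>\<^bsub>free_algebra (wgens n)\<^esub> x"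

text \<open>The parameters \<open>u\<^sub>1, \<dots>, u\<^sub>r\<close> are \<open>u 1, \<dots>, u r\<close>; other values of \<open>u\<close> are never used.\<close>

definition cyclotomic_ideal ::
  "nat \<Rightarrow> nat \<Rightarrow> (nat \<Rightarrow> 'a::field) \<Rightarrow> (nat \<Rightarrow> 'a) \<Rightarrow> (wgen list \<Rightarrow>\<^sub>0 'a) set set" where
  "cyclotomic_ideal n r u \<omega> =
     Idl\<^bsub>affine_wenzl n \<omega>\<^esub> {affine_elem n \<omega> (\<Prod>i\<leftarrow>[1..<r + 1]. fX 1 - free_const (u i))}"

definition cyclotomic_wenzl ::
  "nat \<Rightarrow> nat \<Rightarrow> (nat \<Rightarrow> 'a::field) \<Rightarrow> (nat \<Rightarrow> 'a) \<Rightarrow> (wgen list \<Rightarrow>\<^sub>0 'a) set set ring" where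
  "cyclotomic_wenzl n r u \<omega> = affine_wenzl n \<omega> Quot cyclotomic_ideal n r u \<omega>"

definition cyclotomic_elem ::
  "nat \<Rightarrow> nat \<Rightarrow> (nat \<Rightarrow> 'a::field) \<Rightarrow> (nat \<Rightarrow> 'a) \<Rightarrow> (wgen list \<Rightarrow>\<^sub>0 'a) \<Rightarrow> (wgen list \<Rightarrow>\<^sub>0 'a) set set" where
  "cyclotomic_elem n r u \<omega> x = cyclotomic_ideal n r u \<omega> +>\<^bsub>affine_wenzl n \<omega>\<^esub> affine_elem n \<omega> x"

definition q_coeff :: "nat \<Rightarrow> (nat \<Rightarrow> 'a::field) \<Rightarrow> nat \<Rightarrow> 'a" where
  "q_coeff r u a =
     fps_nth (\<Prod>i = 1..r. (1 + fps_const (u i) * fps_X) / (1 - fps_const (u i) * fps_X)) a"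

definition u_admissible :: "nat \<Rightarrow> (nat \<Rightarrow> 'a::field) \<Rightarrow> (nat \<Rightarrow> 'a) \<Rightarrow> bool" where
  "u_admissible r u \<omega> \<longleftrightarrow>
     (\<forall>a. \<omega> a = q_coeff r u (a + 1) - 1 / 2 * (- 1) ^ r * q_coeff r u a + 1 / 2 * (if a = 0 then 1 else 0))"

definition generic :: "nat \<Rightarrow> nat \<Rightarrow> (nat \<Rightarrow> 'a::field) \<Rightarrow> bool" where
  "generic n r u \<longleftrightarrow>
     (\<forall>d::int.
        (\<exists>i\<in>{1..r}. \<exists>j\<in>{1..r}. i \<noteq> j \<and> (u i + u j = of_int d \<or> u i - u j = of_int d)) \<or>
        (\<exists>i\<in>{1..r}. 2 * u i = of_int d)
        \<longrightarrow> \<bar>d\<bar> \<ge> 2 * int n)"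

text \<open>
  The \<open>i\<close>-th part of \<open>lam\<^bsup>(s)\<^esup>\<close> is \<open>lam s i\<close>, with \<open>1 \<le> s \<le> r\<close> and \<open>i \<ge> 1\<close>; the values outside this
  range are \<open>0\<close>, so that equality of multipartitions is equality of functions. The empty
  multipartition is \<open>\<lambda>_ _. 0\<close>. A node is a triple (row, column, component), counted from \<open>1\<close>.
\<close>

type_synonym mpart = "nat \<Rightarrow> nat \<Rightarrow> nat"
type_synonym node = "nat \<times> nat \<times> nat"

definition is_partition :: "(nat \<Rightarrow> nat) \<Rightarrow> bool" where
  "is_partition p \<longleftrightarrow> p 0 = 0 \<and> (\<forall>i\<ge>1. p (i + 1) \<le> p i) \<and> finite {i. p i \<noteq> 0}"

definition is_multipartition :: "nat \<Rightarrow> mpart \<Rightarrow> bool" where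
  "is_multipartition r \<mu> \<longleftrightarrow>
     (\<forall>s\<in>{1..r}. is_partition (\<mu> s)) \<and> (\<forall>s. s \<notin> {1..r} \<longrightarrow> \<mu> s = (\<lambda>_. 0))"

definition mpart_size :: "nat \<Rightarrow> mpart \<Rightarrow> nat" where
  "mpart_size r \<mu> = (\<Sum>s = 1..r. \<Sum>i | \<mu> s i \<noteq> 0. \<mu> s i)"

definition adds_box :: "mpart \<Rightarrow> node \<Rightarrow> mpart \<Rightarrow> bool" where
  "adds_box lam \<alpha> \<mu> \<longleftrightarrow>
     (case \<alpha> of (i, j, s) \<Rightarrow> j = lam s i + 1 \<and> \<mu> = lam(s := (lam s)(i := j)))"

definition addable :: "nat \<Rightarrow> mpart \<Rightarrow> node \<Rightarrow> bool" where
  "addable r lam \<alpha> \<longleftrightarrow> (\<exists>\<mu>. is_multipartition r \<mu> \<and> adds_box lam \<alpha> \<mu>)"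

definition removable :: "nat \<Rightarrow> mpart \<Rightarrow> node \<Rightarrow> bool" where
  "removable r \<mu> \<alpha> \<longleftrightarrow> (\<exists>lam. is_multipartition r lam \<and> adds_box lam \<alpha> \<mu>)"

definition differ_by :: "mpart \<Rightarrow> node \<Rightarrow> mpart \<Rightarrow> bool" where
  "differ_by \<mu> \<alpha> \<nu> \<longleftrightarrow> adds_box \<nu> \<alpha> \<mu> \<or> adds_box \<mu> \<alpha> \<nu>"

definition box_diff :: "mpart \<Rightarrow> mpart \<Rightarrow> node"  (infixl "\<ominus>\<^sub>b" 65) where
  "\<mu> \<ominus>\<^sub>b \<nu> = (THE \<alpha>. differ_by \<mu> \<alpha> \<nu>)"

text \<open>
  An updown tableau is the list \<open>[\<tt>\<^sub>0, \<tt>\<^sub>1, \<dots>, \<tt>\<^sub>n]\<close> of length \<open>n + 1\<close>, including \<open>\<tt>\<^sub>0 = \<emptyset>\<close>, so that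
  \<open>\<tt>\<^sub>k\<close> is \<open>\<tt> ! k\<close>.
\<close>

type_synonym tableau = "mpart list"

definition updown_tableaux :: "nat \<Rightarrow> nat \<Rightarrow> mpart \<Rightarrow> tableau set" where
  "updown_tableaux n r lam =
     {\<tt>. length \<tt> = n + 1 \<and> (\<forall>k\<le>n. is_multipartition r (\<tt> ! k)) \<and>
         \<tt> ! 0 = (\<lambda>_ _. 0) \<and> \<tt> ! n = lam \<and>
         (\<forall>k\<in>{1..n}. \<exists>\<alpha>. differ_by (\<tt> ! k) \<alpha> (\<tt> ! (k - 1)))}"

definition tab_sim :: "nat \<Rightarrow> tableau \<Rightarrow> tableau \<Rightarrow> bool" where
  "tab_sim k \<uu> \<tt> \<longleftrightarrow> length \<uu> = length \<tt> \<and> (\<forall>j<length \<tt>. j \<noteq> k \<longrightarrow> \<uu> ! j = \<tt> ! j)"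

definition swap_defined :: "nat \<Rightarrow> tableau \<Rightarrow> bool" where
  "swap_defined k \<tt> \<longleftrightarrow>
     \<tt> ! (k - 1) \<noteq> \<tt> ! (k + 1) \<and>
     (case (\<tt> ! k \<ominus>\<^sub>b \<tt> ! (k - 1), \<tt> ! (k + 1) \<ominus>\<^sub>b \<tt> ! k) of
        ((i, j, s), (i', j', s')) \<Rightarrow> s \<noteq> s' \<or> (i \<noteq> i' \<and> j \<noteq> j'))"

definition swap_tab :: "nat \<Rightarrow> nat \<Rightarrow> tableau \<Rightarrow> tableau" where
  "swap_tab r k \<tt> =
     \<tt>[k := THE \<mu>. is_multipartition r \<mu> \<and>
              differ_by \<mu> (\<tt> ! (k - 1) \<ominus>\<^sub>b \<tt> ! k) (\<tt> ! (k + 1)) \<and>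
              differ_by (\<tt> ! (k - 1)) (\<tt> ! k \<ominus>\<^sub>b \<tt> ! (k + 1)) \<mu>]"

definition node_res :: "(nat \<Rightarrow> 'a::field) \<Rightarrow> node \<Rightarrow> 'a" where
  "node_res u \<alpha> = (case \<alpha> of (i, j, s) \<Rightarrow> u s + of_nat j - of_nat i)"

definition tab_content :: "(nat \<Rightarrow> 'a::field) \<Rightarrow> tableau \<Rightarrow> nat \<Rightarrow> 'a" where
  "tab_content u \<tt> k =
     (if \<exists>\<alpha>. adds_box (\<tt> ! (k - 1)) \<alpha> (\<tt> ! k) then node_res u (\<tt> ! k \<ominus>\<^sub>b \<tt> ! (k - 1))
      else - node_res u (\<tt> ! (k - 1) \<ominus>\<^sub>b \<tt> ! k))"

definition node_content :: "nat \<Rightarrow> (nat \<Rightarrow> 'a::field) \<Rightarrow> mpart \<Rightarrow> node \<Rightarrow> 'a" where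
  "node_content r u \<mu> \<alpha> = (if addable r \<mu> \<alpha> then node_res u \<alpha> else - node_res u \<alpha>)"

text \<open>
  A rational function over \<open>R\<close> is given as a function on the field \<open>R((z))\<close>; its residue at \<open>y = c\<close>
  is the coefficient of \<open>z\<^bsup>-1\<^esup>\<close> in its Laurent expansion at \<open>c\<close>, that is, in its value at \<open>y = c + z\<close>.
\<close>

definition residue_at :: "'a::field \<Rightarrow> ('a fls \<Rightarrow> 'a fls) \<Rightarrow> 'a" where
  "residue_at c F = fls_residue (F (fls_const c + fls_X))"

definition W_fun :: "nat \<Rightarrow> (nat \<Rightarrow> 'a::field) \<Rightarrow> nat \<Rightarrow> tableau \<Rightarrow> 'a fls \<Rightarrow> 'a fls" where
  "W_fun r u k \<tt> y =
     1 / 2 - y + (y - 1 / 2 * (- 1) ^ r) *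
       (\<Prod>\<alpha> | addable r (\<tt> ! (k - 1)) \<alpha> \<or> removable r (\<tt> ! (k - 1)) \<alpha>.
          (y + fls_const (node_content r u (\<tt> ! (k - 1)) \<alpha>)) /
          (y - fls_const (node_content r u (\<tt> ! (k - 1)) \<alpha>)))"

definition e_diag :: "nat \<Rightarrow> (nat \<Rightarrow> 'a::field) \<Rightarrow> nat \<Rightarrow> tableau \<Rightarrow> 'a" where
  "e_diag r u k \<tt> = residue_at (tab_content u \<tt> k) (\<lambda>y. W_fun r u k \<tt> y / y)"

text \<open>
  In the following, \<open>rt \<tt> k\<close> is the chosen square root of \<open>e\<^sub>\<tt>\<^sub>\<tt>(k)\<close> (used when
  \<open>\<tt>\<^sub>k\<^sub>-\<^sub>1 = \<tt>\<^sub>k\<^sub>+\<^sub>1\<close>) and \<open>b \<tt> k\<close> the chosen square root of \<open>1 - a\<^sub>\<tt>(k)\<^sup>2\<close> (used when \<open>\<tt>\<^sub>k\<^sub>-\<^sub>1 \<noteq> \<tt>\<^sub>k\<^sub>+\<^sub>1\<close>).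
\<close>

definition e_coeff ::
  "nat \<Rightarrow> (nat \<Rightarrow> 'a::field) \<Rightarrow> (tableau \<Rightarrow> nat \<Rightarrow> 'a) \<Rightarrow> nat \<Rightarrow> tableau \<Rightarrow> tableau \<Rightarrow> 'a" where
  "e_coeff r u rt k \<tt> \<uu> = (if \<uu> = \<tt> then e_diag r u k \<tt> else rt \<tt> k * rt \<uu> k)"

definition s_coeff ::
  "nat \<Rightarrow> (nat \<Rightarrow> 'a::field) \<Rightarrow> (tableau \<Rightarrow> nat \<Rightarrow> 'a) \<Rightarrow> nat \<Rightarrow> tableau \<Rightarrow> tableau \<Rightarrow> 'a" where
  "s_coeff r u rt k \<tt> \<uu> =
     (e_coeff r u rt k \<tt> \<uu> - (if \<tt> = \<uu> then 1 else 0)) / (tab_content u \<tt> k + tab_content u \<uu> k)"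

definition a_coeff :: "(nat \<Rightarrow> 'a::field) \<Rightarrow> nat \<Rightarrow> tableau \<Rightarrow> 'a" where
  "a_coeff u k \<tt> = 1 / (tab_content u \<tt> (k + 1) - tab_content u \<tt> k)"

text \<open>
  In the third condition the two sides are compared only if both are defined: \<open>S\<^sub>k\<^sub>+\<^sub>1\<tt>\<close> may have
  equal entries in positions \<open>k - 1\<close> and \<open>k + 1\<close>, and \<open>S\<^sub>k\<tt>\<close> in positions \<open>k\<close> and \<open>k + 2\<close>.
\<close>

definition root_conditions ::
  "nat \<Rightarrow> nat \<Rightarrow> (nat \<Rightarrow> 'a::field) \<Rightarrow> mpart \<Rightarrow> (tableau \<Rightarrow> nat \<Rightarrow> 'a) \<Rightarrow> (tableau \<Rightarrow> nat \<Rightarrow> 'a) \<Rightarrow> bool" where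
  "root_conditions n r u lam rt b \<longleftrightarrow>
    (let T = updown_tableaux n r lam;
         P = (\<lambda>k (\<tt>::tableau). \<tt> ! (k - 1) = \<tt> ! (k + 1))
     in
      (\<forall>\<tt>\<in>T. \<forall>k\<in>{1..<n}. P k \<tt> \<longrightarrow> rt \<tt> k ^ 2 = e_diag r u k \<tt>) \<and>
      (\<forall>\<tt>\<in>T. \<forall>k\<in>{1..<n}. \<not> P k \<tt> \<longrightarrow> b \<tt> k ^ 2 = 1 - a_coeff u k \<tt> ^ 2) \<and>
      (\<forall>\<tt>\<in>T. \<forall>k\<in>{1..<n}. \<not> P k \<tt> \<and> swap_defined k \<tt> \<longrightarrow> b (swap_tab r k \<tt>) k = b \<tt> k) \<and>
      (\<forall>\<tt>\<in>T. \<forall>\<uu>\<in>T. \<forall>k\<in>{1..<n}. \<forall>l\<in>{1..<n}.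
         \<not> P k \<tt> \<and> tab_sim l \<tt> \<uu> \<and> (k + 1 < l \<or> l + 1 < k) \<longrightarrow> b \<tt> k = b \<uu> k) \<and>
      (\<forall>\<tt>\<in>T. \<forall>k. k \<in> {1..<n} \<and> k + 1 \<in> {1..<n} \<longrightarrow>
         \<not> P k \<tt> \<and> \<not> P (k + 1) \<tt> \<and> swap_defined k \<tt> \<and> swap_defined (k + 1) \<tt> \<and>
         \<not> P k (swap_tab r (k + 1) \<tt>) \<and> \<not> P (k + 1) (swap_tab r k \<tt>) \<longrightarrow>
         b (swap_tab r (k + 1) \<tt>) k = b (swap_tab r k \<tt>) (k + 1)) \<and>
      (\<forall>\<tt>\<in>T. \<forall>k. k \<in> {1..<n} \<and> k + 1 \<in> {1..<n} \<longrightarrow>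
         P k \<tt> \<and> P (k + 1) \<tt> \<longrightarrow> rt \<tt> k * rt \<tt> (k + 1) = 1) \<and>
      (\<forall>\<tt>\<in>T. \<forall>\<uu>\<in>T. \<forall>k\<in>{1..<n}.
         P k \<tt> \<and> P k \<uu> \<and> e_diag r u k \<tt> = e_diag r u k \<uu> \<longrightarrow> rt \<tt> k = rt \<uu> k) \<and>
      (\<forall>\<tt>\<in>T. \<forall>\<uu>\<in>T. \<forall>\<ww>\<in>T. \<forall>k. k \<in> {1..<n} \<and> k + 1 \<in> {1..<n} \<longrightarrow>
         P k \<tt> \<and> P (k + 1) \<tt> \<and> tab_sim (k + 1) \<uu> \<tt> \<and> tab_sim k \<ww> \<tt> \<and>
         swap_defined k \<uu> \<and> swap_defined (k + 1) \<ww> \<and> swap_tab r k \<uu> = swap_tab r (k + 1) \<ww> \<longrightarrow>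
         b \<uu> k * rt \<uu> (k + 1) = b \<ww> (k + 1) * rt \<ww> k))"

definition seminormal_space :: "nat \<Rightarrow> nat \<Rightarrow> mpart \<Rightarrow> (tableau \<Rightarrow>\<^sub>0 'a::field) set" where
  "seminormal_space n r lam = {f. Poly_Mapping.keys f \<subseteq> updown_tableaux n r lam}"

definition basis_vec :: "tableau \<Rightarrow> tableau \<Rightarrow>\<^sub>0 'a::field" where
  "basis_vec \<tt> = Poly_Mapping.single \<tt> 1"

definition vscale :: "'a::field \<Rightarrow> (tableau \<Rightarrow>\<^sub>0 'a) \<Rightarrow> tableau \<Rightarrow>\<^sub>0 'a"  (infixr "*\<^sub>v" 75) where
  "c *\<^sub>v f = Poly_Mapping.map ((*) c) f"

end

theory Submission
  imports Defs
begin

text \<open>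
  Encoding the components of a multipartition by Maya diagrams turns adding and removing a box into
  the same kind of move, carrying a sign and a label (component and diagonal), and genericity makes
  the signed content of a step determine its sign and label. Hence a tableau is determined by its
  contents, and an operator that intertwines the \<open>X\<^sub>j\<close> up to a permutation of the indices has at
  most one nonzero entry in each row.

  This replaces most of the case analysis. The skein relations give that \<open>S\<^sub>k\<^sup>2\<close> commutes with all
  \<open>X\<^sub>j\<close>, so it is diagonal, and \<open>E\<^sub>k S\<^sub>k\<^sup>2 = E\<^sub>k\<close> with \<open>e\<^sub>\<tt>\<^sub>\<tt>(k) \<noteq> 0\<close> makes it the identity where
  \<open>\<tt>\<^sub>k\<^sub>-\<^sub>1 = \<tt>\<^sub>k\<^sub>+\<^sub>1\<close>. Likewise \<open>B = S\<^sub>k S\<^sub>k\<^sub>+\<^sub>1 S\<^sub>k - S\<^sub>k\<^sub>+\<^sub>1 S\<^sub>k S\<^sub>k\<^sub>+\<^sub>1\<close> reverses three consecutive contents and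
  is annihilated by \<open>E\<^sub>k\<close>. A path of three steps and its reversal both exist only if the three labels
  pairwise commute, where the two triple products agree by the root conditions, or coincide, where
  \<open>E\<^sub>k B = 0\<close> applies. The relations between \<open>S\<close> and \<open>E\<close> reduce to \<open>S\<^sub>k E\<^sub>k\<^sub>+\<^sub>1 E\<^sub>k = S\<^sub>k\<^sub>+\<^sub>1 E\<^sub>k\<close> because all
  matrices are symmetric; \<open>E\<^sub>k\<^sup>2 = \<omega>\<^sub>0 E\<^sub>k\<close> reduces to \<open>k = 1\<close> by conjugation; and \<open>S\<^sub>k E\<^sub>k = E\<^sub>k\<close> and
  \<open>E\<^sub>1 X\<^sub>1\<^sup>a E\<^sub>1 = \<omega>\<^sub>a E\<^sub>1\<close> are partial fraction identities for the residues \<open>e\<^sub>\<tt>\<^sub>\<tt>(k)\<close>.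
\<close>

section \<open>Moves of boxes in multipartitions\<close>

text \<open>A step of sign \<epsilon> and label l requires weight \<epsilon> at l and subtracts
  \<epsilon> times the row of l in a Cartan matrix of type A_infinity. Two labels therefore
  coincide, interfere or commute according to the entry 2, -1 or 0, and this trichotomy stands in
  for arguments about rows and columns; the row and column test in the definition of S_k t is
  translated only once, in \<open>far_iff\<close>. Genericity suffices because the diagonals met in
  n steps are below n in absolute value, so that comparing two contents produces integers below 2n.
  Each root condition has its own place: (a) makes S_k symmetric, (b) and (e) give the commutation
  of distant operators, (d) gives E_k E_{k+1} E_k = E_k and its mirror image, (d) and (f) give S_k
  E_{k+1} E_k = S_{k+1} E_k, and (c) enters in the braid relation for three commuting labels. The
  set T of tableaux depends on variables and cannot index a type. Operators therefore act on the
  space over all tableaux, and the representation takes values in the corner cut out by the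
  projection onto the span of T.\<close>

lemma multipartition_antimono:
  assumes "is_multipartition r \<mu>" "1 \<le> i" "i \<le> i'"
  shows "\<mu> s i' \<le> \<mu> s i"
proof (cases "s \<in> {1..r}")
  case True
  hence le: "\<mu> s (k + 1) \<le> \<mu> s k" if "1 \<le> k" for k
    using assms that by (auto simp: is_multipartition_def is_partition_def)
  from assms(3) show ?thesis
  proof (induction i' rule: dec_induct)
    case (step k)
    thus ?case using le[of k] assms(2) by simp
  qed simp
qed (use assms in \<open>auto simp: is_multipartition_def\<close>)

text \<open>A partition is encoded by its Maya diagram \<open>{\<lambda>\<^sub>i - i}\<close>: a bead at \<open>c - 1\<close> and a gap at \<open>c\<close> is an addable
  node of content \<open>c\<close>, the reverse a removable one. The weight records which of the two occurs.\<close>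

definition bead :: "mpart \<Rightarrow> nat \<Rightarrow> int \<Rightarrow> bool" where
  "bead \<mu> s c \<longleftrightarrow> (\<exists>i\<ge>1. int (\<mu> s i) - int i = c)"

definition weight :: "mpart \<Rightarrow> nat \<times> int \<Rightarrow> int" where
  "weight \<mu> l = of_bool (bead \<mu> (fst l) (snd l - 1)) - of_bool (bead \<mu> (fst l) (snd l))"

text \<open>The Cartan matrix with one copy of type A_infinity for each component, indexed by
  component and diagonal.\<close>

definition cartan :: "nat \<times> int \<Rightarrow> nat \<times> int \<Rightarrow> int" where
  "cartan l l' = (if fst l \<noteq> fst l' then 0 else if snd l = snd l' then 2
     else if \<bar>snd l - snd l'\<bar> = 1 then - 1 else 0)"

definition node_label :: "node \<Rightarrow> nat \<times> int" where
  "node_label \<alpha> = (case \<alpha> of (i, j, s) \<Rightarrow> (s, int j - int i))"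

text \<open>One relation for both directions, so that reversing a step negates \<epsilon> and keeps
  the box. The column \<open>j\<close> is that of the box itself: the row length of \<mu> plus one
  if the box is added, the row length of \<mu> if it is removed.\<close>

definition move :: "nat \<Rightarrow> mpart \<Rightarrow> int \<Rightarrow> node \<Rightarrow> mpart \<Rightarrow> bool" where
  "move r \<mu> \<epsilon> \<alpha> \<nu> \<longleftrightarrow> is_multipartition r \<mu> \<and> is_multipartition r \<nu> \<and> (\<epsilon> = 1 \<or> \<epsilon> = - 1) \<and>
     (case \<alpha> of (i, j, s) \<Rightarrow>
       (\<forall>s' i'. int (\<nu> s' i') = int (\<mu> s' i') + (if s' = s \<and> i' = i then \<epsilon> else 0)) \<and>
       int j = int (\<mu> s i) + (if \<epsilon> = 1 then 1 else 0))"

lemma cartan_commute: "cartan l l' = cartan l' l"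
  by (auto simp: cartan_def)

lemma cartan_self [simp]: "cartan l l = 2"
  by (simp add: cartan_def)

text \<open>The numbers \<open>\<mu> s i - i\<close> strictly decrease with \<open>i\<close>, so a
  bead can be traced back to its row.\<close>

lemma bead_inj:
  assumes "is_multipartition r \<mu>" "1 \<le> i" "1 \<le> i'" "int (\<mu> s i) - int i = int (\<mu> s i') - int i'"
  shows "i = i'"
  using multipartition_antimono[OF assms(1,2), of i' s] multipartition_antimono[OF assms(1,3), of i s] assms(4)
  by linarith

lemma moveD:
  assumes "move r \<mu> \<epsilon> (i, j, s) \<nu>"
  shows "is_multipartition r \<mu>" "is_multipartition r \<nu>" "\<epsilon> = 1 \<or> \<epsilon> = - 1"
    "\<And>s' i'. int (\<nu> s' i') = int (\<mu> s' i') + (if s' = s \<and> i' = i then \<epsilon> else 0)"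
    "int j = int (\<mu> s i) + (if \<epsilon> = 1 then 1 else 0)"
  using assms by (auto simp: move_def)

lemma move_multipartition:
  assumes "move r \<mu> \<epsilon> \<alpha> \<nu>"
  shows "is_multipartition r \<mu>" "is_multipartition r \<nu>"
  using assms by (auto simp: move_def)

lemma move_sign: "move r \<mu> \<epsilon> \<alpha> \<nu> \<Longrightarrow> \<epsilon> = 1 \<or> \<epsilon> = - 1"
  by (simp add: move_def)

lemma move_sym: "move r \<mu> \<epsilon> \<alpha> \<nu> \<Longrightarrow> move r \<nu> (- \<epsilon>) \<alpha> \<mu>"
  by (cases \<alpha>) (auto simp: move_def)

lemma move_adds_box:
  assumes "is_multipartition r \<mu>" "is_multipartition r \<nu>"
  shows "move r \<mu> 1 \<alpha> \<nu> \<longleftrightarrow> adds_box \<mu> \<alpha> \<nu>"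
proof (cases \<alpha>)
  case (fields i j s)
  have 1: "(int (\<nu> s' i') = int (\<mu> s' i') + (if s' = s \<and> i' = i then 1 else 0)) \<longleftrightarrow>
      \<nu> s' i' = (\<mu>(s := (\<mu> s)(i := \<mu> s i + 1))) s' i'" for s' i' by auto
  have 2: "int j = int (\<mu> s i) + 1 \<longleftrightarrow> j = \<mu> s i + 1" by auto
  have 3: "(\<forall>s' i'. int (\<nu> s' i') = int (\<mu> s' i') + (if s' = s \<and> i' = i then 1 else 0)) \<longleftrightarrow>
      \<nu> = \<mu>(s := (\<mu> s)(i := \<mu> s i + 1))"
    unfolding 1 by (simp only: fun_eq_iff)
  show ?thesis
    unfolding move_def fields prod.case 3 adds_box_def using assms 2 by auto
qed

lemma move_minus_adds_box:
  assumes "is_multipartition r \<mu>" "is_multipartition r \<nu>"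
  shows "move r \<mu> (- 1) \<alpha> \<nu> \<longleftrightarrow> adds_box \<nu> \<alpha> \<mu>"
  using move_adds_box[OF assms(2,1)] move_sym[of r \<mu> "-1" \<alpha> \<nu>] move_sym[of r \<nu> 1 \<alpha> \<mu>] by auto

lemma move_position:
  assumes "move r \<mu> \<epsilon> (i, j, s) \<nu>"
  shows "1 \<le> i" "1 \<le> j" "s \<in> {1..r}"
proof -
  note m = moveD[OF assms]
  have ne: "\<mu> s i \<noteq> \<nu> s i" using m(3) m(4)[of s i] by auto
  show s: "s \<in> {1..r}"
  proof (rule ccontr)
    assume "s \<notin> {1..r}"
    hence "\<mu> s = (\<lambda>_. 0)" "\<nu> s = (\<lambda>_. 0)" using m(1,2) unfolding is_multipartition_def by blast+
    thus False using ne by simp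
  qed
  hence "\<mu> s 0 = 0" "\<nu> s 0 = 0" using m(1,2) by (auto simp: is_multipartition_def is_partition_def)
  thus "1 \<le> i" using ne by (cases i) auto
  show "1 \<le> j" using m(3) m(4)[of s i] m(5) by auto
qed

text \<open>Lengthening row \<open>i\<close> shifts its bead one place to the right. No other row
  occupies the new place beforehand, by \<open>bead_inj\<close> for \<nu>, or the old place
  afterwards, by \<open>bead_inj\<close> for \<mu>.\<close>

lemma bead_add:
  assumes mv: "move r \<mu> 1 (i, j, s) \<nu>"
  shows "bead \<mu> s (int j - int i - 1)" "\<not> bead \<mu> s (int j - int i)"
    "bead \<nu> s' c \<longleftrightarrow> (if s' = s \<and> c = int j - int i then True
       else if s' = s \<and> c = int j - int i - 1 then False else bead \<mu> s' c)"
proof -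
  note m = moveD[OF mv]
  note p = move_position[OF mv]
  have eq: "\<nu> s' i' = \<mu> s' i' + (if s' = s \<and> i' = i then 1 else 0)" for s' i' using m(4)[of s' i'] by auto
  have j: "int j = int (\<mu> s i) + 1" using m(5) by simp
  show 1: "bead \<mu> s (int j - int i - 1)" using p j unfolding bead_def by (intro exI[of _ i]) auto
  have \<nu>1: "bead \<nu> s (int j - int i)" using p j unfolding bead_def by (intro exI[of _ i]) (auto simp: eq)
  show 2: "\<not> bead \<mu> s (int j - int i)"
  proof
    assume "bead \<mu> s (int j - int i)"
    then obtain i' where i': "1 \<le> i'" "int (\<mu> s i') - int i' = int j - int i" by (auto simp: bead_def)
    have "i \<noteq> i'" using i' j by auto
    have "\<nu> s i' = \<mu> s i'" using eq \<open>i \<noteq> i'\<close> by auto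
    hence "int (\<nu> s i') - int i' = int (\<nu> s i) - int i" using i' j eq by auto
    with bead_inj[OF m(2) p(1) i'(1)] \<open>i \<noteq> i'\<close> show False by metis
  qed
  have 3: "\<not> bead \<nu> s (int j - int i - 1)"
  proof
    assume "bead \<nu> s (int j - int i - 1)"
    then obtain i' where i': "1 \<le> i'" "int (\<nu> s i') - int i' = int j - int i - 1" by (auto simp: bead_def)
    have "i \<noteq> i'" using i' j eq by auto
    have "\<nu> s i' = \<mu> s i'" using eq \<open>i \<noteq> i'\<close> by auto
    hence "int (\<mu> s i') - int i' = int (\<mu> s i) - int i" using i' j eq by auto
    with bead_inj[OF m(1) p(1) i'(1)] \<open>i \<noteq> i'\<close> show False by metis
  qed
  have 4: "bead \<nu> s' c \<longleftrightarrow> bead \<mu> s' c" if "\<not> (s' = s \<and> (c = int j - int i \<or> c = int j - int i - 1))"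
  proof -
    have "(int (\<nu> s' i') - int i' = c) \<longleftrightarrow> (int (\<mu> s' i') - int i' = c)" for i'
      using that eq[of s' i'] j by (cases "s' = s \<and> i' = i") auto
    thus ?thesis by (simp add: bead_def)
  qed
  show "bead \<nu> s' c \<longleftrightarrow> (if s' = s \<and> c = int j - int i then True
       else if s' = s \<and> c = int j - int i - 1 then False else bead \<mu> s' c)"
    using \<nu>1 3 4 by auto
qed

text \<open>A bead moved from c - 1 to c changes the weights on the diagonals c - 1, c, c + 1 by 1,
  -2, 1 and no others. This is the subtraction of a simple root, the weights being the values on the
  simple coroots.\<close>

lemma move_weight_add:
  assumes mv: "move r \<mu> 1 \<alpha> \<nu>"
  shows "weight \<mu> (node_label \<alpha>) = 1" "weight \<nu> l = weight \<mu> l - cartan (node_label \<alpha>) l"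
proof -
  obtain i j s where [simp]: "\<alpha> = (i, j, s)" by (cases \<alpha>)
  note b = bead_add[OF mv[simplified]]
  show "weight \<mu> (node_label \<alpha>) = 1" using b by (simp add: weight_def node_label_def)
  show "weight \<nu> l = weight \<mu> l - cartan (node_label \<alpha>) l"
    using b(1,2) by (cases l) (auto simp: weight_def node_label_def cartan_def b(3))
qed

lemma move_weight:
  assumes mv: "move r \<mu> \<epsilon> \<alpha> \<nu>"
  shows "weight \<mu> (node_label \<alpha>) = \<epsilon>" "weight \<nu> l = weight \<mu> l - \<epsilon> * cartan (node_label \<alpha>) l"
proof -
  consider "\<epsilon> = 1" | "\<epsilon> = - 1" using mv by (auto simp: move_def)
  hence "weight \<mu> (node_label \<alpha>) = \<epsilon> \<and> weight \<nu> l = weight \<mu> l - \<epsilon> * cartan (node_label \<alpha>) l"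
  proof cases
    case 1
    thus ?thesis using move_weight_add[of r \<mu> \<alpha> \<nu>] mv by simp
  next
    case 2
    hence "move r \<nu> 1 \<alpha> \<mu>" using move_sym[OF mv] by simp
    from move_weight_add[OF this] show ?thesis using 2 by simp
  qed
  thus "weight \<mu> (node_label \<alpha>) = \<epsilon>" "weight \<nu> l = weight \<mu> l - \<epsilon> * cartan (node_label \<alpha>) l" by auto
qed

lemma weight_range: "weight \<mu> l \<in> {- 1, 0, 1}"
  by (auto simp: weight_def)

lemma move_row:
  assumes "move r \<mu> \<epsilon> (i, j, s) \<nu>"
  shows "int (\<mu> s i) - int i = int j - int i - (if \<epsilon> = 1 then 1 else 0)"
  using moveD(5)[OF assms] by simp

text \<open>The sign is the weight at the label, and sign and diagonal together locate the bead that
  moves, hence the row.\<close>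

lemma move_unique:
  assumes m: "move r \<mu> \<epsilon> \<alpha> \<nu>" and m': "move r \<mu> \<epsilon>' \<alpha>' \<nu>'" and l: "node_label \<alpha> = node_label \<alpha>'"
  shows "\<epsilon> = \<epsilon>'" "\<alpha> = \<alpha>'" "\<nu> = \<nu>'"
proof -
  show e: "\<epsilon> = \<epsilon>'" using move_weight(1)[OF m] move_weight(1)[OF m'] l by simp
  obtain i j s i' j' where [simp]: "\<alpha> = (i, j, s)" "\<alpha>' = (i', j', s)" and c: "int j - int i = int j' - int i'"
    using l by (cases \<alpha>; cases \<alpha>') (auto simp: node_label_def)
  have i: "i = i'"
    using m m' c e by (intro bead_inj[of r \<mu> _ _ s])
      (auto simp: move_row[OF m[simplified]] move_row[OF m'[simplified]] dest: moveD(1) move_position(1))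
  show "\<alpha> = \<alpha>'" using c i by simp
  have "int (\<nu> s' k) = int (\<nu>' s' k)" for s' k
    using moveD(4)[OF m[simplified], of s' k] moveD(4)[OF m'[simplified], of s' k] unfolding i e by simp
  thus "\<nu> = \<nu>'" by (auto simp: fun_eq_iff)
qed

text \<open>The bead that makes the weight nonzero names the row to be changed, and the gap beside
  it says that the neighbouring row leaves room for the change.\<close>

lemma move_exists:
  assumes mu: "is_multipartition r \<mu>" and s: "s \<in> {1..r}" and w: "weight \<mu> (s, c) = \<epsilon>" "\<epsilon> \<noteq> 0"
  obtains \<alpha> \<nu> where "move r \<mu> \<epsilon> \<alpha> \<nu>" "node_label \<alpha> = (s, c)"
proof -
  have part: "is_partition (\<mu> s)" using mu s by (auto simp: is_multipartition_def)
  hence fin: "finite {i. \<mu> s i \<noteq> 0}" and z: "\<mu> s 0 = 0" by (auto simp: is_partition_def)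
  have build: "is_multipartition r (\<mu>(s := (\<mu> s)(i := v)))"
    if i: "1 \<le> i" and up: "i = 1 \<or> v \<le> \<mu> s (i - 1)" and dn: "\<mu> s (i + 1) \<le> v" for i v
  proof -
    have "finite {k. ((\<mu> s)(i := v)) k \<noteq> 0}"
      by (rule finite_subset[of _ "insert i {i. \<mu> s i \<noteq> 0}"]) (use fin in auto)
    moreover have "((\<mu> s)(i := v)) (k + 1) \<le> ((\<mu> s)(i := v)) k" if "1 \<le> k" for k
      using up dn part that i by (auto simp: is_partition_def)
    ultimately have "is_partition ((\<mu> s)(i := v))" using z i by (auto simp: is_partition_def)
    thus ?thesis using mu s by (auto simp: is_multipartition_def)
  qed
  consider "\<epsilon> = 1" "bead \<mu> s (c - 1)" "\<not> bead \<mu> s c" | "\<epsilon> = - 1" "\<not> bead \<mu> s (c - 1)" "bead \<mu> s c"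
    using w by (cases "bead \<mu> s (c - 1)"; cases "bead \<mu> s c") (auto simp: weight_def)
  thus ?thesis
  proof cases
    case 1
    then obtain i where i: "1 \<le> i" "int (\<mu> s i) - int i = c - 1" by (auto simp: bead_def)
    have "\<mu> s i + 1 \<le> \<mu> s (i - 1)" if "i \<noteq> 1"
    proof (rule ccontr)
      assume "\<not> ?thesis"
      moreover have "\<mu> s i \<le> \<mu> s (i - 1)" using i that by (intro multipartition_antimono[OF mu]) auto
      ultimately have "int (\<mu> s (i - 1)) - int (i - 1) = c" using i that by (simp add: of_nat_diff)
      hence "bead \<mu> s c" using i that unfolding bead_def by (intro exI[of _ "i - 1"]) auto
      with 1 show False by simp
    qed
    hence "is_multipartition r (\<mu>(s := (\<mu> s)(i := \<mu> s i + 1)))"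
      using i multipartition_antimono[OF mu, of i "i + 1" s] by (intro build) auto
    hence "move r \<mu> 1 (i, \<mu> s i + 1, s) (\<mu>(s := (\<mu> s)(i := \<mu> s i + 1)))"
      using mu by (auto simp: move_def)
    moreover have "node_label (i, \<mu> s i + 1, s) = (s, c)" using i by (auto simp: node_label_def)
    ultimately show ?thesis using that 1 by blast
  next
    case 2
    then obtain i where i: "1 \<le> i" "int (\<mu> s i) - int i = c" by (auto simp: bead_def)
    have lt: "\<mu> s (i + 1) < \<mu> s i"
    proof (rule ccontr)
      assume "\<not> ?thesis"
      moreover have "\<mu> s (i + 1) \<le> \<mu> s i" using i by (intro multipartition_antimono[OF mu]) auto
      ultimately have "int (\<mu> s (i + 1)) - int (i + 1) = c - 1" using i by simp
      hence "bead \<mu> s (c - 1)" using i unfolding bead_def by (intro exI[of _ "i + 1"]) auto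
      with 2 show False by simp
    qed
    have "is_multipartition r (\<mu>(s := (\<mu> s)(i := \<mu> s i - 1)))"
      using i lt multipartition_antimono[OF mu, of "i - 1" i s] by (intro build) fastforce+
    hence "move r \<mu> (- 1) (i, \<mu> s i, s) (\<mu>(s := (\<mu> s)(i := \<mu> s i - 1)))"
      using mu lt by (auto simp: move_def of_nat_diff)
    moreover have "node_label (i, \<mu> s i, s) = (s, c)" using i by (auto simp: node_label_def)
    ultimately show ?thesis using that 2 by blast
  qed
qed

lemma move_box_unique:
  assumes m: "move r \<mu> \<epsilon> \<alpha> \<nu>" and m': "move r \<mu> \<epsilon>' \<alpha>' \<nu>"
  shows "\<epsilon> = \<epsilon>'" "\<alpha> = \<alpha>'"
proof -
  obtain i j s i' j' s' where [simp]: "\<alpha> = (i, j, s)" "\<alpha>' = (i', j', s')" by (cases \<alpha>; cases \<alpha>')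
  note a = moveD[OF m[simplified]] and b = moveD[OF m'[simplified]]
  have "s = s' \<and> i = i' \<and> \<epsilon> = \<epsilon>'" using a(3) b(3) a(4)[of s i] b(4)[of s i] by (auto split: if_splits)
  thus "\<epsilon> = \<epsilon>'" "\<alpha> = \<alpha>'" using a(5) b(5) by auto
qed

lemma differ_by_move:
  assumes "is_multipartition r \<mu>" "is_multipartition r \<nu>"
  shows "differ_by \<nu> \<alpha> \<mu> \<longleftrightarrow> (\<exists>\<epsilon>. move r \<mu> \<epsilon> \<alpha> \<nu>)"
proof -
  have "\<epsilon> = 1 \<or> \<epsilon> = - 1" if "move r \<mu> \<epsilon> \<alpha> \<nu>" for \<epsilon>
    using that by (simp add: move_def)
  hence "(\<exists>\<epsilon>. move r \<mu> \<epsilon> \<alpha> \<nu>) \<longleftrightarrow> move r \<mu> 1 \<alpha> \<nu> \<or> move r \<mu> (- 1) \<alpha> \<nu>"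
    by blast
  thus ?thesis using move_adds_box[OF assms] move_minus_adds_box[OF assms] by (auto simp: differ_by_def)
qed

lemma box_diff_move:
  assumes "move r \<mu> \<epsilon> \<alpha> \<nu>"
  shows "\<nu> \<ominus>\<^sub>b \<mu> = \<alpha>" "\<mu> \<ominus>\<^sub>b \<nu> = \<alpha>"
proof -
  have mp: "is_multipartition r \<mu>" "is_multipartition r \<nu>" using assms by (auto simp: move_def)
  show "\<nu> \<ominus>\<^sub>b \<mu> = \<alpha>"
    unfolding box_diff_def differ_by_move[OF mp]
    using assms move_box_unique(2) by (intro the_equality) blast+
  thus "\<mu> \<ominus>\<^sub>b \<nu> = \<alpha>" by (simp add: box_diff_def differ_by_def disj_commute)
qed

section \<open>Two consecutive moves: returning, interfering, commuting\<close>

lemma move_back_iff: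
  assumes "move r \<mu> \<epsilon> \<alpha> \<nu>" "move r \<nu> \<eta> \<beta> \<rho>"
  shows "\<rho> = \<mu> \<longleftrightarrow> node_label \<alpha> = node_label \<beta>"
  using move_box_unique(2)[OF move_sym[OF assms(1)]] move_unique(3)[OF move_sym[OF assms(1)] assms(2)] assms(2)
  by metis

text \<open>The first step raises the weight at an adjacent label by \<epsilon>, and \<eta> is the
  weight found there afterwards. If \<eta> were -\<epsilon>, the weight before would have been
  -2\<epsilon>, out of range.\<close>

lemma move_move_adjacent:
  assumes m: "move r \<mu> \<epsilon> \<alpha> \<nu>" "move r \<nu> \<eta> \<beta> \<rho>" and c: "cartan (node_label \<alpha>) (node_label \<beta>) = - 1"
  shows "\<epsilon> = \<eta>"
proof -
  have "\<eta> = weight \<mu> (node_label \<beta>) + \<epsilon>" using move_weight(2)[OF m(1), of "node_label \<beta>"] move_weight(1)[OF m(2)] c by simp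
  moreover have "\<epsilon> \<in> {1, -1}" "\<eta> \<in> {1, -1}" using m by (auto simp: move_def)
  ultimately show ?thesis using weight_range[of \<mu> "node_label \<beta>"] by auto
qed

lemma cartan_cases: "cartan l l' = 2 \<and> l = l' \<or> cartan l l' = - 1 \<or> cartan l l' = 0"
  by (cases l; cases l') (auto simp: cartan_def)

lemma same_row_not_far:
  assumes "move r \<mu> \<epsilon> (i, j, s) \<nu>" "move r \<nu> \<eta> (i, j', s) \<rho>"
  shows "cartan (node_label (i, j, s)) (node_label (i, j', s)) \<noteq> 0"
  using moveD[OF assms(1)] moveD(3,5)[OF assms(2)] moveD(4)[OF assms(1), of s i]
  by (auto simp: cartan_def node_label_def split: if_splits)

text \<open>A step leaves the weight at an orthogonal label unchanged, so both steps exist in either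
  order. They lie in different rows, so in both orders the same two beads move, the boxes are the
  same, and the end points agree.\<close>

lemma diamond:
  assumes m: "move r \<mu> \<epsilon> \<alpha> \<nu>" "move r \<nu> \<eta> \<beta> \<rho>" and far: "cartan (node_label \<alpha>) (node_label \<beta>) = 0"
  obtains \<nu>' where "move r \<mu> \<eta> \<beta> \<nu>'" "move r \<nu>' \<epsilon> \<alpha> \<rho>"
proof -
  obtain i j s i' j' s' where ab [simp]: "\<alpha> = (i, j, s)" "\<beta> = (i', j', s')" by (cases \<alpha>; cases \<beta>)
  note m1 = moveD[OF m(1)[simplified]] and m2 = moveD[OF m(2)[simplified]]
  note p1 = move_position[OF m(1)[simplified]] and p2 = move_position[OF m(2)[simplified]]
  have ne: "\<not> (s = s' \<and> i = i')" using same_row_not_far m far by auto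
  have "weight \<mu> (node_label \<beta>) = \<eta>" using move_weight(2)[OF m(1), of "node_label \<beta>"] move_weight(1)[OF m(2)] far by simp
  hence w: "weight \<mu> (s', int j' - int i') = \<eta>" "\<eta> \<noteq> 0" using m2(3) by (auto simp: node_label_def)
  obtain \<beta>' \<nu>' where b': "move r \<mu> \<eta> \<beta>' \<nu>'" "node_label \<beta>' = (s', int j' - int i')"
    using move_exists[OF m1(1) p2(3) w] by blast
  obtain i'' j'' where [simp]: "\<beta>' = (i'', j'', s')" and c: "int j'' - int i'' = int j' - int i'"
    using b'(2) by (cases \<beta>') (auto simp: node_label_def)
  have "int (\<mu> s' i'') - int i'' = int (\<mu> s' i') - int i'"
    using move_row[OF b'(1)[simplified]] move_row[OF m(2)[simplified]] c m1(4)[of s' i'] ne by auto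
  hence "i'' = i'" using bead_inj[OF m1(1)] p2(1) move_position(1)[OF b'(1)[simplified]] by blast
  hence b: "\<beta>' = \<beta>" using c by simp
  note n = moveD[OF b'(1)[unfolded b ab(2)]]
  have "weight \<nu>' (node_label \<alpha>) = \<epsilon>"
    using move_weight(2)[OF b'(1)] move_weight(1)[OF m(1)] far b by (simp add: cartan_commute)
  hence w: "weight \<nu>' (s, int j - int i) = \<epsilon>" "\<epsilon> \<noteq> 0" using m1(3) by (auto simp: node_label_def)
  obtain \<alpha>' \<rho>' where a': "move r \<nu>' \<epsilon> \<alpha>' \<rho>'" "node_label \<alpha>' = (s, int j - int i)"
    using move_exists[OF n(2) p1(3) w] by blast
  obtain k l where [simp]: "\<alpha>' = (k, l, s)" and c: "int l - int k = int j - int i"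
    using a'(2) by (cases \<alpha>') (auto simp: node_label_def)
  have "int (\<nu>' s k) - int k = int (\<nu>' s i) - int i"
    using move_row[OF a'(1)[simplified]] move_row[OF m(1)[simplified]] c n(4)[of s i] ne by auto
  hence "k = i" using bead_inj[OF n(2)] p1(1) move_position(1)[OF a'(1)[simplified]] by blast
  hence a: "\<alpha>' = \<alpha>" using c by simp
  note q = moveD[OF a'(1)[unfolded a ab(1)]]
  have "\<rho>' t k = \<rho> t k" for t k
    using q(4)[of t k] n(4)[of t k] m2(4)[of t k] m1(4)[of t k] by simp
  hence "\<rho>' = \<rho>" by (auto simp: fun_eq_iff)
  with that a' b' a b show ?thesis by simp
qed

text \<open>Of the three diagonals near that of the first box, its own is excluded because the
  weight there has become -1, the next higher one forces the same row, and the next lower one forces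
  the same column. Conversely a second box in the same column lies directly below the first.\<close>

lemma add_add_far_iff:
  assumes m: "move r \<mu> 1 (i, j, s) \<nu>" "move r \<nu> 1 (i', j', s) \<rho>"
  shows "cartan (node_label (i, j, s)) (node_label (i', j', s)) = 0 \<longleftrightarrow> i \<noteq> i' \<and> j \<noteq> j'"
proof -
  note m1 = moveD[OF m(1)] and m2 = moveD[OF m(2)]
  note p1 = move_position[OF m(1)] and p2 = move_position[OF m(2)]
  have nu: "\<nu> s k = \<mu> s k + (if k = i then 1 else 0)" for k using m1(4)[of s k] by auto
  have rho: "\<rho> s k = \<nu> s k + (if k = i' then 1 else 0)" for k using m2(4)[of s k] by auto
  have j: "j = \<mu> s i + 1" "j' = \<nu> s i' + 1" using m1(5) m2(5) by auto
  note mu_le = multipartition_antimono[OF m1(1), of _ _ s] and nu_le = multipartition_antimono[OF m1(2), of _ _ s]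
    and rho_le = multipartition_antimono[OF m2(2), of _ _ s]
  show ?thesis
  proof
    assume far: "cartan (node_label (i, j, s)) (node_label (i', j', s)) = 0"
    have ii: "i \<noteq> i'" using same_row_not_far m far by auto
    moreover have "j \<noteq> j'"
    proof
      assume jj: "j = j'"
      hence lt: "\<nu> s i' < \<nu> s i" using j nu[of i] by simp
      have "i < i'" using lt nu_le[of i' i] p2(1) by force
      hence "i + 1 \<noteq> i'" using far jj by (auto simp: cartan_def node_label_def)
      with \<open>i < i'\<close> have i': "i + 1 < i'" by simp
      have "\<rho> s i' \<le> \<rho> s (i + 1)" using i' by (intro rho_le) auto
      hence "j \<le> \<mu> s (i + 1)" using i' jj j rho[of i'] rho[of "i + 1"] nu[of "i + 1"] by simp
      moreover have "\<mu> s (i + 1) \<le> \<mu> s i" using p1 by (intro mu_le) auto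
      ultimately show False using j by simp
    qed
    ultimately show "i \<noteq> i' \<and> j \<noteq> j'" by simp
  next
    assume ne: "i \<noteq> i' \<and> j \<noteq> j'"
    show "cartan (node_label (i, j, s)) (node_label (i', j', s)) = 0"
    proof (rule ccontr)
      assume "\<not> ?thesis"
      then consider "int j - int i = int j' - int i'" | "int j' - int i' = int j - int i + 1" | "int j' - int i' = int j - int i - 1"
        by (fastforce simp: cartan_def node_label_def split: if_splits)
      thus False
      proof cases
        case 1
        have "weight \<nu> (node_label (i, j, s)) = - 1"
          using move_weight(1)[OF m(1)] move_weight(2)[OF m(1), of "node_label (i, j, s)"] by simp
        moreover have "weight \<nu> (node_label (i', j', s)) = 1" using move_weight(1)[OF m(2)] .
        ultimately show False using 1 by (simp add: node_label_def)
      next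
        case 2
        hence "int (\<nu> s i') - int i' = int (\<nu> s i) - int i" using j nu[of i] by simp
        from bead_inj[OF m1(2) p2(1) p1(1) this] ne show False by simp
      next
        case 3
        have nb: "\<not> bead \<nu> s (int j - int i - 1)" using bead_add(3)[OF m(1)] by simp
        have v: "int (\<nu> s i') - int i' = int (\<nu> s i) - int i - 2" using 3 j nu[of i] by simp
        have "i < i'" using v nu_le[of i' i] p2(1) by force
        have "\<nu> s (i + 1) \<le> \<nu> s i" using p1 by (intro nu_le) auto
        moreover have "\<nu> s i' \<le> \<nu> s (i + 1)" using \<open>i < i'\<close> by (intro nu_le) auto
        \<comment> \<open>The first move has vacated the diagonal j - i - 1. Hence row i + 1 is
          strictly shorter than row i in \<nu>, and no row below i + 1 can be the one in
          question.\<close>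
        moreover have "int (\<nu> s (i + 1)) - int (i + 1) \<noteq> int j - int i - 1"
          using nb unfolding bead_def by (metis le_add2)
        ultimately have "\<nu> s i = \<nu> s i' + 1 \<and> i' = i + 1 \<or> i' > i + 1" using v j nu[of i] \<open>i < i'\<close> by force
        thus False
        proof
          assume "i' > i + 1"
          have "\<nu> s (i + 1) < \<nu> s i" using \<open>\<nu> s (i + 1) \<le> \<nu> s i\<close> \<open>int (\<nu> s (i + 1)) - int (i + 1) \<noteq> int j - int i - 1\<close> j nu[of i] by auto
          thus False using v \<open>\<nu> s i' \<le> \<nu> s (i + 1)\<close> \<open>i' > i + 1\<close> by simp
        qed (use ne j nu[of i] in auto)
      qed
    qed
  qed
qed

text \<open>Translates the row and column test of \<open>swap_defined\<close> into orthogonality of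
  labels. Two removals are two additions read backwards. For steps of opposite sign adjacent labels
  are impossible, so distinct labels are orthogonal and the boxes must be shown to differ in row and
  column.\<close>

lemma far_iff:
  assumes m: "move r \<mu> \<epsilon> (i, j, s) \<nu>" "move r \<nu> \<eta> (i', j', s') \<rho>" and ne: "\<rho> \<noteq> \<mu>"
  shows "cartan (node_label (i, j, s)) (node_label (i', j', s')) = 0 \<longleftrightarrow> s \<noteq> s' \<or> (i \<noteq> i' \<and> j \<noteq> j')"
proof (cases "s = s'")
  case False
  thus ?thesis by (simp add: cartan_def node_label_def)
next
  case [simp]: True
  have nl: "node_label (i, j, s) \<noteq> node_label (i', j', s')" using move_back_iff[OF m] ne by simp
  consider "\<epsilon> = 1" "\<eta> = 1" | "\<epsilon> = - 1" "\<eta> = - 1" | "\<epsilon> \<noteq> \<eta>"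
    using moveD(3)[OF m(1)] moveD(3)[OF m(2)] by auto
  thus ?thesis
  proof cases
    case 1
    thus ?thesis using add_add_far_iff m by simp
  next
    case 2
    have "move r \<rho> 1 (i', j', s') \<nu>" "move r \<nu> 1 (i, j, s) \<mu>" using move_sym[OF m(2)] move_sym[OF m(1)] 2 by auto
    from add_add_far_iff[OF this[unfolded True]] show ?thesis by (auto simp: cartan_commute)
  next
    case 3
    hence "cartan (node_label (i, j, s)) (node_label (i', j', s')) \<noteq> - 1" using move_move_adjacent[OF m] by blast
    hence far: "cartan (node_label (i, j, s)) (node_label (i', j', s')) = 0" using cartan_cases nl by blast
    hence ii: "i \<noteq> i'" using same_row_not_far m by auto
    note m1 = moveD[OF m(1)] and m2 = moveD[OF m(2)]
    note p1 = move_position[OF m(1)] and p2 = move_position[OF m(2)]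
    have nu: "int (\<nu> s k) = int (\<mu> s k) + (if k = i then \<epsilon> else 0)" for k using m1(4)[of s k] by auto
    have rho: "int (\<rho> s k) = int (\<nu> s k) + (if k = i' then \<eta> else 0)" for k using m2(4)[of s k] by auto
    \<comment> \<open>With opposite signs, two boxes in one column would make the shape before both
      steps or the shape after them fail to decrease weakly.\<close>
    have "j \<noteq> j'"
    proof
      assume jj: "j = j'"
      consider "i < i'" | "i' < i" using ii by linarith
      thus False
      proof cases
        case 1
        hence "\<mu> s i' \<le> \<mu> s i" "\<rho> s i' \<le> \<rho> s i"
          using multipartition_antimono[OF m1(1), of i i' s] multipartition_antimono[OF m2(2), of i i' s] p1 by auto
        thus False using jj 3 ii nu[of i] nu[of i'] rho[of i] rho[of i'] m1(3,5) m2(3,5) by (auto split: if_splits)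
      next
        case 2
        hence "\<mu> s i \<le> \<mu> s i'" "\<rho> s i \<le> \<rho> s i'"
          using multipartition_antimono[OF m1(1), of i' i s] multipartition_antimono[OF m2(2), of i' i s] p2 by auto
        thus False using jj 3 ii nu[of i] nu[of i'] rho[of i] rho[of i'] m1(3,5) m2(3,5) by (auto split: if_splits)
      qed
    qed
    thus ?thesis using far ii by simp
  qed
qed

text \<open>Reversing a path of length three: comparing the weights along both paths gives linear equations
  between the signs and the Cartan entries.\<close>

lemma reversed_path_labels:
  assumes t: "move r \<mu>0 \<epsilon> \<alpha> \<mu>1" "move r \<mu>1 \<eta> \<beta> \<mu>2" "move r \<mu>2 \<zeta> \<gamma> \<mu>3"
    and t': "move r \<mu>0 \<zeta> \<gamma>' \<nu>1" "move r \<nu>1 \<eta> \<beta>' \<nu>2" "move r \<nu>2 \<epsilon> \<alpha>' \<nu>3"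
    and l: "node_label \<alpha>' = node_label \<alpha>" "node_label \<beta>' = node_label \<beta>" "node_label \<gamma>' = node_label \<gamma>"
  shows "node_label \<alpha> = node_label \<beta> \<and> node_label \<beta> = node_label \<gamma> \<or>
    cartan (node_label \<alpha>) (node_label \<beta>) = 0 \<and> cartan (node_label \<alpha>) (node_label \<gamma>) = 0 \<and>
    cartan (node_label \<beta>) (node_label \<gamma>) = 0"
proof -
  define a b d where "a = cartan (node_label \<alpha>) (node_label \<beta>)" and "b = cartan (node_label \<beta>) (node_label \<gamma>)"
    and "d = cartan (node_label \<alpha>) (node_label \<gamma>)"
  have com: "cartan (node_label \<beta>) (node_label \<alpha>) = a" "cartan (node_label \<gamma>) (node_label \<beta>) = b"
    "cartan (node_label \<gamma>) (node_label \<alpha>) = d" by (simp_all add: a_def b_def d_def cartan_commute)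
  have sg: "\<epsilon> \<in> {1, - 1}" "\<eta> \<in> {1, - 1}" "\<zeta> \<in> {1, - 1}" using t by (auto simp: move_def)
  have "\<eta> = weight \<mu>0 (node_label \<beta>) - \<epsilon> * a"
    using move_weight(1)[OF t(2)] move_weight(2)[OF t(1)] by (simp add: a_def)
  moreover have "\<zeta> = weight \<mu>0 (node_label \<gamma>) - \<epsilon> * d - \<eta> * b"
    using move_weight(1)[OF t(3)] move_weight(2)[OF t(2)] move_weight(2)[OF t(1)] by (simp add: b_def d_def)
  moreover have "\<epsilon> = weight \<mu>0 (node_label \<alpha>)" "\<zeta> = weight \<mu>0 (node_label \<gamma>)"
    using move_weight(1)[OF t(1)] move_weight(1)[OF t'(1)] l by simp_all
  moreover have "\<eta> = weight \<mu>0 (node_label \<beta>) - \<zeta> * b"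
    using move_weight(1)[OF t'(2)] move_weight(2)[OF t'(1)] l by (simp add: com)
  moreover have "\<epsilon> = weight \<mu>0 (node_label \<alpha>) - \<zeta> * d - \<eta> * a"
    using move_weight(1)[OF t'(3)] move_weight(2)[OF t'(2)] move_weight(2)[OF t'(1)] l by (simp add: com)
  ultimately have eq: "\<epsilon> * a = \<zeta> * b" "\<epsilon> * d + \<eta> * b = 0" "\<zeta> * d + \<eta> * a = 0" by linarith+
  have "\<bar>\<epsilon>\<bar> = 1" "\<bar>\<eta>\<bar> = 1" "\<bar>\<zeta>\<bar> = 1" using sg by auto
  hence ab: "\<bar>a\<bar> = \<bar>b\<bar>" and db: "\<bar>d\<bar> = \<bar>b\<bar>"
    using arg_cong[OF eq(1), of abs] eq(2)[unfolded add_eq_0_iff, THEN arg_cong[of _ _ abs]] by (simp_all add: abs_mult)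
  \<comment> \<open>Three labels are never pairwise adjacent, since the diagram of type A_infinity
    has no triangle. As the three entries have equal absolute value, all are 2 or all are 0.\<close>
  have "\<not> (a = - 1 \<and> b = - 1 \<and> d = - 1)"
    by (auto simp: a_def b_def d_def cartan_def split: if_splits)
  moreover have "a = 2 \<and> node_label \<alpha> = node_label \<beta> \<or> a = - 1 \<or> a = 0"
    "b = 2 \<and> node_label \<beta> = node_label \<gamma> \<or> b = - 1 \<or> b = 0" "d = 2 \<or> d = - 1 \<or> d = 0"
    unfolding a_def b_def d_def using cartan_cases by blast+
  ultimately have "node_label \<alpha> = node_label \<beta> \<and> node_label \<beta> = node_label \<gamma> \<or> a = 0 \<and> d = 0 \<and> b = 0"
    using ab db by (elim disjE conjE) simp_all
  thus ?thesis by (simp add: a_def b_def d_def)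
qed

section \<open>Size bounds, finiteness and the parity of the number of nodes\<close>

text \<open>After k steps every component fits into a k by k square. This crude bound yields both
  the finiteness of the set of tableaux and the bound on diagonals on which genericity acts.\<close>

definition bounded_mpart :: "nat \<Rightarrow> mpart \<Rightarrow> bool" where
  "bounded_mpart m \<mu> \<longleftrightarrow> (\<forall>s i. \<mu> s i \<le> m \<and> (\<mu> s i \<noteq> 0 \<longrightarrow> i \<le> m))"

lemma bounded_mpart_move:
  assumes m: "move r \<mu> \<epsilon> \<alpha> \<nu>" and b: "bounded_mpart k \<mu>"
  shows "bounded_mpart (k + 1) \<nu>" "\<bar>snd (node_label \<alpha>)\<bar> \<le> int k"
proof -
  obtain i j s where [simp]: "\<alpha> = (i, j, s)" by (cases \<alpha>)
  note d = moveD[OF m[simplified]] and p = move_position[OF m[simplified]]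
  have i: "i \<le> k + 1" "j \<le> k + 1" "\<epsilon> = - 1 \<Longrightarrow> i \<le> k \<and> j \<le> k"
  proof -
    have "i \<le> k \<and> j \<le> k" if e: "\<epsilon> = - 1"
    proof -
      have "\<mu> s i \<noteq> 0" using e d(4)[of s i] by auto
      thus ?thesis using e d(5) b by (auto simp: bounded_mpart_def)
    qed
    moreover have "i \<le> k + 1 \<and> j \<le> k + 1" if e: "\<epsilon> = 1"
    proof -
      have "\<nu> s i \<noteq> 0" using e d(4)[of s i] by simp
      hence "i \<le> k + 1"
      proof (cases "i = 1")
        case False
        hence "\<nu> s i \<le> \<nu> s (i - 1)" using p by (intro multipartition_antimono[OF d(2)]) auto
        hence "\<mu> s (i - 1) \<noteq> 0" using \<open>\<nu> s i \<noteq> 0\<close> d(4)[of s "i - 1"] p False by (cases "i - 1 = i") auto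
        hence "i - 1 \<le> k" using b by (auto simp: bounded_mpart_def)
        thus ?thesis by simp
      qed simp
      moreover have "\<mu> s i \<le> k" using b by (simp add: bounded_mpart_def)
      ultimately show ?thesis using d(5) e by simp
    qed
    ultimately show "i \<le> k + 1" "j \<le> k + 1" "\<epsilon> = - 1 \<Longrightarrow> i \<le> k \<and> j \<le> k" using d(3) by auto
  qed
  show "bounded_mpart (k + 1) \<nu>"
    unfolding bounded_mpart_def
  proof (intro allI conjI impI)
    fix s' i'
    have mu: "\<mu> s' i' \<le> k" "\<mu> s' i' \<noteq> 0 \<Longrightarrow> i' \<le> k" using b by (auto simp: bounded_mpart_def)
    show "\<nu> s' i' \<le> k + 1" using d(4)[of s' i'] d(3) mu by (auto split: if_splits)
    show "i' \<le> k + 1" if "\<nu> s' i' \<noteq> 0" using d(4)[of s' i'] mu i that by (auto split: if_splits)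
  qed
  \<comment> \<open>Row and column lie between 1 and k + 1, so the diagonal stays within k although
    the square has grown.\<close>
  show "\<bar>snd (node_label \<alpha>)\<bar> \<le> int k" using i p by (auto simp: node_label_def)
qed

lemma finite_bounded_mpart: "finite {\<mu>. is_multipartition r \<mu> \<and> bounded_mpart k \<mu>}"
proof -
  define R where "R = {f :: nat \<Rightarrow> nat. \<forall>i. (i \<in> {..k} \<longrightarrow> f i \<in> {..k}) \<and> (i \<notin> {..k} \<longrightarrow> f i = 0)}"
  have R: "finite R" unfolding R_def by (rule finite_set_of_finite_funs) auto
  have "finite {\<mu>. \<forall>s. (s \<in> {..r} \<longrightarrow> \<mu> s \<in> R) \<and> (s \<notin> {..r} \<longrightarrow> \<mu> s = (\<lambda>_. 0))}"
    by (rule finite_set_of_finite_funs) (use R in auto)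
  thus ?thesis
    by (rule finite_subset[rotated]) (auto simp: R_def bounded_mpart_def is_multipartition_def)
qed

lemma card_changes_parity:
  fixes f :: "int \<Rightarrow> bool"
  shows "even (card {c \<in> {a<..a + int k}. f (c - 1) \<noteq> f c}) \<longleftrightarrow> f a = f (a + int k)"
proof (induction k)
  case (Suc k)
  let ?S = "\<lambda>k. {c \<in> {a<..a + int k}. f (c - 1) \<noteq> f c}"
  let ?x = "a + int (Suc k)"
  have "{a<..?x} = insert ?x {a<..a + int k}" by auto
  hence "?S (Suc k) = (if f (?x - 1) \<noteq> f ?x then insert ?x (?S k) else ?S k)" by auto
  moreover have "?x \<notin> ?S k" by simp
  moreover have "finite (?S k)" by (rule finite_subset[of _ "{a<..a + int k}"]) auto
  moreover have "?x - 1 = a + int k" by simp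
  ultimately show ?case using Suc by (cases "f (?x - 1) = f ?x") auto
qed simp

text \<open>A Maya diagram consists of beads far to the left and of gaps far to the right, so it
  switches an odd number of times. The switches are the diagonals of addable and removable
  nodes.\<close>

lemma card_labels_odd:
  assumes mu: "is_multipartition r \<mu>" and s: "s \<in> {1..r}" and b: "bounded_mpart k \<mu>"
  shows "finite {c. weight \<mu> (s, c) \<noteq> 0}" "odd (card {c. weight \<mu> (s, c) \<noteq> 0})"
proof -
  define K where "K = int k + 1"
  \<comment> \<open>Row -c lies below the k by k square, so it is empty and its bead is at
    c.\<close>
  have lo: "bead \<mu> s c" if "c \<le> - K" for c
    using that b unfolding bead_def bounded_mpart_def K_def
    by (intro exI[of _ "nat (- c)"]) fastforce
  have hi: "\<not> bead \<mu> s c" if "c \<ge> K" for c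
  proof
    assume "bead \<mu> s c"
    then obtain i where "1 \<le> i" "int (\<mu> s i) - int i = c" by (auto simp: bead_def)
    moreover have "\<mu> s i \<le> k" using b by (simp add: bounded_mpart_def)
    ultimately show False using that by (simp add: K_def)
  qed
  have mem: "c \<in> {- K<..- K + int (nat (2 * K))}" if "bead \<mu> s (c - 1) \<noteq> bead \<mu> s c" for c
  proof -
    have "\<not> c \<le> - K" using that lo[of c] lo[of "c - 1"] by auto
    moreover have "\<not> c > K" using that hi[of c] hi[of "c - 1"] by auto
    ultimately show ?thesis by (auto simp: K_def)
  qed
  have eq: "{c. weight \<mu> (s, c) \<noteq> 0} = {c \<in> {- K<..- K + int (nat (2 * K))}. bead \<mu> s (c - 1) \<noteq> bead \<mu> s c}"
    using mem by (auto simp: weight_def)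
  show "finite {c. weight \<mu> (s, c) \<noteq> 0}"
    unfolding eq by (rule finite_subset[of _ "{- K<..- K + int (nat (2 * K))}"]) auto
  show "odd (card {c. weight \<mu> (s, c) \<noteq> 0})"
    unfolding eq card_changes_parity using lo[of "- K"] hi[of K] by (simp add: K_def)
qed

definition edge_nodes :: "nat \<Rightarrow> mpart \<Rightarrow> node set" where
  "edge_nodes r \<mu> = {\<alpha>. addable r \<mu> \<alpha> \<or> removable r \<mu> \<alpha>}"

lemma addable_move: "is_multipartition r \<mu> \<Longrightarrow> addable r \<mu> \<alpha> \<longleftrightarrow> (\<exists>\<nu>. move r \<mu> 1 \<alpha> \<nu>)"
  unfolding addable_def by (metis move_adds_box move_multipartition(2))

lemma removable_move: "is_multipartition r \<mu> \<Longrightarrow> removable r \<mu> \<alpha> \<longleftrightarrow> (\<exists>\<nu>. move r \<mu> (- 1) \<alpha> \<nu>)"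
  unfolding removable_def by (metis move_minus_adds_box move_multipartition(2))

lemma edge_nodes_move:
  assumes "is_multipartition r \<mu>"
  shows "\<alpha> \<in> edge_nodes r \<mu> \<longleftrightarrow> (\<exists>\<epsilon> \<nu>. move r \<mu> \<epsilon> \<alpha> \<nu>)"
proof
  assume "\<exists>\<epsilon> \<nu>. move r \<mu> \<epsilon> \<alpha> \<nu>"
  then obtain \<epsilon> \<nu> where m: "move r \<mu> \<epsilon> \<alpha> \<nu>" by blast
  from move_sign[OF m] m show "\<alpha> \<in> edge_nodes r \<mu>"
    by (auto simp: edge_nodes_def addable_move[OF assms] removable_move[OF assms])
qed (auto simp: edge_nodes_def addable_move[OF assms] removable_move[OF assms])

lemma inj_on_node_label: "is_multipartition r \<mu> \<Longrightarrow> inj_on node_label (edge_nodes r \<mu>)"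
  using move_unique(2) by (intro inj_onI) (metis edge_nodes_move)

lemma image_node_label:
  assumes "is_multipartition r \<mu>"
  shows "node_label ` edge_nodes r \<mu> = (SIGMA s:{1..r}. {c. weight \<mu> (s, c) \<noteq> 0})"
proof (intro equalityI subsetI)
  fix l assume "l \<in> node_label ` edge_nodes r \<mu>"
  then obtain \<alpha> \<epsilon> \<nu> where m: "move r \<mu> \<epsilon> \<alpha> \<nu>" "l = node_label \<alpha>" using assms by (auto simp: edge_nodes_move)
  have "weight \<mu> l \<noteq> 0" using move_weight(1)[OF m(1)] m by (auto simp: move_def)
  moreover have "fst l \<in> {1..r}" using m move_position(3) by (cases \<alpha>) (auto simp: node_label_def)
  ultimately show "l \<in> (SIGMA s:{1..r}. {c. weight \<mu> (s, c) \<noteq> 0})" by (cases l) auto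
next
  fix l assume "l \<in> (SIGMA s:{1..r}. {c. weight \<mu> (s, c) \<noteq> 0})"
  then obtain s c where l: "l = (s, c)" "s \<in> {1..r}" "weight \<mu> (s, c) \<noteq> 0" by auto
  then obtain \<alpha> \<nu> where "move r \<mu> (weight \<mu> (s, c)) \<alpha> \<nu>" "node_label \<alpha> = (s, c)"
    using move_exists[OF assms l(2) refl l(3)] by blast
  thus "l \<in> node_label ` edge_nodes r \<mu>" using l edge_nodes_move[OF assms] by (metis imageI)
qed

text \<open>Each of the r components contributes an odd number. This parity turns the sign (-1)^|A|
  that arises at y = 0 in the partial fractions into the sign (-1)^r that occurs in W_k.\<close>

lemma
  assumes mu: "is_multipartition r \<mu>" and b: "bounded_mpart k \<mu>"
  shows finite_edge_nodes: "finite (edge_nodes r \<mu>)"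
    and card_edge_nodes: "even (card (edge_nodes r \<mu>)) \<longleftrightarrow> even r"
proof -
  have fin: "finite (node_label ` edge_nodes r \<mu>)"
    unfolding image_node_label[OF mu] using card_labels_odd(1)[OF mu _ b] by (intro finite_SigmaI) auto
  thus "finite (edge_nodes r \<mu>)" using inj_on_node_label[OF mu] finite_imageD by blast
  have "card (edge_nodes r \<mu>) = card (node_label ` edge_nodes r \<mu>)"
    using inj_on_node_label[OF mu] by (simp add: card_image)
  also have "\<dots> = (\<Sum>s\<in>{1..r}. card {c. weight \<mu> (s, c) \<noteq> 0})"
    unfolding image_node_label[OF mu] using card_labels_odd(1)[OF mu _ b] by (intro card_SigmaI) auto
  also have "even \<dots> \<longleftrightarrow> even (card {s \<in> {1..r}. odd (card {c. weight \<mu> (s, c) \<noteq> 0})})"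
    by (rule even_sum_iff) simp
  also have "{s \<in> {1..r}. odd (card {c. weight \<mu> (s, c) \<noteq> 0})} = {1..r}"
    using card_labels_odd(2)[OF mu _ b] by auto
  finally show "even (card (edge_nodes r \<mu>)) \<longleftrightarrow> even r" by simp
qed

section \<open>Contents and genericity\<close>

definition label_content :: "(nat \<Rightarrow> 'a::field) \<Rightarrow> int \<Rightarrow> nat \<times> int \<Rightarrow> 'a" where
  "label_content u \<epsilon> l = of_int \<epsilon> * (u (fst l) + of_int (snd l))"

lemma node_res_label: "node_res u \<alpha> = label_content u 1 (node_label \<alpha>)"
  by (cases \<alpha>) (simp add: node_res_def label_content_def node_label_def)

lemma node_content_move:
  assumes m: "move r \<mu> \<epsilon> \<alpha> \<nu>"
  shows "node_content r u \<mu> \<alpha> = label_content u \<epsilon> (node_label \<alpha>)"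
proof -
  have mu: "is_multipartition r \<mu>" using m by (simp add: move_def)
  have "addable r \<mu> \<alpha> \<longleftrightarrow> \<epsilon> = 1" using m move_unique(1) addable_move[OF mu] by blast
  moreover have "\<epsilon> = 1 \<or> \<epsilon> = - 1" using m by (simp add: move_def)
  ultimately show ?thesis by (auto simp: node_content_def node_res_label label_content_def)
qed

lemma tab_content_move:
  assumes m: "move r (t ! (k - 1)) \<epsilon> \<alpha> (t ! k)"
  shows "tab_content u t k = label_content u \<epsilon> (node_label \<alpha>)"
proof -
  have mp: "is_multipartition r (t ! (k - 1))" "is_multipartition r (t ! k)" using m by (auto simp: move_def)
  have "(\<exists>\<alpha>. adds_box (t ! (k - 1)) \<alpha> (t ! k)) \<longleftrightarrow> \<epsilon> = 1"
    using m move_box_unique(1)[OF m] move_adds_box[OF mp] by blast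
  moreover have "\<epsilon> = 1 \<or> \<epsilon> = - 1" using m by (simp add: move_def)
  ultimately show ?thesis
    using box_diff_move[OF m] by (auto simp: tab_content_def node_res_label label_content_def)
qed

lemma of_int_eq_0_bounded:
  assumes "CHAR('a::field) = 0 \<or> CHAR('a) > 2 * n" "\<bar>d\<bar> \<le> 2 * int n" "(of_int d :: 'a) = 0"
  shows "d = 0"
proof -
  have "int CHAR('a) dvd d" using assms(3) by (simp add: of_int_eq_0_iff_char_dvd)
  thus ?thesis using assms(1,2) zdvd_imp_le[of "int CHAR('a)" "\<bar>d\<bar>"] by (cases "d = 0") auto
qed

text \<open>For different components, or for one component with opposite signs, equal contents make
  u_s + u_s', u_s - u_s' or 2u_s an integer of absolute value at most 2n - 2, against genericity.
  Otherwise the difference of the diagonals vanishes in the field, and the characteristic makes it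
  zero.\<close>

lemma label_content_inj:
  fixes u :: "nat \<Rightarrow> 'a::field"
  assumes char: "CHAR('a) = 0 \<or> CHAR('a) > 2 * n" and gen: "generic n r u"
    and l: "fst l \<in> {1..r}" "\<bar>snd l\<bar> < int n" and l': "fst l' \<in> {1..r}" "\<bar>snd l'\<bar> < int n"
    and sg: "\<epsilon> = 1 \<or> \<epsilon> = - 1" "\<eta> = 1 \<or> \<eta> = - 1"
    and eq: "label_content u \<epsilon> l = label_content u \<eta> l'"
  shows "\<epsilon> = \<eta>" "l = l'"
proof -
  have gen1: "2 * int n \<le> \<bar>d\<bar>" if "i \<in> {1..r}" "j \<in> {1..r}" "i \<noteq> j" "u i + u j = of_int d \<or> u i - u j = of_int d" for i j d
    using gen that unfolding generic_def by blast
  have gen2: "2 * int n \<le> \<bar>d\<bar>" if "i \<in> {1..r}" "2 * u i = of_int d" for i d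
    using gen that unfolding generic_def by blast
  obtain s c s' c' where [simp]: "l = (s, c)" "l' = (s', c')" by (cases l; cases l')
  have e1: "u s - u s' = of_int (c' - c)" if "\<epsilon> = \<eta>"
    using sg eq that by (auto simp: label_content_def algebra_simps)
  have e2: "u s + u s' = of_int (- c' - c)" if "\<epsilon> \<noteq> \<eta>"
  proof -
    have opp: "x + y = 0" if "of_int \<epsilon> * x = of_int \<eta> * y" for x y :: 'a
      using sg that \<open>\<epsilon> \<noteq> \<eta>\<close> by auto
    have "(u s + u s') + (of_int c' + of_int c) = (u s + of_int c) + (u s' + of_int c')" by (simp only: ac_simps)
    also have "\<dots> = 0" using eq by (intro opp) (simp add: label_content_def)
    finally show ?thesis by (simp add: eq_neg_iff_add_eq_0[symmetric])
  qed
  have ss: "s = s'"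
  proof (rule ccontr)
    assume "s \<noteq> s'"
    thus False using e1 e2 gen1[of s s' "c' - c"] gen1[of s s' "- c' - c"] l l' by (cases "\<epsilon> = \<eta>") auto
  qed
  show ee: "\<epsilon> = \<eta>"
  proof (rule ccontr)
    assume "\<epsilon> \<noteq> \<eta>"
    hence "2 * u s = of_int (- c' - c)" using e2 ss by simp
    from gen2[OF _ this] l l' show False by simp
  qed
  have "(of_int (c' - c) :: 'a) = 0" using e1[OF ee] ss by simp
  moreover have "\<bar>c' - c\<bar> \<le> 2 * int n" using l l' by simp
  ultimately have "c' - c = 0" using of_int_eq_0_bounded[OF char] by blast
  thus "l = l'" using ss by simp
qed

text \<open>Injectivity is applied after reversing the second sign; the remaining coincidence, equal
  labels with opposite signs, is what \<open>ne\<close> excludes.\<close>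

lemma label_content_sum_nonzero:
  fixes u :: "nat \<Rightarrow> 'a::field"
  assumes char: "CHAR('a) = 0 \<or> CHAR('a) > 2 * n" and gen: "generic n r u"
    and l: "fst l \<in> {1..r}" "\<bar>snd l\<bar> < int n" and l': "fst l' \<in> {1..r}" "\<bar>snd l'\<bar> < int n"
    and sg: "\<epsilon> = 1 \<or> \<epsilon> = - 1" "\<eta> = 1 \<or> \<eta> = - 1" and ne: "l = l' \<Longrightarrow> \<epsilon> = \<eta>"
  shows "label_content u \<epsilon> l + label_content u \<eta> l' \<noteq> 0"
proof
  assume "label_content u \<epsilon> l + label_content u \<eta> l' = 0"
  moreover have "label_content u (- \<eta>) l' = - label_content u \<eta> l'" by (simp add: label_content_def)
  ultimately have eq: "label_content u \<epsilon> l = label_content u (- \<eta>) l'" by (metis add_right_cancel left_minus)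
  have sg': "- \<eta> = 1 \<or> - \<eta> = - 1" using sg by auto
  have "\<epsilon> = - \<eta>" "l = l'" using label_content_inj[OF char gen l l' sg(1) sg' eq] by auto
  thus False using ne sg by auto
qed

text \<open>Equality would make 2u_s an integer of absolute value at most 2n - 1. The lemma keeps
  the factor 2c - (-1)^r of the residues e_tt(k) away from zero.\<close>

lemma two_label_content_ne:
  fixes u :: "nat \<Rightarrow> 'a::field"
  assumes gen: "generic n r u" and l: "fst l \<in> {1..r}" "\<bar>snd l\<bar> < int n" and sg: "\<epsilon> = 1 \<or> \<epsilon> = - 1"
  shows "2 * label_content u \<epsilon> l \<noteq> (- 1) ^ k"
proof
  assume eq: "2 * label_content u \<epsilon> l = (- 1) ^ k"
  have *: "2 * x = of_int (\<epsilon> * (- 1) ^ k)" if "2 * (of_int \<epsilon> * x) = (- 1) ^ k" for x :: 'a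
    using sg that by (auto simp: minus_equation_iff)
  have "2 * (u (fst l) + of_int (snd l)) = of_int (\<epsilon> * (- 1) ^ k)"
    using eq unfolding label_content_def by (rule *)
  hence "2 * u (fst l) = of_int (\<epsilon> * (- 1) ^ k - 2 * snd l)"
    by (simp only: distrib_left of_int_diff of_int_mult of_int_numeral) (simp only: eq_diff_eq)
  hence "2 * int n \<le> \<bar>\<epsilon> * (- 1) ^ k - 2 * snd l\<bar>" using gen l unfolding generic_def by blast
  moreover have "\<epsilon> * (- 1) ^ k = 1 \<or> \<epsilon> * (- 1) ^ k = - 1" using sg by (cases "even k") auto
  ultimately show False using l by auto
qed

section \<open>Partial fractions and residues\<close>

lemma poly_eq_by_card:
  fixes p q :: "'a::idom poly"
  assumes S: "finite S" and deg: "degree p < card S" "degree q < card S"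
    and eq: "\<And>x. x \<in> S \<Longrightarrow> poly p x = poly q x"
  shows "p = q"
proof (rule ccontr)
  assume "p \<noteq> q"
  hence nz: "p - q \<noteq> 0" by simp
  have "card S \<le> card {x. poly (p - q) x = 0}"
    using nz eq by (intro card_mono poly_roots_finite) auto
  also have "\<dots> \<le> degree (p - q)" using nz by (rule card_poly_roots_bound)
  also have "\<dots> < card S" using deg by (intro degree_diff_less)
  finally show False by simp
qed

lemma degree_lead_prod_monic:
  fixes f :: "'i \<Rightarrow> 'a::idom"
  assumes "finite I"
  shows "degree (\<Prod>i\<in>I. [:f i, 1:]) = card I" "lead_coeff (\<Prod>i\<in>I. [:f i, 1:]) = 1"
  by (subst degree_prod_sum_eq, simp_all) (simp add: lead_coeff_prod)

text \<open>The top coefficient in Lagrange interpolation. It is the residue theorem for p divided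
  by the product of the X - x over x in S, the right side being the contribution of
  infinity.\<close>

lemma lagrange_lead_coeff:
  fixes p :: "'a::field poly"
  assumes S: "finite S" and deg: "degree p < card S"
  shows "(\<Sum>x\<in>S. poly p x / (\<Prod>y\<in>S - {x}. x - y)) = coeff p (card S - 1)"
proof -
  define B where "B x = (\<Prod>y\<in>S - {x}. [:- y, 1:])" for x
  define q where "q = (\<Sum>x\<in>S. smult (poly p x / (\<Prod>y\<in>S - {x}. x - y)) (B x))"
  have B: "degree (B x) = card S - 1" "coeff (B x) (card S - 1) = 1" if "x \<in> S" for x
    using that S degree_lead_prod_monic[of "S - {x}" "\<lambda>y. - y"] by (auto simp: B_def)
  have "0 < card S" using deg by simp
  have Bz: "poly (B x) z = (if x = z then (\<Prod>y\<in>S - {x}. x - y) else 0)" if "x \<in> S" "z \<in> S" for x z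
    using that S by (auto simp: B_def poly_prod intro!: prod_zero prod.cong)
  have "p = q"
  proof (rule poly_eq_by_card[OF S deg])
    have "degree q \<le> card S - 1"
      unfolding q_def using B by (intro degree_sum_le S) (auto intro: order_trans[OF degree_smult_le])
    thus "degree q < card S" using \<open>0 < card S\<close> by simp
    fix z assume z: "z \<in> S"
    have "poly q z = (\<Sum>x\<in>S. if x = z then poly p x else 0)"
      unfolding q_def poly_sum using S z Bz by (intro sum.cong) (auto simp: prod_zero_iff)
    thus "poly p z = poly q z" using S z by simp
  qed
  hence "coeff p (card S - 1) = coeff q (card S - 1)" by simp
  also have "\<dots> = (\<Sum>x\<in>S. poly p x / (\<Prod>y\<in>S - {x}. x - y))"
    using B by (simp add: q_def coeff_sum)
  finally show ?thesis by simp
qed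

section \<open>Values and residues of Laurent expansions\<close>

text \<open>Models a rational function that is defined at the point of expansion, together with its
  value there. By the closure rules below, the residue at a simple pole is found by evaluating the
  other factors.\<close>

definition regular :: "'a::field fls \<Rightarrow> 'a \<Rightarrow> bool" where
  "regular f a \<longleftrightarrow> (\<exists>g. f = fps_to_fls g \<and> fps_nth g 0 = a)"

lemma regularI: "f = fps_to_fls g \<Longrightarrow> fps_nth g 0 = a \<Longrightarrow> regular f a"
  by (auto simp: regular_def)

lemma regular_const: "regular (fls_const c) c"
  by (rule regularI[of _ "fps_const c"]) (auto intro: fls_eqI)

lemma regular_1: "regular 1 1"
  using regular_const[of 1] by simp

lemma regular_X: "regular fls_X 0"
  by (rule regularI[of _ fps_X]) (auto intro: fls_eqI)

lemma regular_plus: "regular f a \<Longrightarrow> regular g b \<Longrightarrow> regular (f + g) (a + b)"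
  by (metis fps_add_nth fps_to_fls_plus regular_def)

lemma regular_minus: "regular f a \<Longrightarrow> regular g b \<Longrightarrow> regular (f - g) (a - b)"
  by (metis fps_sub_nth fps_to_fls_minus regular_def)

lemma regular_times: "regular f a \<Longrightarrow> regular g b \<Longrightarrow> regular (f * g) (a * b)"
  by (metis fps_mult_nth_0 fls_times_fps_to_fls regular_def)

lemma fps_to_fls_inverse_unit:
  fixes g :: "'a::field fps"
  assumes "fps_nth g 0 \<noteq> 0"
  shows "fps_to_fls (inverse g) = inverse (fps_to_fls g)"
proof -
  have "fps_to_fls g * fps_to_fls (inverse g) = 1"
    using assms by (simp flip: fls_times_fps_to_fls add: inverse_mult_eq_1')
  thus ?thesis by (metis inverse_unique)
qed

lemma regular_inverse:
  assumes "regular f a" "a \<noteq> 0" shows "regular (inverse f) (inverse a)"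
proof -
  obtain g where g: "f = fps_to_fls g" "fps_nth g 0 = a" using assms by (auto simp: regular_def)
  hence "inverse f = fps_to_fls (inverse g)" using assms by (simp add: fps_to_fls_inverse_unit)
  thus ?thesis using g by (intro regularI[of _ "inverse g"]) auto
qed

lemma regular_divide: "regular f a \<Longrightarrow> regular g b \<Longrightarrow> b \<noteq> 0 \<Longrightarrow> regular (f / g) (a / b)"
  by (simp add: divide_inverse regular_times regular_inverse)

lemma regular_prod:
  "(\<And>i. i \<in> I \<Longrightarrow> regular (f i) (a i)) \<Longrightarrow> regular (\<Prod>i\<in>I. f i) (\<Prod>i\<in>I. a i)"
  by (induction I rule: infinite_finite_induct) (auto intro: regular_1 regular_times)

lemma residue_simple_pole:
  assumes "regular f a" "regular g b"
  shows "fls_residue (g + f / fls_X) = a"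
proof -
  obtain h k where "f = fps_to_fls h" "fps_nth h 0 = a" "g = fps_to_fls k"
    using assms by (auto simp: regular_def)
  moreover have "f / fls_X = fls_shift 1 f"
    by (metis div_by_1 divide_divide_eq_right fls_X_inv_times_conv_shift(2) fls_inverse_X(1) divide_inverse)
  ultimately show ?thesis by simp
qed

text \<open>The residue of \<open>W(y)/y\<close> at \<open>c i\<close>, where \<open>c\<close> lists the contents of the addable and removable nodes.\<close>

definition res_coeff :: "nat \<Rightarrow> 'i set \<Rightarrow> ('i \<Rightarrow> 'a::field) \<Rightarrow> 'i \<Rightarrow> 'a" where
  "res_coeff r A c i = (2 * c i - (- 1) ^ r) * (\<Prod>j\<in>A - {i}. (c i + c j) / (c i - c j))"

text \<open>Only the factor with j = i has a pole at c_i, and a simple one since the contents are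
  distinct. Its numerator takes the value 2c_i there, which cancels 1/y up to the factor 2; the
  summand (1/2 - y)/y is regular and contributes nothing.\<close>

lemma residue_W:
  fixes c :: "'i \<Rightarrow> 'a::field"
  assumes two: "(2::'a) \<noteq> 0" and A: "finite A" and i: "i \<in> A" and inj: "inj_on c A" and nz: "c i \<noteq> 0"
  shows "residue_at (c i) (\<lambda>y. (1 / 2 - y + (y - 1 / 2 * (- 1) ^ r) *
      (\<Prod>j\<in>A. (y + fls_const (c j)) / (y - fls_const (c j)))) / y) = res_coeff r A c i"
proof -
  define y where "y = fls_const (c i) + fls_X"
  have y: "regular y (c i)" unfolding y_def using regular_plus[OF regular_const regular_X, of "c i"] by simp
  have half: "(1 / 2 :: 'a fls) = fls_const (1 / 2)"
    using two by (simp flip: fls_const_divide_const add: fls_const_1)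
  have sgn: "((- 1) ^ r :: 'a fls) = fls_const ((- 1) ^ r)"
    by (simp add: fls_const_power)
  define P where "P = (\<Prod>j\<in>A - {i}. (y + fls_const (c j)) / (y - fls_const (c j)))"
  have P: "regular P (\<Prod>j\<in>A - {i}. (c i + c j) / (c i - c j))"
    unfolding P_def using inj i
    by (intro regular_prod regular_divide regular_plus regular_minus y regular_const) (auto simp: inj_on_def)
  have yi: "y - fls_const (c i) = fls_X" by (simp add: y_def)
  have prod: "(\<Prod>j\<in>A. (y + fls_const (c j)) / (y - fls_const (c j))) = (y + fls_const (c i)) / fls_X * P"
    by (subst prod.remove[OF A i]) (simp add: P_def yi)
  define F where "F = (y - 1 / 2 * (- 1) ^ r) * (y + fls_const (c i)) * P / y"
  have F: "regular F ((c i - 1 / 2 * (- 1) ^ r) * (c i + c i) * (\<Prod>j\<in>A - {i}. (c i + c j) / (c i - c j)) / c i)"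
    unfolding F_def half sgn using nz by (intro regular_divide regular_times regular_minus regular_plus y regular_const P)
  have G: "regular ((1 / 2 - y) / y) ((1 / 2 - c i) / c i)"
    unfolding half using nz by (intro regular_divide regular_minus y regular_const)
  have "(1 / 2 - y + (y - 1 / 2 * (- 1) ^ r) *
      (\<Prod>j\<in>A. (y + fls_const (c j)) / (y - fls_const (c j)))) / y = (1 / 2 - y) / y + F / fls_X"
    unfolding prod F_def by (simp only: add_divide_distrib[of "1 / 2 - y" _ y]) (simp only: divide_inverse ac_simps)
  hence "residue_at (c i) (\<lambda>y. (1 / 2 - y + (y - 1 / 2 * (- 1) ^ r) *
      (\<Prod>j\<in>A. (y + fls_const (c j)) / (y - fls_const (c j)))) / y) = fls_residue ((1 / 2 - y) / y + F / fls_X)"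
    by (simp add: residue_at_def y_def)
  also have "\<dots> = (c i - 1 / 2 * (- 1) ^ r) * (c i + c i) * (\<Prod>j\<in>A - {i}. (c i + c j) / (c i - c j)) / c i"
    by (rule residue_simple_pole[OF F G])
  also have "\<dots> = res_coeff r A c i"
    using nz two by (simp add: res_coeff_def field_simps)
  finally show ?thesis .
qed

section \<open>Partial fraction identities\<close>

text \<open>Lagrange interpolation of a monic polynomial of degree |A| at 0 and all c_i has
  coefficient sum 1. The point c_i yields the i-th summand, because the factor c_i + c_k completes
  the product, from which 2c_i then splits off. The point 0 yields -1/(2c_k), where the parity
  cancels the signs.\<close>

lemma sum_res_coeff:
  fixes c :: "'i \<Rightarrow> 'a::field"
  assumes two: "(2::'a) \<noteq> 0" and A: "finite A" and k: "k \<in> A" and inj: "inj_on c A"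
    and nz: "\<And>i j. i \<in> A \<Longrightarrow> j \<in> A \<Longrightarrow> c i + c j \<noteq> 0"
    and parity: "(- 1 :: 'a) ^ card A = (- 1) ^ r"
  shows "(\<Sum>i\<in>A. res_coeff r A c i / (c i + c k)) = 1 + 1 / (2 * c k)"
proof -
  have nz0: "c i \<noteq> 0" if "i \<in> A" for i using nz[OF that that] by auto
  define S where "S = insert 0 (c ` A)"
  \<comment> \<open>Divided by the product of the X - x over x in S, this is the product part of
    W_k(y) / (y (y + c_k)), whose residues at the c_i are the summands.\<close>
  define p where "p = [:- ((- 1) ^ r / 2), 1:] * (\<Prod>j\<in>A - {k}. [:c j, 1:])"
  have card: "card S = Suc (card A)"
    unfolding S_def using A nz0 inj by (subst card_insert_disjoint) (auto simp: card_image)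
  have fS: "finite S" using A by (simp add: S_def)
  have pS: "p = (\<Prod>j\<in>A. [:if j = k then - ((- 1) ^ r / 2) else c j, 1:])"
    unfolding p_def by (subst prod.remove[OF A k]) (auto intro!: arg_cong2[of _ _ _ _ "(*)"] prod.cong)
  have "degree p = card A" "coeff p (card A) = 1"
    using degree_lead_prod_monic[OF A, of "\<lambda>j. if j = k then - ((- 1) ^ r / 2) else c j"] by (simp_all add: pS)
  hence "(\<Sum>x\<in>S. poly p x / (\<Prod>y\<in>S - {x}. x - y)) = 1"
    using lagrange_lead_coeff[of S p] card fS by simp
  also have "(\<Sum>x\<in>S. poly p x / (\<Prod>y\<in>S - {x}. x - y)) =
      poly p 0 / (\<Prod>y\<in>S - {0}. 0 - y) + (\<Sum>i\<in>A. poly p (c i) / (\<Prod>y\<in>S - {c i}. c i - y))"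
    unfolding S_def using A nz0 inj by (subst sum.insert) (auto simp: sum.reindex)
  also have "(\<Sum>i\<in>A. poly p (c i) / (\<Prod>y\<in>S - {c i}. c i - y)) = (\<Sum>i\<in>A. res_coeff r A c i / (c i + c k))"
  proof (rule sum.cong)
    fix i assume i: "i \<in> A"
    have "S - {c i} = insert 0 (c ` (A - {i}))"
      unfolding S_def using i nz0 inj by (auto simp: inj_on_def)
    hence D: "(\<Prod>y\<in>S - {c i}. c i - y) = c i * (\<Prod>j\<in>A - {i}. c i - c j)"
      using A nz0 inj by (simp, subst prod.insert)
        (auto simp: prod.reindex inj_on_def intro!: prod.reindex_cong[of c])
    have "(c i + c k) * (\<Prod>j\<in>A - {k}. c i + c j) = (\<Prod>j\<in>A. c i + c j)"
      by (rule prod.remove[OF A k, symmetric])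
    also have "\<dots> = (c i + c i) * (\<Prod>j\<in>A - {i}. c i + c j)"
      by (rule prod.remove[OF A i])
    finally have E: "(c i + c k) * (\<Prod>j\<in>A - {k}. c i + c j) = 2 * c i * (\<Prod>j\<in>A - {i}. c i + c j)"
      by simp
    have Dn: "(\<Prod>j\<in>A - {i}. c i - c j) \<noteq> 0"
      using A i inj by (auto simp: inj_on_def)
    have p: "poly p (c i) = (c i - (- 1) ^ r / 2) * (\<Prod>j\<in>A - {k}. c i + c j)"
      by (simp add: p_def poly_prod algebra_simps)
    have R: "res_coeff r A c i * (\<Prod>j\<in>A - {i}. c i - c j) = (2 * c i - (- 1) ^ r) * (\<Prod>j\<in>A - {i}. c i + c j)"
      using Dn by (simp add: res_coeff_def prod_dividef del: prod_zero_iff)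
    have "2 * (res_coeff r A c i * (c i * (\<Prod>j\<in>A - {i}. c i - c j))) =
        2 * c i * ((2 * c i - (- 1) ^ r) * (\<Prod>j\<in>A - {i}. c i + c j))"
      by (simp flip: R)
    also have "\<dots> = 2 * (poly p (c i) * (c i + c k))"
      unfolding p using E two by (simp add: field_simps)
    finally have "res_coeff r A c i * (c i * (\<Prod>j\<in>A - {i}. c i - c j)) = poly p (c i) * (c i + c k)"
      using two by simp
    hence "res_coeff r A c i / (c i + c k) = poly p (c i) / (c i * (\<Prod>j\<in>A - {i}. c i - c j))"
      using Dn nz[OF i k] nz0[OF i] by (simp add: frac_eq_eq del: prod_zero_iff)
    thus "poly p (c i) / (\<Prod>y\<in>S - {c i}. c i - y) = res_coeff r A c i / (c i + c k)"
      by (simp add: D)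
  qed simp
  also have "poly p 0 / (\<Prod>y\<in>S - {0}. 0 - y) = - 1 / (2 * c k)"
  proof -
    have "S - {0} = c ` A" using nz0 by (auto simp: S_def)
    hence "(\<Prod>y\<in>S - {0}. 0 - y) = (\<Prod>j\<in>A. - c j)" using inj by (simp add: prod.reindex)
    also have "\<dots> = (- 1) ^ card A * (\<Prod>j\<in>A. c j)" by (simp add: prod_uminus)
    also have "(\<Prod>j\<in>A. c j) = c k * (\<Prod>j\<in>A - {k}. c j)" by (rule prod.remove[OF A k])
    finally have D: "(\<Prod>y\<in>S - {0}. 0 - y) = (- 1) ^ r * (c k * (\<Prod>j\<in>A - {k}. c j))"
      by (simp add: parity)
    have "(\<Prod>j\<in>A - {k}. c j) \<noteq> 0" using A nz0 by auto
    moreover have "poly p 0 = - ((- 1) ^ r / 2) * (\<Prod>j\<in>A - {k}. c j)"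
      by (simp add: p_def poly_prod)
    ultimately show ?thesis using two nz0[OF k] unfolding D by (simp add: divide_simps)
  qed
  finally show ?thesis by (simp add: algebra_simps)
qed

lemma res_coeff_nonzero:
  fixes c :: "'i \<Rightarrow> 'a::field"
  assumes "finite A" "i \<in> A" "inj_on c A" "\<And>j. j \<in> A \<Longrightarrow> c i + c j \<noteq> 0" "2 * c i \<noteq> (- 1) ^ r"
  shows "res_coeff r A c i \<noteq> 0"
  using assms by (auto simp: res_coeff_def inj_on_def)

text \<open>With x/(x - c_i) in place of 1/(x - c_i) the constant is the value at x = 0, and for x =
  1/y each term is a geometric series in y. Without denominators, both sides are polynomials of
  degree at most |I| that agree at 0 and at every c_i.\<close>

lemma prod_cayley_partial_fractions:
  fixes c :: "'i \<Rightarrow> 'a::field"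
  assumes I: "finite I" and inj: "inj_on c I" and nz: "\<And>i. i \<in> I \<Longrightarrow> c i \<noteq> 0"
    and x: "\<And>i. i \<in> I \<Longrightarrow> x \<noteq> c i"
  shows "(\<Prod>i\<in>I. (x + c i) / (x - c i)) = (- 1) ^ card I +
    (\<Sum>i\<in>I. 2 * (\<Prod>j\<in>I - {i}. (c i + c j) / (c i - c j)) * x / (x - c i))"
proof -
  define B where "B i = 2 * (\<Prod>j\<in>I - {i}. (c i + c j) / (c i - c j))" for i
  define S where "S = insert 0 (c ` I)"
  have card: "card S = Suc (card I)"
    unfolding S_def using I nz inj by (subst card_insert_disjoint) (auto simp: card_image)
  define p where "p = (\<Prod>i\<in>I. [:c i, 1:])"
  define q where "q = smult ((- 1) ^ card I) (\<Prod>i\<in>I. [:- c i, 1:]) +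
    (\<Sum>i\<in>I. smult (B i) ([:0, 1:] * (\<Prod>j\<in>I - {i}. [:- c j, 1:])))"
  have deg1: "degree (smult (B i) ([:0, 1:] * (\<Prod>j\<in>I - {i}. [:- c j, 1:]))) \<le> card I" if "i \<in> I" for i
  proof -
    have "degree ([:0, 1:] * (\<Prod>j\<in>I - {i}. [:- c j, 1:])) \<le> 1 + card (I - {i})"
      using degree_mult_le[of "[:0, 1:]" "\<Prod>j\<in>I - {i}. [:- c j, 1:]"]
        degree_lead_prod_monic(1)[of "I - {i}" "\<lambda>j. - c j"] I by simp
    also have "\<dots> = card I" using I that card_Suc_Diff1[OF I that] by simp
    finally show ?thesis using degree_smult_le order_trans by blast
  qed
  have q_eval: "poly q z = (- 1) ^ card I * (\<Prod>j\<in>I. z - c j) + (\<Sum>i\<in>I. B i * (z * (\<Prod>j\<in>I - {i}. z - c j)))" for z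
    by (simp add: q_def poly_prod poly_sum ac_simps del: prod_zero_iff)
  have "p = q"
  proof (rule poly_eq_by_card[of S])
    show "finite S" using I by (simp add: S_def)
    show "degree p < card S" using degree_lead_prod_monic(1)[OF I, of c] by (simp add: card p_def)
    have "degree q \<le> card I" unfolding q_def
      using degree_lead_prod_monic(1)[OF I, of "\<lambda>i. - c i"] deg1 I
      by (intro degree_add_le degree_sum_le) (auto intro: order_trans[OF degree_smult_le])
    thus "degree q < card S" by (simp add: card)
    fix y assume "y \<in> S"
    then consider "y = 0" | k where "k \<in> I" "y = c k" by (auto simp: S_def)
    thus "poly p y = poly q y"
    proof cases
      case 1
      thus ?thesis by (simp add: p_def q_def poly_prod poly_sum prod_uminus)
    next
      case 2
      have "(\<Prod>j\<in>I - {i}. c k - c j) = 0" if "i \<in> I" "i \<noteq> k" for i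
        using that 2 I by (intro prod_zero) auto
      note zero = this
      have Z: "(\<Prod>j\<in>I. c k - c j) = 0" using 2 I by (intro prod_zero) auto
      have Dn: "(\<Prod>j\<in>I - {k}. c k - c j) \<noteq> 0" using 2 I inj by (auto simp: inj_on_def)
      hence "poly q y = (\<Sum>i\<in>I. if i = k then B k * (c k * (\<Prod>j\<in>I - {k}. c k - c j)) else 0)"
        unfolding q_eval using 2 Z zero by (auto simp del: prod_zero_iff intro!: sum.cong)
      also have "\<dots> = B k * (c k * (\<Prod>j\<in>I - {k}. c k - c j))" using I 2 by simp
      also have "\<dots> = (c k + c k) * (\<Prod>j\<in>I - {k}. c k + c j)"
        using Dn by (simp add: B_def prod_dividef del: prod_zero_iff)
      also have "\<dots> = poly p y"
        unfolding p_def poly_prod 2 by (subst prod.remove[OF I 2(1)]) (simp add: add.commute)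
      finally show ?thesis by simp
    qed
  qed
  hence pq: "poly p x = poly q x" by simp
  have D: "(\<Prod>j\<in>I. x - c j) \<noteq> 0" using x I by auto
  have Di: "(\<Prod>j\<in>I - {i}. x - c j) / (\<Prod>j\<in>I. x - c j) = 1 / (x - c i)" if i: "i \<in> I" for i
  proof -
    have "(\<Prod>j\<in>I. x - c j) = (x - c i) * (\<Prod>j\<in>I - {i}. x - c j)" by (rule prod.remove[OF I i])
    thus ?thesis using D by (simp add: divide_simps)
  qed
  have "(\<Prod>i\<in>I. (x + c i) / (x - c i)) = poly p x / (\<Prod>j\<in>I. x - c j)"
    by (simp add: p_def poly_prod prod_dividef add.commute)
  also have "\<dots> = ((- 1) ^ card I * (\<Prod>j\<in>I. x - c j) + (\<Sum>i\<in>I. B i * (x * (\<Prod>j\<in>I - {i}. x - c j)))) / (\<Prod>j\<in>I. x - c j)"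
    by (simp only: pq q_eval)
  also have "\<dots> = (- 1) ^ card I + (\<Sum>i\<in>I. B i * x * ((\<Prod>j\<in>I - {i}. x - c j) / (\<Prod>j\<in>I. x - c j)))"
    by (simp only: add_divide_distrib sum_divide_distrib times_divide_eq_right nonzero_mult_div_cancel_right[OF D]
        mult.assoc)
  also have "\<dots> = (- 1) ^ card I + (\<Sum>i\<in>I. B i * x / (x - c i))"
    using Di by simp
  finally show ?thesis by (simp add: B_def)
qed

text \<open>With x = 1/y the factor (1 + cy)/(1 - cy) becomes (x + c)/(x - c). The partial fractions
  are therefore used in the field of Laurent series, at x = \<open>fls_X_inv\<close>, and the result
  is read back in power series.\<close>

lemma q_coeff_eq_sum:
  fixes c :: "nat \<Rightarrow> 'a::field"
  assumes inj: "inj_on c {1..r}" and nz: "\<And>i. i \<in> {1..r} \<Longrightarrow> c i \<noteq> 0"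
  shows "q_coeff r c a = (if a = 0 then (- 1) ^ r else 0) +
    (\<Sum>i = 1..r. 2 * (\<Prod>j\<in>{1..r} - {i}. (c i + c j) / (c i - c j)) * c i ^ a)"
proof -
  define B where "B i = 2 * (\<Prod>j\<in>{1..r} - {i}. (c i + c j) / (c i - c j))" for i
  have geom: "inverse (1 - fps_const d * fps_X) = Abs_fps (\<lambda>n. d ^ n)" for d :: 'a
  proof (rule fps_inverse_unique)
    show "(1 - fps_const d * fps_X) * Abs_fps (\<lambda>n. d ^ n) = 1"
    proof (rule fps_ext)
      fix n show "fps_nth ((1 - fps_const d * fps_X) * Abs_fps (\<lambda>n. d ^ n)) n = fps_nth 1 n"
        by (cases n) (simp_all add: left_diff_distrib mult.assoc)
    qed
  qed
  have const: "fps_to_fls (fps_const d) = fls_const d" for d :: 'a by (intro fls_eqI) simp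
  have fX: "fps_to_fls fps_X = (fls_X :: 'a fls)" by (intro fls_eqI) simp
  have lift1: "fps_to_fls (1 + fps_const d * fps_X) = 1 + fls_const d * fls_X"
    "fps_to_fls (1 - fps_const d * fps_X) = 1 - fls_const d * fls_X" for d :: 'a
    by (simp_all only: fps_to_fls_plus fps_to_fls_minus fls_times_fps_to_fls const fX fps_one_to_fls)
  have const_inj: "fls_const d = fls_const e \<longleftrightarrow> d = e" for d e :: 'a
  proof
    assume "fls_const d = fls_const e"
    hence "fls_nth (fls_const d) 0 = fls_nth (fls_const e) 0" by simp
    thus "d = e" by simp
  qed simp
  have ne: "fls_X_inv \<noteq> fls_const (d :: 'a)" for d
  proof
    assume "fls_X_inv = fls_const d"
    hence "fls_nth fls_X_inv (- 1) = fls_nth (fls_const d) (- 1)" by simp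
    thus False by simp
  qed
  have frac: "(fls_X_inv + fls_const d) / (fls_X_inv - fls_const e) = (1 + fls_const d * fls_X) / (1 - fls_const e * fls_X)"
    "fls_X_inv / (fls_X_inv - fls_const e) = 1 / (1 - fls_const e * fls_X)" for d e :: 'a
  proof -
    have X: "fls_X_inv * fls_X = (1 :: 'a fls)" by (simp add: fls_X_inv_times_conv_shift)
    have "a / b = (a * fls_X) / (b * fls_X)" for a b :: "'a fls" by simp
    from this[of "fls_X_inv + fls_const d" "fls_X_inv - fls_const e"] this[of fls_X_inv "fls_X_inv - fls_const e"]
    show "(fls_X_inv + fls_const d) / (fls_X_inv - fls_const e) = (1 + fls_const d * fls_X) / (1 - fls_const e * fls_X)"
      "fls_X_inv / (fls_X_inv - fls_const e) = 1 / (1 - fls_const e * fls_X)"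
      by (simp_all only: distrib_right left_diff_distrib X)
  qed
  have lift_prod: "fps_to_fls (\<Prod>i\<in>J. f i) = (\<Prod>i\<in>J. fps_to_fls (f i))" for J and f :: "nat \<Rightarrow> 'a fps"
    by (induction J rule: infinite_finite_induct) (simp_all add: fls_times_fps_to_fls)
  have lift_sum: "fps_to_fls (\<Sum>i\<in>J. f i) = (\<Sum>i\<in>J. fps_to_fls (f i))" for J and f :: "nat \<Rightarrow> 'a fps"
    by (induction J rule: infinite_finite_induct) simp_all
  have const_prod: "fls_const (\<Prod>i\<in>J. f i) = (\<Prod>i\<in>J. fls_const (f i))" for J and f :: "nat \<Rightarrow> 'a"
    by (induction J rule: infinite_finite_induct) (simp_all flip: fls_const_mult_const)
  have const_sum: "fls_const (d + e) = fls_const d + fls_const e" "fls_const (d - e) = fls_const d - fls_const e" for d e :: 'a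
    by (auto intro!: fls_eqI)
  have lift2: "inverse (1 - fls_const d * fls_X) = fps_to_fls (Abs_fps (\<lambda>n. d ^ n))" for d :: 'a
    unfolding geom[symmetric] by (subst fps_to_fls_inverse_unit) (simp, simp only: lift1)
  have "fps_to_fls (\<Prod>i = 1..r. (1 + fps_const (c i) * fps_X) / (1 - fps_const (c i) * fps_X)) =
      (\<Prod>i = 1..r. (1 + fls_const (c i) * fls_X) / (1 - fls_const (c i) * fls_X))"
    unfolding lift_prod
    by (intro prod.cong refl) (simp add: fps_divide_unit fls_times_fps_to_fls fps_to_fls_inverse_unit lift1 divide_inverse)
  also have "\<dots> = (\<Prod>i = 1..r. (fls_X_inv + fls_const (c i)) / (fls_X_inv - fls_const (c i)))"
    by (simp only: frac)
  also have "\<dots> = (- 1) ^ card {1..r} + (\<Sum>i\<in>{1..r}. 2 * (\<Prod>j\<in>{1..r} - {i}.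
      (fls_const (c i) + fls_const (c j)) / (fls_const (c i) - fls_const (c j))) * fls_X_inv / (fls_X_inv - fls_const (c i)))"
  proof (rule prod_cayley_partial_fractions)
    show "inj_on (\<lambda>i. fls_const (c i)) {1..r}" 
      using inj unfolding inj_on_def const_inj .
    show "fls_const (c i) \<noteq> 0" if "i \<in> {1..r}" for i using nz[OF that] by simp
  qed (simp_all only: ne finite_atLeastAtMost not_False_eq_True)
  also have "\<dots> = (- 1) ^ r + (\<Sum>i = 1..r. fls_const (B i) * fps_to_fls (Abs_fps (\<lambda>n. c i ^ n)))"
    by (simp only: times_divide_eq_right[symmetric] frac divide_inverse[of 1] mult_1_left lift2 B_def
        fls_const_mult_const[symmetric] const_prod fls_const_divide_const[symmetric] const_sum fls_const_numeral card_atLeastAtMost) simp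
  also have "\<dots> = fps_to_fls ((- 1) ^ r + (\<Sum>i = 1..r. fps_const (B i) * Abs_fps (\<lambda>n. c i ^ n)))"
    by (simp add: lift_sum fls_times_fps_to_fls const fps_to_fls_power)
  finally have "(\<Prod>i = 1..r. (1 + fps_const (c i) * fps_X) / (1 - fps_const (c i) * fps_X)) =
      (- 1) ^ r + (\<Sum>i = 1..r. fps_const (B i) * Abs_fps (\<lambda>n. c i ^ n))"
    by (rule iffD1[OF fps_to_fls_eq_iff])
  moreover have "fps_nth ((- 1) ^ r) a = (if a = 0 then (- 1 :: 'a) ^ r else 0)"
    by (cases "even r") simp_all
  ultimately show ?thesis
    by (simp add: q_coeff_def fps_sum_nth B_def)
qed

text \<open>At a = 0 the delta term of admissibility cancels the constant (-1)^r of the partial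
  fractions. What is left has the factors u_i - (-1)^r/2, which turn the coefficients of q_a into
  the residues belonging to the contents u_1, ..., u_r.\<close>

lemma admissible_eq_sum_res_coeff:
  fixes u :: "nat \<Rightarrow> 'a::field"
  assumes two: "(2::'a) \<noteq> 0" and adm: "u_admissible r u \<omega>"
    and inj: "inj_on u {1..r}" and nz: "\<And>i. i \<in> {1..r} \<Longrightarrow> u i \<noteq> 0"
  shows "(\<Sum>i = 1..r. res_coeff r {1..r} u i * u i ^ a) = \<omega> a"
proof -
  define B where "B i = 2 * (\<Prod>j\<in>{1..r} - {i}. (u i + u j) / (u i - u j))" for i
  have q: "q_coeff r u a = (if a = 0 then (- 1) ^ r else 0) + (\<Sum>i = 1..r. B i * u i ^ a)" for a
    unfolding B_def by (rule q_coeff_eq_sum[OF inj nz])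
  have "(- 1 :: 'a) ^ r * (- 1) ^ r = 1" by (simp flip: power_mult_distrib)
  moreover have "\<omega> a = q_coeff r u (a + 1) - 1 / 2 * (- 1) ^ r * q_coeff r u a + 1 / 2 * (if a = 0 then 1 else 0)"
    using adm by (simp add: u_admissible_def)
  ultimately have "\<omega> a = (\<Sum>i = 1..r. B i * u i ^ (a + 1)) - 1 / 2 * (- 1) ^ r * (\<Sum>i = 1..r. B i * u i ^ a)"
    unfolding q by (cases "a = 0") (simp_all add: distrib_left)
  also have "\<dots> = (\<Sum>i = 1..r. res_coeff r {1..r} u i * u i ^ a)"
    unfolding sum_distrib_left sum_subtractf[symmetric] using two
    by (intro sum.cong) (simp_all add: B_def res_coeff_def field_simps)
  finally show ?thesis by simp
qed

section \<open>Operators on a finite basis\<close>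

lemma lookup_vscale: "Poly_Mapping.lookup (c *\<^sub>v v) t = c * Poly_Mapping.lookup v t"
  unfolding vscale_def by (simp add: Poly_Mapping.map.rep_eq when_def)

lemma lookup_basis_vec: "Poly_Mapping.lookup (basis_vec t) u = (if t = u then 1 else 0)"
  unfolding basis_vec_def by (simp add: lookup_single when_def)

text \<open>Operators on the space over all tableaux, since the span of a set depending on n, r and
  \<lambda> is not a type. As a type they become an instance of \<open>ring_1\<close>, so relations
  can be verified by rewriting.\<close>

typedef (overloaded) 'a::field endo =
  "{f :: (tableau \<Rightarrow>\<^sub>0 'a) \<Rightarrow> (tableau \<Rightarrow>\<^sub>0 'a).
     (\<forall>v w. f (v + w) = f v + f w) \<and> (\<forall>c v. f (c *\<^sub>v v) = c *\<^sub>v f v)}"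
  morphisms app endo
  by (rule exI[of _ "\<lambda>_. 0"]) (auto intro!: poly_mapping_eqI simp: lookup_vscale)

setup_lifting type_definition_endo

lemma app_add: "app A (v + w) = app A v + app A w"
  and app_scale: "app A (c *\<^sub>v v) = c *\<^sub>v app A v"
  by (transfer, simp)+

lemma app_zero: "app A 0 = 0"
  using app_add[of A 0 0] by simp

lemma app_sum: "app A (\<Sum>i\<in>I. f i) = (\<Sum>i\<in>I. app A (f i))"
  by (induction I rule: infinite_finite_induct) (auto simp: app_zero app_add)

lemma endo_eqI: "(\<And>v. app A v = app B v) \<Longrightarrow> A = B"
  by (simp add: app_inject[symmetric] fun_eq_iff)

instantiation endo :: (field) ring_1
begin

lift_definition zero_endo :: "'a endo" is "\<lambda>_. 0"
  by (auto intro!: poly_mapping_eqI simp: lookup_vscale)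
lift_definition one_endo :: "'a endo" is "\<lambda>v. v" by simp
lift_definition plus_endo :: "'a endo \<Rightarrow> 'a endo \<Rightarrow> 'a endo" is "\<lambda>f g v. f v + g v"
  by (auto intro!: poly_mapping_eqI simp: lookup_vscale lookup_add algebra_simps)
lift_definition minus_endo :: "'a endo \<Rightarrow> 'a endo \<Rightarrow> 'a endo" is "\<lambda>f g v. f v - g v"
  by (auto intro!: poly_mapping_eqI simp: lookup_vscale lookup_minus lookup_add algebra_simps)
lift_definition uminus_endo :: "'a endo \<Rightarrow> 'a endo" is "\<lambda>f v. - f v"
  by (auto intro!: poly_mapping_eqI simp: lookup_vscale lookup_add algebra_simps)
lift_definition times_endo :: "'a endo \<Rightarrow> 'a endo \<Rightarrow> 'a endo" is "\<lambda>f g v. f (g v)"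
  by simp

instance
proof
  show "(0::'a endo) \<noteq> 1"
  proof
    assume "(0::'a endo) = 1"
    hence "app (0::'a endo) (basis_vec []) = app 1 (basis_vec [])" by simp
    hence "(0::tableau \<Rightarrow>\<^sub>0 'a) = basis_vec []" by transfer
    thus False by (metis lookup_basis_vec lookup_zero one_neq_zero)
  qed
qed (transfer; simp add: fun_eq_iff algebra_simps; fail)+

end

lift_definition scal :: "'a::field \<Rightarrow> 'a endo" is "\<lambda>c v. c *\<^sub>v v"
  by (auto intro!: poly_mapping_eqI simp: lookup_vscale lookup_add algebra_simps)

lemma app_times: "app (A * B) v = app A (app B v)" by transfer simp
lemma app_plus: "app (A + B) v = app A v + app B v" by transfer simp
lemma app_minus: "app (A - B) v = app A v - app B v" by transfer simp
lemma app_0: "app 0 v = 0" by transfer simp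
lemma app_1: "app 1 v = v" by transfer simp
lemma app_scal: "app (scal c) v = c *\<^sub>v v" by transfer simp

lemma scal_commute: "A * scal c = scal c * A"
  by (rule endo_eqI) (simp add: app_times app_scal app_scale)
lemma scal_add: "scal (a + b) = scal a + scal b"
  by (rule endo_eqI, rule poly_mapping_eqI)
    (simp add: app_plus app_scal lookup_vscale lookup_add algebra_simps)
lemma scal_mult: "scal (a * b) = scal a * scal b"
  by (rule endo_eqI, rule poly_mapping_eqI) (simp add: app_times app_scal lookup_vscale)
lemma scal_0: "scal 0 = 0"
  by (rule endo_eqI, rule poly_mapping_eqI) (simp add: app_0 app_scal lookup_vscale)
lemma scal_1: "scal 1 = 1"
  by (rule endo_eqI, rule poly_mapping_eqI) (simp add: app_1 app_scal lookup_vscale)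

section \<open>Matrices and the corner algebra of a finite set of tableaux\<close>

text \<open>The first index is the source: \<open>M t u\<close> is the coefficient of the basis
  vector of \<open>u\<close> in the image of that of \<open>t\<close>, as in the formulas of the
  theorem.\<close>

definition mat :: "tableau set \<Rightarrow> (tableau \<Rightarrow> tableau \<Rightarrow> 'a::field) \<Rightarrow> 'a endo" where
  "mat T M = endo (\<lambda>v. \<Sum>u\<in>T. Poly_Mapping.single u (\<Sum>t\<in>T. Poly_Mapping.lookup v t * M t u))"

lemma lookup_sum_single:
  "finite T \<Longrightarrow> Poly_Mapping.lookup (\<Sum>u\<in>T. Poly_Mapping.single u (f u)) w = (if w \<in> T then f w else 0)"
  by (simp add: lookup_sum lookup_single when_def)

lemma lookup_mat:
  assumes "finite T"
  shows "Poly_Mapping.lookup (app (mat T M) v) u =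
    (if u \<in> T then \<Sum>t\<in>T. Poly_Mapping.lookup v t * M t u else 0)"
proof -
  have "app (mat T M) = (\<lambda>v. \<Sum>u\<in>T. Poly_Mapping.single u (\<Sum>t\<in>T. Poly_Mapping.lookup v t * M t u))"
    unfolding mat_def using assms
    by (intro endo_inverse) (auto intro!: poly_mapping_eqI
      simp: lookup_sum_single lookup_vscale lookup_add algebra_simps sum.distrib sum_distrib_left)
  thus ?thesis using assms by (simp add: lookup_sum_single)
qed

definition entry :: "'a::field endo \<Rightarrow> tableau \<Rightarrow> tableau \<Rightarrow> 'a" where
  "entry A t u = Poly_Mapping.lookup (app A (basis_vec t)) u"

lemma entry_plus: "entry (A + B) t u = entry A t u + entry B t u"
  and entry_minus: "entry (A - B) t u = entry A t u - entry B t u"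
  and entry_0: "entry 0 t u = 0"
  by (simp_all add: entry_def app_plus app_minus app_0 lookup_add lookup_minus)

lemma entry_scal: "entry (scal c * A) t u = c * entry A t u"
  by (simp add: entry_def app_times app_scal lookup_vscale)

lemma entry_mat: "finite T \<Longrightarrow> entry (mat T M) t u = (if t \<in> T \<and> u \<in> T then M t u else 0)"
  by (auto simp: entry_def lookup_mat lookup_basis_vec if_distrib[of "\<lambda>x. x * _"] cong: if_cong)

text \<open>The unit of the corner algebra is the projection onto the span of \<open>T\<close>, not the identity operator.\<close>

locale finite_basis =
  fixes T :: "tableau set"
  assumes finite_T: "finite T"
begin

definition proj :: "'a::field endo" where
  "proj = mat T (\<lambda>t u. if t = u then 1 else 0)"

definition corner :: "'a::field endo set" where
  "corner = {A. proj * A = A \<and> A * proj = A}"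

lemma lookup_proj: "Poly_Mapping.lookup (app proj v) u = (if u \<in> T then Poly_Mapping.lookup v u else 0)"
  by (simp add: proj_def lookup_mat finite_T if_distrib cong: if_cong)

lemma proj_idem: "proj * proj = proj"
  by (rule endo_eqI, rule poly_mapping_eqI) (simp add: app_times lookup_proj)

lemma app_proj: "app proj v = (\<Sum>t\<in>T. Poly_Mapping.lookup v t *\<^sub>v basis_vec t)"
  by (rule poly_mapping_eqI)
    (simp add: lookup_proj lookup_sum lookup_vscale lookup_basis_vec finite_T if_distrib cong: if_cong)

lemma proj_corner: "proj \<in> corner"
  by (simp add: corner_def proj_idem)

lemma mat_corner: "mat T M \<in> corner"
  unfolding corner_def
  by (auto intro!: endo_eqI poly_mapping_eqI simp: app_times lookup_proj lookup_mat finite_T)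

lemma corner_proj: "A \<in> corner \<Longrightarrow> proj * A = A" "A \<in> corner \<Longrightarrow> A * proj = A"
  by (simp_all add: corner_def)

lemma corner_0: "0 \<in> corner" by (simp add: corner_def)
lemma corner_plus: "A \<in> corner \<Longrightarrow> B \<in> corner \<Longrightarrow> A + B \<in> corner"
  by (simp add: corner_def algebra_simps)
lemma corner_minus: "A \<in> corner \<Longrightarrow> B \<in> corner \<Longrightarrow> A - B \<in> corner"
  by (simp add: corner_def algebra_simps)
lemma corner_times: "A \<in> corner \<Longrightarrow> B \<in> corner \<Longrightarrow> A * B \<in> corner"
  unfolding corner_def by (metis (mono_tags, lifting) mem_Collect_eq mult.assoc)
lemma corner_scal: "A \<in> corner \<Longrightarrow> scal c * A \<in> corner"
  unfolding corner_def by (smt (verit) mem_Collect_eq mult.assoc scal_commute)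

lemmas corner_intros = proj_corner mat_corner corner_0 corner_plus corner_minus corner_times corner_scal

lemma entry_corner: "A \<in> corner \<Longrightarrow> t \<notin> T \<or> u \<notin> T \<Longrightarrow> entry A t u = 0"
proof -
  assume A: "A \<in> corner" and tu: "t \<notin> T \<or> u \<notin> T"
  have 1: "entry A t u = (if u \<in> T then entry A t u else 0)"
    using A by (metis (mono_tags, lifting) app_times corner_def entry_def lookup_proj mem_Collect_eq)
  have "app proj (basis_vec t) = 0" if "t \<notin> T"
    using that by (auto intro!: poly_mapping_eqI simp: lookup_proj lookup_basis_vec)
  hence "entry A t u = 0" if "t \<notin> T"
    using A that by (metis (mono_tags, lifting) app_times app_zero corner_def entry_def lookup_zero mem_Collect_eq)
  thus ?thesis using 1 tu by auto
qed

lemma lookup_corner: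
  assumes "A \<in> corner"
  shows "Poly_Mapping.lookup (app A v) u = (\<Sum>t\<in>T. Poly_Mapping.lookup v t * entry A t u)"
proof -
  have "app A v = app A (app proj v)"
    using assms by (metis (mono_tags, lifting) app_times corner_def mem_Collect_eq)
  also have "\<dots> = (\<Sum>t\<in>T. Poly_Mapping.lookup v t *\<^sub>v app A (basis_vec t))"
    by (simp add: app_proj app_sum app_scale)
  finally show ?thesis by (simp add: lookup_sum lookup_vscale entry_def)
qed

lemma corner_eqI:
  assumes "A \<in> corner" "B \<in> corner" "\<And>t u. t \<in> T \<Longrightarrow> u \<in> T \<Longrightarrow> entry A t u = entry B t u"
  shows "A = B"
proof (rule endo_eqI, rule poly_mapping_eqI)
  fix v u
  have "entry A t u = entry B t u" if "t \<in> T" for t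
    using assms that by (cases "u \<in> T") (simp_all add: entry_corner)
  thus "Poly_Mapping.lookup (app A v) u = Poly_Mapping.lookup (app B v) u"
    using assms by (simp add: lookup_corner)
qed

text \<open>As the first index is the source, composing operators multiplies their matrices in the
  opposite order.\<close>

lemma entry_times:
  assumes "A \<in> corner"
  shows "entry (A * B) t u = (\<Sum>w\<in>T. entry B t w * entry A w u)"
  using assms by (simp add: entry_def[of "A * B"] app_times lookup_corner) (simp add: entry_def)

lemma entry_proj: "entry proj t u = (if t \<in> T \<and> t = u then 1 else 0)"
  by (auto simp: proj_def entry_mat finite_T)

definition corner_ring :: "'a::field endo ring" where
  "corner_ring = \<lparr>carrier = corner, monoid.mult = (*), one = proj, zero = 0, add = (+)\<rparr>"

lemma corner_ring_simps [simp]: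
  "carrier corner_ring = corner" "x \<otimes>\<^bsub>corner_ring\<^esub> y = x * y" "\<one>\<^bsub>corner_ring\<^esub> = proj"
  "\<zero>\<^bsub>corner_ring\<^esub> = 0" "x \<oplus>\<^bsub>corner_ring\<^esub> y = x + y"
  by (simp_all add: corner_ring_def)

lemma ring_corner_ring: "ring (corner_ring :: 'a::field endo ring)"
proof (rule ringI)
  show "abelian_group (corner_ring :: 'a endo ring)"
  proof (rule abelian_groupI)
    fix x :: "'a endo" assume "x \<in> carrier corner_ring"
    thus "\<exists>y\<in>carrier corner_ring. y \<oplus>\<^bsub>corner_ring\<^esub> x = \<zero>\<^bsub>corner_ring\<^esub>"
      using corner_minus[OF corner_0, of x] by (intro bexI[of _ "0 - x"]) simp_all
  qed (auto intro: corner_intros simp: algebra_simps)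
  show "Group.monoid (corner_ring :: 'a endo ring)"
    by (rule monoidI) (auto intro: corner_intros simp: mult.assoc corner_proj)
qed (auto intro: corner_intros simp: algebra_simps)

end

section \<open>Evaluation of the free algebra and passage to quotients\<close>

lemma free_algebra_simps:
  "carrier (free_algebra G) = {f. Poly_Mapping.keys f \<subseteq> lists G}"
  "x \<otimes>\<^bsub>free_algebra G\<^esub> y = x * y" "\<one>\<^bsub>free_algebra G\<^esub> = 1"
  "\<zero>\<^bsub>free_algebra G\<^esub> = 0" "x \<oplus>\<^bsub>free_algebra G\<^esub> y = x + y"
  by (simp_all add: free_algebra_def)

lemma free_carrier_0: "0 \<in> carrier (free_algebra G)"
  and free_carrier_1: "1 \<in> carrier (free_algebra G)"
  and free_carrier_const: "free_const c \<in> carrier (free_algebra G)"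
  and free_carrier_gen: "g \<in> G \<Longrightarrow> free_gen g \<in> carrier (free_algebra G)"
  by (auto simp: free_algebra_simps zero_list_def free_const_def free_gen_def
      simp flip: single_one split: if_splits)

lemma free_carrier_plus:
  "x \<in> carrier (free_algebra G) \<Longrightarrow> y \<in> carrier (free_algebra G) \<Longrightarrow> x + y \<in> carrier (free_algebra G)"
  using Poly_Mapping.keys_add[of x y] by (auto simp: free_algebra_simps)

lemma free_carrier_uminus:
  "x \<in> carrier (free_algebra G) \<Longrightarrow> - x \<in> carrier (free_algebra G)"
  by (auto simp: free_algebra_simps in_keys_iff subset_iff)

lemma free_carrier_minus:
  "x \<in> carrier (free_algebra G) \<Longrightarrow> y \<in> carrier (free_algebra G) \<Longrightarrow> x - y \<in> carrier (free_algebra G)"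
  using free_carrier_plus[OF _ free_carrier_uminus, of x G y] by simp

lemma free_carrier_times:
  "x \<in> carrier (free_algebra G) \<Longrightarrow> y \<in> carrier (free_algebra G) \<Longrightarrow> x * y \<in> carrier (free_algebra G)"
  using Poly_Mapping.keys_mult[of x y]
  by (fastforce simp: free_algebra_simps plus_list_def)

lemma free_carrier_power:
  "x \<in> carrier (free_algebra G) \<Longrightarrow> x ^ k \<in> carrier (free_algebra G)"
  by (induction k) (auto intro: free_carrier_1 free_carrier_times)

lemma free_carrier_prod_list:
  "(\<And>i. i \<in> set xs \<Longrightarrow> f i \<in> carrier (free_algebra G)) \<Longrightarrow> prod_list (map f xs) \<in> carrier (free_algebra G)"
  by (induction xs) (auto intro: free_carrier_1 free_carrier_times)

lemmas free_carrier_intros = free_carrier_0 free_carrier_1 free_carrier_const free_carrier_gen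
  free_carrier_plus free_carrier_minus free_carrier_times free_carrier_power

lemma ring_free_algebra: "ring (free_algebra G :: ('g list \<Rightarrow>\<^sub>0 'a::field) ring)"
proof (rule ringI)
  show "abelian_group (free_algebra G :: ('g list \<Rightarrow>\<^sub>0 'a) ring)"
  proof (rule abelian_groupI)
    fix x :: "'g list \<Rightarrow>\<^sub>0 'a" assume "x \<in> carrier (free_algebra G)"
    thus "\<exists>y\<in>carrier (free_algebra G). y \<oplus>\<^bsub>free_algebra G\<^esub> x = \<zero>\<^bsub>free_algebra G\<^esub>"
      by (intro bexI[of _ "- x"]) (simp_all add: free_algebra_simps(2-) free_carrier_uminus)
  qed (auto simp: free_algebra_simps(2-) algebra_simps intro: free_carrier_intros)
  show "Group.monoid (free_algebra G :: ('g list \<Rightarrow>\<^sub>0 'a) ring)"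
    by (rule monoidI) (auto simp: free_algebra_simps(2-) algebra_simps intro: free_carrier_intros)
qed (auto simp: free_algebra_simps(2-) algebra_simps)

definition free_eval :: "('g \<Rightarrow> 'a::field endo) \<Rightarrow> ('g list \<Rightarrow>\<^sub>0 'a) \<Rightarrow> 'a endo" where
  "free_eval \<rho> f = (\<Sum>w\<in>Poly_Mapping.keys f. scal (Poly_Mapping.lookup f w) * prod_list (map \<rho> w))"

lemma free_eval_superset:
  assumes "finite K" "Poly_Mapping.keys f \<subseteq> K"
  shows "free_eval \<rho> f = (\<Sum>w\<in>K. scal (Poly_Mapping.lookup f w) * prod_list (map \<rho> w))"
  unfolding free_eval_def using assms
  by (intro sum.mono_neutral_left) (auto simp: scal_0 in_keys_iff)

lemma free_eval_plus: "free_eval \<rho> (f + g) = free_eval \<rho> f + free_eval \<rho> g"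
proof -
  let ?K = "Poly_Mapping.keys f \<union> Poly_Mapping.keys g"
  have "free_eval \<rho> h = (\<Sum>w\<in>?K. scal (Poly_Mapping.lookup h w) * prod_list (map \<rho> w))"
    if "h \<in> {f, g, f + g}" for h
    using that Poly_Mapping.keys_add[of f g] by (intro free_eval_superset) auto
  thus ?thesis by (simp add: lookup_add scal_add algebra_simps sum.distrib)
qed

lemma free_eval_0: "free_eval \<rho> 0 = 0"
  by (simp add: free_eval_def)

lemma free_eval_uminus: "free_eval \<rho> (- f) = - free_eval \<rho> f"
  using free_eval_plus[of \<rho> f "- f"] by (simp add: free_eval_0 eq_neg_iff_add_eq_0 add.commute)

lemma free_eval_minus: "free_eval \<rho> (f - g) = free_eval \<rho> f - free_eval \<rho> g"
  by (simp only: diff_conv_add_uminus free_eval_plus free_eval_uminus)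

lemma free_eval_single: "free_eval \<rho> (Poly_Mapping.single w c) = scal c * prod_list (map \<rho> w)"
  by (cases "c = 0") (simp_all add: free_eval_def scal_0)

lemma free_eval_times: "free_eval \<rho> (f * g) = free_eval \<rho> f * free_eval \<rho> g"
proof -
  have 1: "free_eval \<rho> (Poly_Mapping.single w c * Poly_Mapping.single w' c') =
      free_eval \<rho> (Poly_Mapping.single w c) * free_eval \<rho> (Poly_Mapping.single w' c')" for w w' c c'
  proof -
    have "scal (c * c') * (prod_list (map \<rho> w) * prod_list (map \<rho> w')) =
        scal c * (scal c' * prod_list (map \<rho> w)) * prod_list (map \<rho> w')"
      by (simp only: scal_mult mult.assoc)
    also have "scal c' * prod_list (map \<rho> w) = prod_list (map \<rho> w) * scal c'"
      by (rule scal_commute[symmetric])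
    finally show ?thesis by (simp add: mult_single free_eval_single plus_list_def mult.assoc)
  qed
  have upd: "Poly_Mapping.update k v h = h + Poly_Mapping.single k v" if "k \<notin> Poly_Mapping.keys h"
    for k :: "'b list" and v :: 'a and h
    using that by (intro poly_mapping_eqI)
      (auto simp: Poly_Mapping.update.rep_eq lookup_add lookup_single when_def in_keys_iff)
  have 2: "free_eval \<rho> (f * Poly_Mapping.single w' c') = free_eval \<rho> f * free_eval \<rho> (Poly_Mapping.single w' c')"
    for f w' c'
    by (induction f rule: update_induct) (simp_all add: free_eval_0 upd free_eval_plus distrib_right 1)
  show ?thesis
    by (induction g rule: update_induct) (simp_all add: free_eval_0 upd free_eval_plus distrib_left 2)
qed

lemma free_eval_const: "free_eval \<rho> (free_const c) = scal c"
  and free_eval_gen: "free_eval \<rho> (free_gen g) = \<rho> g"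
  by (simp_all add: free_const_def free_gen_def free_eval_single scal_1)

lemma free_eval_1: "free_eval \<rho> 1 = 1"
  by (simp flip: single_one add: free_eval_single zero_list_def scal_1)

lemma free_eval_power: "free_eval \<rho> (f ^ k) = free_eval \<rho> f ^ k"
  by (induction k) (simp_all add: free_eval_1 free_eval_times)

lemma free_eval_prod_list: "free_eval \<rho> (prod_list fs) = prod_list (map (free_eval \<rho>) fs)"
  by (induction fs) (simp_all add: free_eval_1 free_eval_times)

context finite_basis
begin

text \<open>The factor \<open>proj\<close> sends the empty word to the unit of the corner instead of
  the identity operator; on nonempty words in corner elements it has no effect.\<close>

definition eval_corner :: "('g \<Rightarrow> 'a::field endo) \<Rightarrow> ('g list \<Rightarrow>\<^sub>0 'a) \<Rightarrow> 'a endo" where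
  "eval_corner \<rho> f = free_eval \<rho> f * proj"

lemma eval_corner_hom:
  assumes \<rho>: "\<And>g. g \<in> G \<Longrightarrow> \<rho> g \<in> corner"
  shows "eval_corner \<rho> \<in> ring_hom (free_algebra G) (corner_ring :: 'a::field endo ring)"
proof -
  have word: "prod_list (map \<rho> w) * proj \<in> corner" if "w \<in> lists G" for w
    using that by (induction w) (auto simp: mult.assoc intro: corner_intros \<rho>)
  have mem: "eval_corner \<rho> f \<in> corner" if "f \<in> carrier (free_algebra G)" for f
  proof -
    have "(\<Sum>w\<in>K. scal (Poly_Mapping.lookup f w) * (prod_list (map \<rho> w) * proj)) \<in> corner"
      if "finite K" "K \<subseteq> lists G" for K
      using that by (induction K rule: finite_induct) (auto intro: corner_intros word)
    from this[of "Poly_Mapping.keys f"] that show ?thesis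
      by (simp add: eval_corner_def free_eval_def sum_distrib_right mult.assoc free_algebra_simps)
  qed
  show ?thesis
  proof (rule ring_hom_memI)
    show "eval_corner \<rho> x \<in> carrier corner_ring" if "x \<in> carrier (free_algebra G)" for x
      using mem[OF that] by simp
    fix x y :: "'b list \<Rightarrow>\<^sub>0 'a" assume "x \<in> carrier (free_algebra G)" and y: "y \<in> carrier (free_algebra G)"
    have "proj * (free_eval \<rho> y * proj) = free_eval \<rho> y * proj"
      using mem[OF y] by (simp add: corner_def eval_corner_def)
    thus "eval_corner \<rho> (x \<otimes>\<^bsub>free_algebra G\<^esub> y) = eval_corner \<rho> x \<otimes>\<^bsub>corner_ring\<^esub> eval_corner \<rho> y"
      by (simp add: eval_corner_def free_algebra_simps free_eval_times mult.assoc)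
  qed (auto simp: eval_corner_def free_algebra_simps free_eval_plus free_eval_1 algebra_simps)
qed

end

lemma ring_hom_factor_ideal:
  fixes A :: "('x, 'm) ring_scheme" and B :: "('y, 'n) ring_scheme"
  assumes A: "ring A" and B: "ring B" and h: "h \<in> ring_hom A B" and S: "S \<subseteq> carrier A"
    and zero: "\<And>x. x \<in> S \<Longrightarrow> h x = \<zero>\<^bsub>B\<^esub>"
  obtains h' where "h' \<in> ring_hom (A Quot Idl\<^bsub>A\<^esub> S) B"
    and "\<And>x. x \<in> carrier A \<Longrightarrow> h' (Idl\<^bsub>A\<^esub> S +>\<^bsub>A\<^esub> x) = h x"
proof -
  interpret H: ring_hom_ring A B h using A B h by (rule ring_hom_ringI2)
  interpret I: ideal "Idl\<^bsub>A\<^esub> S" A using H.R.genideal_ideal[OF S] .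
  have "Idl\<^bsub>A\<^esub> S \<subseteq> a_kernel A B h"
  proof (rule H.R.genideal_minimal[OF H.kernel_is_ideal])
    show "S \<subseteq> a_kernel A B h" unfolding a_kernel_def' using zero S by blast
  qed
  hence ker: "h x = \<zero>\<^bsub>B\<^esub>" if "x \<in> Idl\<^bsub>A\<^esub> S" for x
    using that unfolding a_kernel_def' by blast
  have coset: "\<exists>x\<in>carrier A. X = Idl\<^bsub>A\<^esub> S +>\<^bsub>A\<^esub> x" if "X \<in> carrier (A Quot Idl\<^bsub>A\<^esub> S)" for X
    using that unfolding FactRing_def A_RCOSETS_def' by auto
  \<comment> \<open>Since \<open>h\<close> vanishes on the ideal, the image of a coset under
    \<open>h\<close> has exactly one element.\<close>
  define h' where "h' X = the_elem (h ` X)" for X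
  have h': "h' (Idl\<^bsub>A\<^esub> S +>\<^bsub>A\<^esub> x) = h x" if x: "x \<in> carrier A" for x
  proof -
    have "h ` (Idl\<^bsub>A\<^esub> S +>\<^bsub>A\<^esub> x) = {h x}"
    proof (intro equalityI subsetI)
      fix y assume "y \<in> h ` (Idl\<^bsub>A\<^esub> S +>\<^bsub>A\<^esub> x)"
      then obtain a where "a \<in> Idl\<^bsub>A\<^esub> S" "y = h (a \<oplus>\<^bsub>A\<^esub> x)"
        unfolding a_r_coset_def' by blast
      thus "y \<in> {h x}" using x ker by (simp add: I.a_Hcarr)
    next
      fix y assume "y \<in> {h x}"
      thus "y \<in> h ` (Idl\<^bsub>A\<^esub> S +>\<^bsub>A\<^esub> x)" using I.a_rcos_self[OF x] by auto
    qed
    thus ?thesis by (simp add: h'_def)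
  qed
  have "h' \<in> ring_hom (A Quot Idl\<^bsub>A\<^esub> S) B"
  proof (rule ring_hom_memI)
    fix X assume "X \<in> carrier (A Quot Idl\<^bsub>A\<^esub> S)"
    then obtain x where "x \<in> carrier A" "X = Idl\<^bsub>A\<^esub> S +>\<^bsub>A\<^esub> x" using coset by blast
    thus "h' X \<in> carrier B" by (simp add: h')
  next
    fix X Y assume "X \<in> carrier (A Quot Idl\<^bsub>A\<^esub> S)" "Y \<in> carrier (A Quot Idl\<^bsub>A\<^esub> S)"
    then obtain x y where "x \<in> carrier A" "X = Idl\<^bsub>A\<^esub> S +>\<^bsub>A\<^esub> x" "y \<in> carrier A" "Y = Idl\<^bsub>A\<^esub> S +>\<^bsub>A\<^esub> y"
      using coset by meson
    thus "h' (X \<otimes>\<^bsub>A Quot Idl\<^bsub>A\<^esub> S\<^esub> Y) = h' X \<otimes>\<^bsub>B\<^esub> h' Y"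
      and "h' (X \<oplus>\<^bsub>A Quot Idl\<^bsub>A\<^esub> S\<^esub> Y) = h' X \<oplus>\<^bsub>B\<^esub> h' Y"
      by (simp_all add: FactRing_def I.rcoset_mult_add I.a_rcos_sum h')
  next
    show "h' \<one>\<^bsub>A Quot Idl\<^bsub>A\<^esub> S\<^esub> = \<one>\<^bsub>B\<^esub>" by (simp add: FactRing_def h')
  qed
  with h' that show ?thesis by blast
qed

context finite_basis
begin

lemma left_module_of_corner_hom:
  assumes A: "ring A" and h: "h \<in> ring_hom A (corner_ring :: 'a::field endo ring)"
  shows "left_module A {v. Poly_Mapping.keys v \<subseteq> T} (\<lambda>x. app (h x))"
proof -
  interpret H: ring_hom_ring A "corner_ring :: 'a endo ring" h
    using A ring_corner_ring h by (rule ring_hom_ringI2)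
  \<comment> \<open>The span of \<open>T\<close> is the set of fixed vectors of the projection, so
    closure under the action becomes an identity between operators.\<close>
  have V: "Poly_Mapping.keys v \<subseteq> T \<longleftrightarrow> app proj v = v" for v :: "tableau \<Rightarrow>\<^sub>0 'a"
    by (auto simp: poly_mapping_eq_iff fun_eq_iff lookup_proj in_keys_iff subset_iff)
  show ?thesis
  proof (intro left_module.intro left_module_axioms.intro; (unfold mem_Collect_eq V)?)
    show "ring A" by fact
    fix v :: "tableau \<Rightarrow>\<^sub>0 'a" assume v: "app proj v = v"
    have "app proj (- v + v) = 0" by (simp add: app_zero)
    thus "app proj (- v) = - v" unfolding app_add v by (simp add: eq_neg_iff_add_eq_0)
    show "app (h \<one>\<^bsub>A\<^esub>) v = v" using v by simp
    fix x assume x: "x \<in> carrier A"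
    show "app proj (app (h x) v) = app (h x) v"
      using H.hom_closed[OF x] by (simp add: corner_def flip: app_times)
  qed (simp_all add: app_zero app_add app_plus app_times)
qed

end

section \<open>The braid relation from the other relations\<close>

text \<open>S exchanges X and Y up to E - e. Passing S twice produces the corrections S(E - e) and
  (E - e)S with opposite signs, and both are equal to E - S.\<close>

lemma skein_square_commutes:
  fixes S E X Y e :: "'x::ring"
  assumes unit: "e * S = S" "S * e = S" "e * X = X" "X * e = X" "e * Y = Y" "Y * e = Y"
    and ES: "E * S = E" and SE: "S * E = E"
    and SX: "S * X - Y * S = E - e" and XS: "X * S - S * Y = E - e"
  shows "S * S * X = X * (S * S)" "S * S * Y = Y * (S * S)"
proof -
  have SX': "S * X = Y * S + (E - e)" using SX by (metis add_diff_cancel_left' diff_add_cancel add.commute)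
  have XS': "X * S = S * Y + (E - e)" using XS by (metis add_diff_cancel_left' diff_add_cancel add.commute)
  have "S * S * X = (S * Y) * S + S * (E - e)" by (simp only: mult.assoc SX' distrib_left)
  also have "S * Y = X * S - (E - e)" by (simp add: XS')
  finally show "S * S * X = X * (S * S)"
    by (simp add: left_diff_distrib right_diff_distrib mult.assoc ES SE unit)
  have "Y * (S * S) = (S * X) * S - (E - e) * S" by (simp add: SX' distrib_right mult.assoc)
  also have "(S * X) * S = S * (S * Y) + S * (E - e)" by (simp only: mult.assoc XS' distrib_left)
  finally show "S * S * Y = Y * (S * S)"
    by (simp add: left_diff_distrib right_diff_distrib mult.assoc ES SE unit)
qed

text \<open>The relations on three strands except the braid relation, with \<open>e\<close> in the role of the unit.\<close>

locale wenzl_triple =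
  fixes S T E F X Y Z e :: "'x::ring"
  assumes unit: "e * S = S" "S * e = S" "e * T = T" "T * e = T" "e * E = E" "E * e = E" "e * F = F" "F * e = F"
      "e * X = X" "X * e = X" "e * Y = Y" "Y * e = Y" "e * Z = Z" "Z * e = Z" "e * e = e"
    and SS: "S * S = e" and TT: "T * T = e"
    and ES: "E * S = E" and FT: "F * T = F"
    and SX: "S * X - Y * S = E - e" and XS: "X * S - S * Y = E - e"
    and TY: "T * Y - Z * T = F - e" and YT: "Y * T - T * Z = F - e"
    and SZ: "S * Z = Z * S" and TX: "T * X = X * T"
    and EFE: "E * (F * E) = E" and FEF: "F * (E * F) = F"
    and SFE: "S * (F * E) = T * E" and FET: "F * (E * T) = F * S"
begin

lemma suffix2: "a * b = d \<Longrightarrow> a * (b * w) = d * w"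
  for a b d w :: 'x by (simp flip: mult.assoc)

lemma suffix3: "a * (b * c) = d \<Longrightarrow> a * (b * (c * w)) = d * w"
  for a b c d w :: 'x by (simp flip: mult.assoc)

text \<open>This and the following word identities, up to \<open>SFS\<close>, evaluate the
  corrections that appear when X, Y and Z are moved through STS and TST.\<close>

lemma STE: "S * (T * E) = F * E"
  using suffix2[OF SS, of "F * E"] suffix2[OF unit(7), of E] by (simp add: SFE)

lemma FST: "F * (S * T) = F * E"
proof -
  have "F * (S * T) = F * (E * (T * T))" using arg_cong[OF FET, of "\<lambda>x. x * T"] by (simp add: mult.assoc)
  thus ?thesis by (simp add: TT unit)
qed

lemma EFS: "E * (F * S) = E * T"
  using arg_cong[OF EFE, of "\<lambda>x. x * T"] by (simp add: mult.assoc FET)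

lemma ETS: "E * (T * S) = E * F"
proof -
  have "E * (T * S) = E * (F * (S * S))" using arg_cong[OF EFS, of "\<lambda>x. x * S"] by (simp add: mult.assoc)
  thus ?thesis by (simp add: SS unit)
qed

lemma TEF: "T * (E * F) = S * F"
  using arg_cong[OF SFE, of "\<lambda>x. x * F"] by (simp add: mult.assoc FEF)

lemma TSF: "T * (S * F) = E * F"
  unfolding TEF[symmetric] using suffix2[OF TT, of "E * F"] suffix2[OF unit(5), of F] by simp

lemma SFS: "S * (F * S) = T * (E * T)"
  unfolding FET[symmetric] using arg_cong[OF SFE, of "\<lambda>x. x * T"] by (simp add: mult.assoc)

lemma move_rules:
  "S * X = Y * S + E - e" "S * Y = X * S - E + e" "T * Y = Z * T + F - e" "T * Z = Y * T - F + e"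
proof -
  have eq: "a = b + (g - e)" if "a - b = g - e" for a b g :: 'x using that by (metis add_diff_cancel_left' diff_add_cancel add.commute)
  have eq': "b = a - g + e" if "a - b = g - e" for a b g :: 'x using that by (metis diff_diff_eq2 diff_diff_eq minus_diff_eq add.commute diff_add_eq uminus_add_conv_diff add_diff_cancel_right')
  show "S * X = Y * S + E - e" "T * Y = Z * T + F - e" using eq[OF SX] eq[OF TY] by (simp_all add: add_diff_eq)
  show "S * Y = X * S - E + e" "T * Z = Y * T - F + e" using eq'[OF XS] eq'[OF YT] .
qed

definition B where "B = S * (T * S) - T * (S * T)"

text \<open>The rules carry X, Y and Z to the left. Most occur a second time with a word appended,
  to apply inside products nested to the right.\<close>

lemmas expand = mult.assoc distrib_left distrib_right right_diff_distrib left_diff_distrib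
  move_rules move_rules[THEN suffix2] SZ SZ[THEN suffix2] TX TX[THEN suffix2]
  SS SS[THEN suffix2] TT TT[THEN suffix2] unit unit[THEN suffix2]
  STE STE[THEN suffix3] FST FST[THEN suffix3] ETS ETS[THEN suffix3] TSF TSF[THEN suffix3] SFS SFS[THEN suffix3]

text \<open>STS and TST move X, Y, Z past themselves in reversed order with corrections that agree.
  For X and Z the corrections differ by SFS - TET, which is zero; for Y both contain the same words
  EF, FE, ST and TS.\<close>

lemma braid_intertwines: "B * X = Z * B" "B * Y = Y * B" "B * Z = X * B"
  by (simp_all only: B_def expand) (simp_all add: algebra_simps)

lemma E_braid: "E * B = 0"
proof -
  have "E * B = (E * S) * (T * S) - (E * (T * S)) * T" by (simp add: B_def right_diff_distrib mult.assoc)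
  also have "\<dots> = 0" by (simp add: ES ETS mult.assoc FT)
  finally show ?thesis .
qed

end

section \<open>The seminormal operators\<close>

definition step_sign :: "tableau \<Rightarrow> nat \<Rightarrow> int" where
  "step_sign t k = (if \<exists>\<alpha>. adds_box (t ! (k - 1)) \<alpha> (t ! k) then 1 else - 1)"

definition step_label :: "tableau \<Rightarrow> nat \<Rightarrow> nat \<times> int" where
  "step_label t k = node_label (t ! k \<ominus>\<^sub>b t ! (k - 1))"

lemma step_move:
  assumes "move r (t ! (k - 1)) \<epsilon> \<alpha> (t ! k)"
  shows "step_sign t k = \<epsilon>" "step_label t k = node_label \<alpha>"
proof -
  note mp = move_multipartition[OF assms]
  have "(\<exists>\<alpha>. adds_box (t ! (k - 1)) \<alpha> (t ! k)) \<longleftrightarrow> \<epsilon> = 1"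
    using assms move_box_unique(1)[OF assms] move_adds_box[OF mp] by blast
  thus "step_sign t k = \<epsilon>" using move_sign[OF assms] by (auto simp: step_sign_def)
  show "step_label t k = node_label \<alpha>" using box_diff_move(1)[OF assms] by (simp add: step_label_def)
qed

locale seminormal =
  fixes n r :: nat and u \<omega> :: "nat \<Rightarrow> 'a::field" and lam :: mpart
    and rt b :: "tableau \<Rightarrow> nat \<Rightarrow> 'a"
  assumes n_pos: "n \<ge> 1"
    and char: "CHAR('a) = 0 \<or> CHAR('a) > 2 * n"
    and gen: "generic n r u"
    and adm: "u_admissible r u \<omega>"
    and root: "root_conditions n r u lam rt b"
begin

abbreviation T :: "tableau set" where "T \<equiv> updown_tableaux n r lam"
abbreviation c :: "tableau \<Rightarrow> nat \<Rightarrow> 'a" where "c \<equiv> tab_content u"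
abbreviation lab :: "tableau \<Rightarrow> nat \<Rightarrow> nat \<times> int" where "lab \<equiv> step_label"
abbreviation sg :: "tableau \<Rightarrow> nat \<Rightarrow> int" where "sg \<equiv> step_sign"
abbreviation P :: "nat \<Rightarrow> tableau \<Rightarrow> bool" where "P k t \<equiv> t ! (k - 1) = t ! (k + 1)"

section \<open>Updown tableaux, their contents and swaps\<close>

lemma two: "(2 :: 'a) \<noteq> 0"
  using of_int_eq_0_bounded[OF char, of 2] n_pos by auto

lemma length_T: "t \<in> T \<Longrightarrow> length t = n + 1"
  by (simp add: updown_tableaux_def)

lemma T_0: "t \<in> T \<Longrightarrow> t ! 0 = (\<lambda>_ _. 0)"
  by (simp add: updown_tableaux_def)

lemma T_move:
  assumes "t \<in> T" "1 \<le> k" "k \<le> n"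
  shows "move r (t ! (k - 1)) (sg t k) (t ! k \<ominus>\<^sub>b t ! (k - 1)) (t ! k)"
proof -
  have mp: "is_multipartition r (t ! (k - 1))" "is_multipartition r (t ! k)"
    using assms by (auto simp: updown_tableaux_def)
  have "\<exists>\<alpha>. differ_by (t ! k) \<alpha> (t ! (k - 1))" using assms by (auto simp: updown_tableaux_def)
  then obtain \<alpha> \<epsilon> where m: "move r (t ! (k - 1)) \<epsilon> \<alpha> (t ! k)"
    using differ_by_move[OF mp] by blast
  thus ?thesis using step_move(1)[OF m] box_diff_move(1)[OF m] by simp
qed

lemma T_moveE:
  assumes "t \<in> T" "1 \<le> k" "k \<le> n"
  obtains \<alpha> where "move r (t ! (k - 1)) (sg t k) \<alpha> (t ! k)" "node_label \<alpha> = lab t k"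
  using T_move[OF assms] by (auto simp: step_label_def)

lemma T_move_Suc:
  assumes "t \<in> T" "k < n"
  shows "move r (t ! k) (sg t (k + 1)) (t ! (k + 1) \<ominus>\<^sub>b t ! k) (t ! (k + 1))"
  using T_move[of t "k + 1"] assms by simp

lemma T_moveE_Suc:
  assumes "t \<in> T" "k < n"
  obtains \<alpha> where "move r (t ! k) (sg t (k + 1)) \<alpha> (t ! (k + 1))" "node_label \<alpha> = lab t (k + 1)"
  using T_moveE[of t "k + 1"] assms by auto

lemma T_multipartition: "t \<in> T \<Longrightarrow> k \<le> n \<Longrightarrow> is_multipartition r (t ! k)"
  by (simp add: updown_tableaux_def)

lemma T_bounded:
  assumes "t \<in> T" "k \<le> n"
  shows "bounded_mpart k (t ! k)"
  using assms(2)
proof (induction k)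
  case 0
  thus ?case using assms by (simp add: T_0 bounded_mpart_def)
next
  case (Suc k)
  thus ?case using bounded_mpart_move(1)[OF T_move[OF assms(1), of "Suc k"]] by simp
qed

lemma bounded_mpart_mono: "bounded_mpart k \<mu> \<Longrightarrow> k \<le> l \<Longrightarrow> bounded_mpart l \<mu>"
  unfolding bounded_mpart_def by (meson order_trans)

lemma finite_T: "finite T"
proof (rule finite_subset)
  let ?M = "{\<mu>. is_multipartition r \<mu> \<and> bounded_mpart n \<mu>}"
  show "T \<subseteq> {t. set t \<subseteq> ?M \<and> length t = n + 1}"
  proof
    fix t assume t: "t \<in> T"
    have "t ! k \<in> ?M" if "k < length t" for k
      using that t T_bounded[OF t, of k] T_multipartition[OF t, of k] length_T[OF t]
      by (auto intro: bounded_mpart_mono)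
    thus "t \<in> {t. set t \<subseteq> ?M \<and> length t = n + 1}"
      using length_T[OF t] by (auto simp: in_set_conv_nth)
  qed
  show "finite {t. set t \<subseteq> ?M \<and> length t = n + 1}"
    by (rule finite_lists_length_eq[OF finite_bounded_mpart])
qed

sublocale finite_basis T
  by unfold_locales (rule finite_T)

text \<open>Concerns every step out of t_{k-1}, not only the one taken by t, because the residues
  involve all addable and removable nodes of that shape.\<close>

lemma label_bounds:
  assumes t: "t \<in> T" and k: "1 \<le> k" "k \<le> n" and m: "move r (t ! (k - 1)) \<epsilon> \<alpha> \<nu>"
  shows "fst (node_label \<alpha>) \<in> {1..r}" "\<bar>snd (node_label \<alpha>)\<bar> < int n"
proof -
  show "fst (node_label \<alpha>) \<in> {1..r}"
    using m move_position(3) by (cases \<alpha>) (auto simp: node_label_def)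
  show "\<bar>snd (node_label \<alpha>)\<bar> < int n"
    using bounded_mpart_move(2)[OF m T_bounded[OF t, of "k - 1"]] k by linarith
qed

lemma lab_bounds:
  assumes "t \<in> T" "1 \<le> k" "k \<le> n"
  shows "fst (lab t k) \<in> {1..r}" "\<bar>snd (lab t k)\<bar> < int n" "sg t k = 1 \<or> sg t k = - 1"
  using label_bounds[OF assms T_move[OF assms]] move_sign[OF T_move[OF assms]] by (simp_all add: step_label_def)

lemma c_eq: "t \<in> T \<Longrightarrow> 1 \<le> k \<Longrightarrow> k \<le> n \<Longrightarrow> c t k = label_content u (sg t k) (lab t k)"
  using tab_content_move[OF T_move] by (simp add: step_label_def)

lemma c_eq_iff:
  assumes "t \<in> T" "1 \<le> k" "k \<le> n" "t' \<in> T" "1 \<le> l" "l \<le> n"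
  shows "c t k = c t' l \<longleftrightarrow> sg t k = sg t' l \<and> lab t k = lab t' l"
  using label_content_inj[OF char gen lab_bounds(1,2)[OF assms(1-3)] lab_bounds(1,2)[OF assms(4-6)]
      lab_bounds(3)[OF assms(1-3)] lab_bounds(3)[OF assms(4-6)]]
  by (auto simp: c_eq[OF assms(1-3)] c_eq[OF assms(4-6)])

lemma content_forward:
  assumes t: "t \<in> T" "t' \<in> T" and k: "1 \<le> k" "k \<le> n" and eq: "t ! (k - 1) = t' ! (k - 1)" "c t k = c t' k"
  shows "t ! k = t' ! k"
proof -
  have "lab t k = lab t' k" using c_eq_iff[OF t(1) k t(2) k] eq by simp
  moreover obtain \<alpha> where "move r (t ! (k - 1)) (sg t k) \<alpha> (t ! k)" "node_label \<alpha> = lab t k"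
    using T_moveE[OF t(1) k] .
  moreover obtain \<alpha>' where "move r (t' ! (k - 1)) (sg t' k) \<alpha>' (t' ! k)" "node_label \<alpha>' = lab t' k"
    using T_moveE[OF t(2) k] .
  ultimately show ?thesis using move_unique(3) eq by metis
qed

lemma contents_forward:
  assumes t: "t \<in> T" "t' \<in> T" and k: "k \<le> n" and eq: "\<And>j. 1 \<le> j \<Longrightarrow> j \<le> k \<Longrightarrow> c t j = c t' j"
  shows "t ! k = t' ! k"
  using k eq
proof (induction k)
  case 0
  thus ?case using t by (simp add: T_0)
next
  case (Suc k)
  thus ?case using content_forward[OF t, of "Suc k"] by simp
qed

lemma contents_eqI:
  assumes t: "t \<in> T" "t' \<in> T" and eq: "\<And>j. 1 \<le> j \<Longrightarrow> j \<le> n \<Longrightarrow> c t j = c t' j"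
  shows "t = t'"
proof (rule nth_equalityI)
  show "length t = length t'" using t by (simp add: length_T)
  show "t ! k = t' ! k" if "k < length t" for k
    using that length_T[OF t(1)] by (intro contents_forward[OF t]) (auto intro: eq)
qed

lemma P_iff:
  assumes t: "t \<in> T" and k: "1 \<le> k" "k < n"
  shows "P k t \<longleftrightarrow> lab t k = lab t (k + 1)"
proof -
  have "1 \<le> k" "k \<le> n" using k by auto
  from move_back_iff[OF T_move[OF t this] T_move_Suc[OF t k(2)]] show ?thesis
    by (auto simp: step_label_def)
qed

lemma c_next:
  assumes t: "t \<in> T" and k: "1 \<le> k" "k < n" and P: "P k t"
  shows "c t (k + 1) = - c t k"
proof -
  have k': "1 \<le> k" "k \<le> n" using k by auto
  have "move r (t ! (k + 1 - 1)) (- sg t k) (t ! k \<ominus>\<^sub>b t ! (k - 1)) (t ! (k + 1))"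
    using move_sym[OF T_move[OF t k']] P by simp
  from tab_content_move[OF this, of u] show ?thesis
    using c_eq[OF t k'] by (simp add: label_content_def step_label_def)
qed

lemma c_local:
  assumes "t ! (k - 1) = t' ! (k - 1)" "t ! k = t' ! k"
  shows "c t k = c t' k"
  using assms by (simp add: tab_content_def)

lemma sim_nth: "t \<in> T \<Longrightarrow> tab_sim k v t \<Longrightarrow> j \<noteq> k \<Longrightarrow> j \<le> n \<Longrightarrow> v ! j = t ! j"
  by (auto simp: tab_sim_def length_T)

lemma sim_iff: "t \<in> T \<Longrightarrow> v \<in> T \<Longrightarrow> tab_sim k v t \<longleftrightarrow> (\<forall>j\<le>n. j \<noteq> k \<longrightarrow> v ! j = t ! j)"
  by (auto simp: tab_sim_def length_T less_Suc_eq_le)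

lemma sim_refl: "tab_sim k t t"
  by (simp add: tab_sim_def)

lemma sim_sym: "tab_sim k t v \<longleftrightarrow> tab_sim k v t"
  by (auto simp: tab_sim_def)

lemma sim_trans: "tab_sim k t v \<Longrightarrow> tab_sim k v w \<Longrightarrow> tab_sim k t w"
  by (simp add: tab_sim_def)

lemma tab_eqI: "t \<in> T \<Longrightarrow> v \<in> T \<Longrightarrow> (\<And>j. j \<le> n \<Longrightarrow> t ! j = v ! j) \<Longrightarrow> t = v"
  by (rule nth_equalityI) (auto simp: length_T)

lemma sim_eqI: "t \<in> T \<Longrightarrow> v \<in> T \<Longrightarrow> tab_sim k v t \<Longrightarrow> v ! k = t ! k \<Longrightarrow> v = t"
  by (rule tab_eqI) (auto simp: sim_iff)

lemma c_sim:
  assumes "t \<in> T" "tab_sim k v t" "1 \<le> j" "j \<le> n" "j \<noteq> k" "j \<noteq> k + 1"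
  shows "c v j = c t j"
  using assms by (intro c_local sim_nth[OF assms(1,2)]) auto

lemma P_sim:
  assumes "t \<in> T" "tab_sim k v t" "1 \<le> k" "k < n"
  shows "P k v \<longleftrightarrow> P k t"
  using sim_nth[OF assms(1,2), of "k - 1"] sim_nth[OF assms(1,2), of "k + 1"] assms by simp

lemma update_in_T:
  assumes t: "t \<in> T" and k: "1 \<le> k" "k < n"
    and m: "move r (t ! (k - 1)) \<epsilon> \<alpha> \<nu>" "move r \<nu> \<eta> \<beta> (t ! (k + 1))"
  shows "t[k := \<nu>] \<in> T"
proof -
  let ?t = "t[k := \<nu>]"
  have nth: "?t ! j = (if j = k then \<nu> else t ! j)" for j
    using k length_T[OF t] by simp
  have mp: "is_multipartition r (?t ! j)" if "j \<le> n" for j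
    using that T_multipartition[OF t] move_multipartition(2)[OF m(1)] by (simp add: nth)
  have "\<exists>\<alpha>. differ_by (?t ! j) \<alpha> (?t ! (j - 1))" if j: "j \<in> {1..n}" for j
  proof -
    have "\<exists>\<alpha> \<epsilon>. move r (?t ! (j - 1)) \<epsilon> \<alpha> (?t ! j)"
    proof -
      consider "j = k" | "j = k + 1" | "j \<noteq> k" "j \<noteq> k + 1" by blast
      thus ?thesis
      proof cases
        case 1
        hence "?t ! (j - 1) = t ! (k - 1)" "?t ! j = \<nu>" using k nth by auto
        thus ?thesis using m by metis
      next
        case 2
        hence "?t ! (j - 1) = \<nu>" "?t ! j = t ! (k + 1)" using nth by auto
        thus ?thesis using m by metis
      next
        case 3
        hence "?t ! (j - 1) = t ! (j - 1)" "?t ! j = t ! j" using nth j by auto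
        moreover have "1 \<le> j" "j \<le> n" using j by auto
        ultimately show ?thesis using T_move[OF t, of j] by metis
      qed
    qed
    moreover have "is_multipartition r (?t ! (j - 1))" "is_multipartition r (?t ! j)" using mp j by auto
    ultimately show ?thesis using differ_by_move by blast
  qed
  thus ?thesis using mp t k nth length_T[OF t] by (simp add: updown_tableaux_def)
qed

lemma splice_in_T:
  assumes t: "t \<in> T" "w \<in> T" and k: "1 \<le> k" "k < n"
    and eq: "w ! (k - 1) = t ! (k - 1)" "w ! (k + 1) = t ! (k + 1)"
  shows "t[k := w ! k] \<in> T"
  using update_in_T[OF t(1) k] T_move[OF t(2), of k] T_move_Suc[OF t(2) k(2)] k eq by auto

lemma update_nth: "t \<in> T \<Longrightarrow> k \<le> n \<Longrightarrow> t[k := \<nu>] ! j = (if j = k then \<nu> else t ! j)"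
  using length_T[of t] by simp

lemma update_sim: "tab_sim k (t[k := \<nu>]) t"
  by (simp add: tab_sim_def)

lemma c_ne:
  assumes t: "t \<in> T" and k: "1 \<le> k" "k < n" and P: "\<not> P k t"
  shows "c t k \<noteq> c t (k + 1)"
  using c_eq_iff[OF t _ _ t, of k "k + 1"] P_iff[OF t k] P k by auto

text \<open>These are the denominators of \<open>s_coeff\<close>. Both steps leave the same shape,
  so equal labels carry equal signs and the contents cannot be opposite.\<close>

lemma c_sum_ne:
  assumes t: "t \<in> T" "v \<in> T" and k: "1 \<le> k" "k \<le> n" and eq: "t ! (k - 1) = v ! (k - 1)"
  shows "c t k + c v k \<noteq> 0"
proof -
  have "sg t k = sg v k" if l: "lab t k = lab v k"
    using move_unique(1)[OF T_move[OF t(1) k], of "sg v k"] T_move[OF t(2) k] l eq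
    by (auto simp: step_label_def)
  thus ?thesis unfolding c_eq[OF t(1) k] c_eq[OF t(2) k]
    by (intro label_content_sum_nonzero[OF char gen] lab_bounds[OF t(1) k] lab_bounds[OF t(2) k])
qed

lemma swap_defined_iff:
  assumes t: "t \<in> T" and k: "1 \<le> k" "k < n"
  shows "swap_defined k t \<longleftrightarrow> cartan (lab t k) (lab t (k + 1)) = 0"
proof (cases "P k t")
  case True
  hence "lab t k = lab t (k + 1)" using P_iff[OF t k] by simp
  thus ?thesis using True by (simp add: swap_defined_def)
next
  case False
  obtain i j s where 1: "t ! k \<ominus>\<^sub>b t ! (k - 1) = (i, j, s)" by (cases "t ! k \<ominus>\<^sub>b t ! (k - 1)")
  obtain i' j' s' where 2: "t ! (k + 1) \<ominus>\<^sub>b t ! k = (i', j', s')" by (cases "t ! (k + 1) \<ominus>\<^sub>b t ! k")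
  have "k \<le> n" using k by simp
  have "lab t k = node_label (i, j, s)" "lab t (k + 1) = node_label (i', j', s')"
    using 1 2 by (simp_all add: step_label_def)
  with far_iff[OF T_move[OF t k(1) \<open>k \<le> n\<close>, unfolded 1] T_move_Suc[OF t k(2), unfolded 2]] False
  show ?thesis unfolding swap_defined_def 1 2 prod.case by metis
qed

text \<open>The labels are adjacent, so the signs agree and the contents differ by 1 or -1. Hence
  b_t(k) = 0, and the convention v_{S_k t} = 0 for undefined S_k t is compatible with S_k^2 =
  1.\<close>

lemma a_coeff_undefined:
  assumes t: "t \<in> T" and k: "1 \<le> k" "k < n" and P: "\<not> P k t" and nd: "\<not> swap_defined k t"
  shows "a_coeff u k t ^ 2 = 1"
proof -
  have k': "k \<le> n" using k by simp
  have ca: "cartan (lab t k) (lab t (k + 1)) = - 1"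
    using cartan_cases[of "lab t k" "lab t (k + 1)"] P nd P_iff[OF t k] swap_defined_iff[OF t k] by auto
  have sg: "sg t k = sg t (k + 1)"
    using move_move_adjacent[OF T_move[OF t k(1) k'] T_move_Suc[OF t k(2)]] ca by (simp add: step_label_def)
  have fl: "fst (lab t k) = fst (lab t (k + 1))" "\<bar>snd (lab t k) - snd (lab t (k + 1))\<bar> = 1"
    using ca by (auto simp: cartan_def split: if_splits)
  define d where "d = sg t k * (snd (lab t (k + 1)) - snd (lab t k))"
  have "c t (k + 1) - c t k = of_int d"
    using k by (simp add: c_eq[OF t] sg fl label_content_def algebra_simps d_def)
  moreover have "d = 1 \<or> d = - 1"
    using lab_bounds(3)[OF t k(1) k'] fl(2) by (auto simp: d_def)
  ultimately have "c t (k + 1) - c t k = 1 \<or> c t (k + 1) - c t k = - 1" by auto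
  thus ?thesis by (auto simp: a_coeff_def)
qed

text \<open>The diamond provides a multipartition with the property described in
  \<open>swap_tab\<close>. It is the only one, because a step out of t_{k-1} is determined by its
  label.\<close>

lemma swap_tab_moves:
  assumes t: "t \<in> T" and k: "1 \<le> k" "k < n" and d: "swap_defined k t"
  obtains \<nu> \<alpha> \<beta> where "swap_tab r k t = t[k := \<nu>]" "move r (t ! (k - 1)) (sg t (k + 1)) \<beta> \<nu>"
    "move r \<nu> (sg t k) \<alpha> (t ! (k + 1))" "node_label \<alpha> = lab t k" "node_label \<beta> = lab t (k + 1)"
proof -
  have k': "k \<le> n" using k by simp
  define \<alpha> where "\<alpha> = t ! k \<ominus>\<^sub>b t ! (k - 1)"
  define \<beta> where "\<beta> = t ! (k + 1) \<ominus>\<^sub>b t ! k"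
  note m1 = T_move[OF t k(1) k', folded \<alpha>_def] and m2 = T_move_Suc[OF t k(2), folded \<beta>_def]
  have sym: "t ! (k - 1) \<ominus>\<^sub>b t ! k = \<alpha>" "t ! k \<ominus>\<^sub>b t ! (k + 1) = \<beta>"
    using box_diff_move(2)[OF m1] box_diff_move(2)[OF m2] by auto
  have la: "node_label \<alpha> = lab t k" "node_label \<beta> = lab t (k + 1)"
    by (simp_all add: step_label_def \<alpha>_def \<beta>_def)
  have "cartan (node_label \<alpha>) (node_label \<beta>) = 0" using d swap_defined_iff[OF t k] la by simp
  then obtain \<nu> where \<nu>: "move r (t ! (k - 1)) (sg t (k + 1)) \<beta> \<nu>" "move r \<nu> (sg t k) \<alpha> (t ! (k + 1))"
    using diamond[OF m1 m2] by blast
  have mp: "is_multipartition r (t ! (k - 1))" "is_multipartition r (t ! (k + 1))"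
    using m1 m2 move_multipartition by blast+
  have "(THE \<mu>. is_multipartition r \<mu> \<and> differ_by \<mu> \<alpha> (t ! (k + 1)) \<and> differ_by (t ! (k - 1)) \<beta> \<mu>) = \<nu>"
  proof (rule the_equality)
    have "move r (t ! (k + 1)) (- sg t k) \<alpha> \<nu>" "move r \<nu> (- sg t (k + 1)) \<beta> (t ! (k - 1))"
      using \<nu> move_sym by blast+
    thus "is_multipartition r \<nu> \<and> differ_by \<nu> \<alpha> (t ! (k + 1)) \<and> differ_by (t ! (k - 1)) \<beta> \<nu>"
      using differ_by_move move_multipartition(2)[OF \<nu>(1)] mp by blast
  next
    fix \<mu> assume \<mu>: "is_multipartition r \<mu> \<and> differ_by \<mu> \<alpha> (t ! (k + 1)) \<and> differ_by (t ! (k - 1)) \<beta> \<mu>"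
    hence "is_multipartition r \<mu>" by simp
    from \<mu> differ_by_move[OF this mp(1)] obtain \<epsilon> where "move r \<mu> \<epsilon> \<beta> (t ! (k - 1))" by blast
    from move_unique(3)[OF move_sym[OF this] \<nu>(1) refl] show "\<mu> = \<nu>" .
  qed
  hence "swap_tab r k t = t[k := \<nu>]" unfolding swap_tab_def sym by (simp only:)
  with \<nu> la that show ?thesis by blast
qed

text \<open>The swap exchanges signs and labels of two steps, hence their contents. It is an
  involution since a step is determined by its starting shape and its label.\<close>

lemma swap_facts:
  assumes t: "t \<in> T" and k: "1 \<le> k" "k < n" and d: "swap_defined k t"
  defines "s \<equiv> swap_tab r k t"
  shows swap_in_T: "s \<in> T" and swap_sim: "tab_sim k s t"
    and swap_lab: "lab s k = lab t (k + 1)" "lab s (k + 1) = lab t k"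
    and swap_c: "c s k = c t (k + 1)" "c s (k + 1) = c t k"
    and swap_swap_defined: "swap_defined k s" and swap_not_P: "\<not> P k t" "\<not> P k s"
    and swap_swap: "swap_tab r k s = t" and swap_ne: "s \<noteq> t"
proof -
  obtain \<nu> \<alpha> \<beta> where \<nu>: "s = t[k := \<nu>]" "move r (t ! (k - 1)) (sg t (k + 1)) \<beta> \<nu>"
    "move r \<nu> (sg t k) \<alpha> (t ! (k + 1))" "node_label \<alpha> = lab t k" "node_label \<beta> = lab t (k + 1)"
    unfolding s_def by (rule swap_tab_moves[OF t k d])
  show sT: "s \<in> T" unfolding \<nu>(1) by (rule update_in_T[OF t k \<nu>(2,3)])
  show sim: "tab_sim k s t" unfolding \<nu>(1) by (rule update_sim)
  have k': "k \<le> n" and km: "k - 1 \<noteq> k" using k by auto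
  have nth: "s ! j = (if j = k then \<nu> else t ! j)" for j unfolding \<nu>(1) by (rule update_nth[OF t k'])
  have m1: "move r (s ! (k - 1)) (sg t (k + 1)) \<beta> (s ! k)" using \<nu>(2) km by (simp add: nth)
  have m2: "move r (s ! (k + 1 - 1)) (sg t k) \<alpha> (s ! (k + 1))" using \<nu>(3) by (simp add: nth)
  show l1: "lab s k = lab t (k + 1)" using step_move(2)[OF m1] \<nu>(5) by simp
  show l2: "lab s (k + 1) = lab t k" using step_move(2)[OF m2] \<nu>(4) by simp
  show c1: "c s k = c t (k + 1)" using tab_content_move[OF m1, of u] \<nu>(5) c_eq[OF t, of "k + 1"] k by simp
  show c2: "c s (k + 1) = c t k" using tab_content_move[OF m2, of u] \<nu>(4) c_eq[OF t k(1) k'] by simp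
  show nP: "\<not> P k t" using d by (simp add: swap_defined_def)
  show "\<not> P k s" using nP P_sim[OF t sim k] by simp
  show d': "swap_defined k s" using d l1 l2 by (simp add: swap_defined_iff[OF sT k] swap_defined_iff[OF t k] cartan_commute)
  show ne: "s \<noteq> t" using c1 c_ne[OF t k nP] by auto
  obtain \<nu>' \<alpha>' \<beta>' where \<nu>': "swap_tab r k s = s[k := \<nu>']" "move r (s ! (k - 1)) (sg s (k + 1)) \<beta>' \<nu>'"
    "node_label \<beta>' = lab s (k + 1)"
    by (rule swap_tab_moves[OF sT k d'])
  have "s ! (k - 1) = t ! (k - 1)" using nth km by simp
  moreover have "sg s (k + 1) = sg t k" using step_move(1)[OF m2] by simp
  ultimately have "\<nu>' = t ! k"
    using move_unique(3)[OF \<nu>'(2), of "sg t k"] T_move[OF t k(1) k'] \<nu>'(3) l2 by (auto simp: step_label_def)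
  hence "s[k := \<nu>'] = t" unfolding \<nu>(1) by simp
  thus "swap_tab r k s = t" using \<nu>'(1) by simp
qed

lemma swap_c_other:
  assumes t: "t \<in> T" and k: "1 \<le> k" "k < n" and d: "swap_defined k t"
    and j: "1 \<le> j" "j \<le> n" "j \<noteq> k" "j \<noteq> k + 1"
  shows "c (swap_tab r k t) j = c t j"
  by (rule c_sim[OF t swap_sim[OF t k d] j])

lemma swap_eqI:
  assumes t: "t \<in> T" "v \<in> T" and k: "1 \<le> k" "k < n" and d: "swap_defined k t"
    and sim: "tab_sim k v t" and eq: "c v k = c t (k + 1)"
  shows "v = swap_tab r k t"
proof -
  note s = swap_facts[OF t(1) k d]
  have k': "k \<le> n" "k - 1 \<noteq> k" "k - 1 \<le> n" using k by auto
  have "v ! (k - 1) = swap_tab r k t ! (k - 1)"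
    using sim_nth[OF t(1) sim k'(2,3)] sim_nth[OF t(1) s(2) k'(2,3)] by simp
  moreover have "c v k = c (swap_tab r k t) k" using eq s(5) by simp
  ultimately have "v ! k = swap_tab r k t ! k" by (rule content_forward[OF t(2) s(1) k(1) k'(1)])
  moreover have "tab_sim k v (swap_tab r k t)" using sim_trans[OF sim] s(2) sim_sym by blast
  ultimately show ?thesis using sim_eqI[OF s(1) t(2)] by blast
qed

text \<open>In order: the squares of the two kinds of roots, then the conditions (a) to (f).\<close>

lemma root_conditions_split:
  shows root_rt: "\<forall>t\<in>T. \<forall>k\<in>{1..<n}. P k t \<longrightarrow> rt t k ^ 2 = e_diag r u k t"
    and root_b: "\<forall>t\<in>T. \<forall>k\<in>{1..<n}. \<not> P k t \<longrightarrow> b t k ^ 2 = 1 - a_coeff u k t ^ 2"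
    and root_swap: "\<forall>t\<in>T. \<forall>k\<in>{1..<n}. \<not> P k t \<and> swap_defined k t \<longrightarrow> b (swap_tab r k t) k = b t k"
    and root_b_far: "\<forall>t\<in>T. \<forall>v\<in>T. \<forall>k\<in>{1..<n}. \<forall>l\<in>{1..<n}.
      \<not> P k t \<and> tab_sim l t v \<and> (k + 1 < l \<or> l + 1 < k) \<longrightarrow> b t k = b v k"
    and root_b_braid: "\<forall>t\<in>T. \<forall>k. k \<in> {1..<n} \<and> k + 1 \<in> {1..<n} \<longrightarrow>
      \<not> P k t \<and> \<not> P (k + 1) t \<and> swap_defined k t \<and> swap_defined (k + 1) t \<and>
      \<not> P k (swap_tab r (k + 1) t) \<and> \<not> P (k + 1) (swap_tab r k t) \<longrightarrow>
      b (swap_tab r (k + 1) t) k = b (swap_tab r k t) (k + 1)"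
    and root_rt_mult: "\<forall>t\<in>T. \<forall>k. k \<in> {1..<n} \<and> k + 1 \<in> {1..<n} \<longrightarrow>
      P k t \<and> P (k + 1) t \<longrightarrow> rt t k * rt t (k + 1) = 1"
    and root_rt_eq: "\<forall>t\<in>T. \<forall>v\<in>T. \<forall>k\<in>{1..<n}. P k t \<and> P k v \<and> e_diag r u k t = e_diag r u k v \<longrightarrow> rt t k = rt v k"
    and root_b_rt: "\<forall>t\<in>T. \<forall>v\<in>T. \<forall>w\<in>T. \<forall>k. k \<in> {1..<n} \<and> k + 1 \<in> {1..<n} \<longrightarrow>
      P k t \<and> P (k + 1) t \<and> tab_sim (k + 1) v t \<and> tab_sim k w t \<and> swap_defined k v \<and>
      swap_defined (k + 1) w \<and> swap_tab r k v = swap_tab r (k + 1) w \<longrightarrow>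
      b v k * rt v (k + 1) = b w (k + 1) * rt w k"
  using root unfolding root_conditions_def Let_def by - (elim conjE, assumption)+

end

lemma sum_single:
  assumes "finite A" "z \<in> A" "\<And>w. w \<in> A \<Longrightarrow> w \<noteq> z \<Longrightarrow> f w = 0"
  shows "sum f A = f z"
  using assms by (subst sum.remove[of A z]) auto

context seminormal
begin

section \<open>The residues e_tt(k) and their sums\<close>

text \<open>The hypotheses of the residue lemmas for the contents at the shape t_{k-1}. The sign
  comes from the Maya diagrams, the conditions on contents from genericity.\<close>

lemma edge_nodes_facts:
  assumes t: "t \<in> T" and k: "1 \<le> k" "k \<le> n"
  defines "A \<equiv> edge_nodes r (t ! (k - 1))" and "d \<equiv> node_content r u (t ! (k - 1))"
  shows "finite A" "(- 1 :: 'a) ^ card A = (- 1) ^ r" "inj_on d A"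
    "\<And>\<alpha> \<beta>. \<alpha> \<in> A \<Longrightarrow> \<beta> \<in> A \<Longrightarrow> d \<alpha> + d \<beta> \<noteq> 0" "\<And>\<alpha>. \<alpha> \<in> A \<Longrightarrow> 2 * d \<alpha> \<noteq> (- 1) ^ r"
proof -
  have mp: "is_multipartition r (t ! (k - 1))" using T_multipartition[OF t, of "k - 1"] k by simp
  have bd: "bounded_mpart (k - 1) (t ! (k - 1))" using T_bounded[OF t, of "k - 1"] k by simp
  show "finite A" unfolding A_def by (rule finite_edge_nodes[OF mp bd])
  have "even (card A) \<longleftrightarrow> even r" unfolding A_def by (rule card_edge_nodes[OF mp bd])
  thus "(- 1 :: 'a) ^ card A = (- 1) ^ r" by (cases "even r") auto
  have ex: "\<exists>\<epsilon> \<nu>. move r (t ! (k - 1)) \<epsilon> \<alpha> \<nu> \<and> d \<alpha> = label_content u \<epsilon> (node_label \<alpha>)" if "\<alpha> \<in> A" for \<alpha>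
    using that node_content_move edge_nodes_move[OF mp] unfolding A_def d_def by blast
  show "inj_on d A"
  proof (rule inj_onI)
    fix \<alpha> \<beta> assume ab: "\<alpha> \<in> A" "\<beta> \<in> A" "d \<alpha> = d \<beta>"
    obtain \<epsilon> \<nu> where 1: "move r (t ! (k - 1)) \<epsilon> \<alpha> \<nu>" "d \<alpha> = label_content u \<epsilon> (node_label \<alpha>)" using ex ab by blast
    obtain \<eta> \<rho> where 2: "move r (t ! (k - 1)) \<eta> \<beta> \<rho>" "d \<beta> = label_content u \<eta> (node_label \<beta>)" using ex ab by blast
    have "node_label \<alpha> = node_label \<beta>"
      using 1(2) 2(2) ab(3)
      by (intro label_content_inj(2)[OF char gen label_bounds[OF t k 1(1)] label_bounds[OF t k 2(1)] move_sign[OF 1(1)] move_sign[OF 2(1)]]) simp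
    thus "\<alpha> = \<beta>" by (rule move_unique(2)[OF 1(1) 2(1)])
  qed
  show "d \<alpha> + d \<beta> \<noteq> 0" if ab: "\<alpha> \<in> A" "\<beta> \<in> A" for \<alpha> \<beta>
  proof -
    obtain \<epsilon> \<nu> where 1: "move r (t ! (k - 1)) \<epsilon> \<alpha> \<nu>" "d \<alpha> = label_content u \<epsilon> (node_label \<alpha>)" using ex ab by blast
    obtain \<eta> \<rho> where 2: "move r (t ! (k - 1)) \<eta> \<beta> \<rho>" "d \<beta> = label_content u \<eta> (node_label \<beta>)" using ex ab by blast
    show ?thesis unfolding 1(2) 2(2)
      by (rule label_content_sum_nonzero[OF char gen label_bounds[OF t k 1(1)] label_bounds[OF t k 2(1)]
            move_sign[OF 1(1)] move_sign[OF 2(1)] move_unique(1)[OF 1(1) 2(1)]])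
  qed
  show "2 * d \<alpha> \<noteq> (- 1) ^ r" if a: "\<alpha> \<in> A" for \<alpha>
  proof -
    obtain \<epsilon> \<nu> where 1: "move r (t ! (k - 1)) \<epsilon> \<alpha> \<nu>" "d \<alpha> = label_content u \<epsilon> (node_label \<alpha>)" using ex a by blast
    show ?thesis unfolding 1(2) by (rule two_label_content_ne[OF gen label_bounds[OF t k 1(1)] move_sign[OF 1(1)]])
  qed
qed

lemma step_edge_node:
  assumes t: "t \<in> T" and k: "1 \<le> k" "k \<le> n"
  shows "t ! k \<ominus>\<^sub>b t ! (k - 1) \<in> edge_nodes r (t ! (k - 1))"
    "node_content r u (t ! (k - 1)) (t ! k \<ominus>\<^sub>b t ! (k - 1)) = c t k"
proof -
  note m = T_move[OF t k]
  show "t ! k \<ominus>\<^sub>b t ! (k - 1) \<in> edge_nodes r (t ! (k - 1))"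
    using m edge_nodes_move move_multipartition(1)[OF m] by blast
  show "node_content r u (t ! (k - 1)) (t ! k \<ominus>\<^sub>b t ! (k - 1)) = c t k"
    unfolding node_content_move[OF m] tab_content_move[OF m] ..
qed

lemma e_diag_eq:
  assumes t: "t \<in> T" and k: "1 \<le> k" "k \<le> n"
  shows "e_diag r u k t = res_coeff r (edge_nodes r (t ! (k - 1))) (node_content r u (t ! (k - 1)))
    (t ! k \<ominus>\<^sub>b t ! (k - 1))"
proof -
  note f = edge_nodes_facts[OF t k] and s = step_edge_node[OF t k]
  show ?thesis
    unfolding e_diag_def W_fun_def edge_nodes_def[symmetric] s(2)[symmetric]
    using f(4)[OF s(1) s(1)] by (intro residue_W[OF two f(1) s(1) f(3)]) auto
qed

lemma e_diag_nonzero: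
  assumes t: "t \<in> T" and k: "1 \<le> k" "k \<le> n"
  shows "e_diag r u k t \<noteq> 0"
proof -
  note f = edge_nodes_facts[OF assms] and s = step_edge_node[OF assms]
  show ?thesis
    unfolding e_diag_eq[OF assms]
    by (rule res_coeff_nonzero[OF f(1) s(1) f(3) f(4)[OF s(1)] f(5)[OF s(1)]])
qed

text \<open>If t_{k-1} = t_{k+1}, a tableau in the class of t at k goes to an arbitrary neighbour of
  this shape and back. The class is thus indexed by the addable and removable nodes.\<close>

lemma sum_sim_edge_nodes:
  assumes t: "t \<in> T" and k: "1 \<le> k" "k < n" and P: "P k t"
  shows "(\<Sum>v | v \<in> T \<and> tab_sim k v t. g (v ! k \<ominus>\<^sub>b t ! (k - 1))) = (\<Sum>\<alpha>\<in>edge_nodes r (t ! (k - 1)). g \<alpha>)"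
proof (rule sum.reindex_bij_betw)
  have k': "k \<le> n" "k - 1 \<noteq> k" "k - 1 \<le> n" using k by auto
  have mp: "is_multipartition r (t ! (k - 1))" using T_multipartition[OF t k'(3)] .
  have v: "v ! (k - 1) = t ! (k - 1)" if "tab_sim k v t" for v using sim_nth[OF t that k'(2,3)] .
  show "bij_betw (\<lambda>v. v ! k \<ominus>\<^sub>b t ! (k - 1)) {v \<in> T. tab_sim k v t} (edge_nodes r (t ! (k - 1)))"
    unfolding bij_betw_def
  proof (intro conjI equalityI subsetI)
    show "inj_on (\<lambda>v. v ! k \<ominus>\<^sub>b t ! (k - 1)) {v \<in> T. tab_sim k v t}"
    proof (rule inj_onI)
      fix v w assume vw: "v \<in> {v \<in> T. tab_sim k v t}" "w \<in> {v \<in> T. tab_sim k v t}"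
        "v ! k \<ominus>\<^sub>b t ! (k - 1) = w ! k \<ominus>\<^sub>b t ! (k - 1)"
      have mv: "move r (t ! (k - 1)) (sg x k) (x ! k \<ominus>\<^sub>b t ! (k - 1)) (x ! k)" if "x \<in> {v \<in> T. tab_sim k v t}" for x
        using T_move[of x k] k(1) k'(1) v[of x] that by simp
      have "v ! k = w ! k"
        by (rule move_unique(3)[OF mv[OF vw(1)] mv[OF vw(2)]]) (simp only: vw(3))
      moreover have "tab_sim k v w" using vw sim_trans[of k v t w] sim_sym by blast
      ultimately show "v = w" using sim_eqI[of w v k] vw by blast
    qed
  next
    fix \<alpha> assume "\<alpha> \<in> (\<lambda>v. v ! k \<ominus>\<^sub>b t ! (k - 1)) ` {v \<in> T. tab_sim k v t}"
    then obtain w where "\<alpha> = w ! k \<ominus>\<^sub>b t ! (k - 1)" "w \<in> T" "tab_sim k w t" by blast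
    thus "\<alpha> \<in> edge_nodes r (t ! (k - 1))" using step_edge_node(1)[of w k] k k' v[of w] by simp
  next
    fix \<alpha> assume "\<alpha> \<in> edge_nodes r (t ! (k - 1))"
    then obtain \<epsilon> \<nu> where m: "move r (t ! (k - 1)) \<epsilon> \<alpha> \<nu>" using edge_nodes_move[OF mp] by blast
    have "move r \<nu> (- \<epsilon>) \<alpha> (t ! (k + 1))" using move_sym[OF m] P by simp
    hence "t[k := \<nu>] \<in> T" by (rule update_in_T[OF t k m])
    moreover have "\<alpha> = t[k := \<nu>] ! k \<ominus>\<^sub>b t ! (k - 1)"
      using update_nth[OF t k'(1), of \<nu> k] box_diff_move(1)[OF m] by simp
    ultimately show "\<alpha> \<in> (\<lambda>v. v ! k \<ominus>\<^sub>b t ! (k - 1)) ` {v \<in> T. tab_sim k v t}"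
      using update_sim by blast
  qed
qed

lemma sum_e_diag:
  assumes t: "t \<in> T" and k: "1 \<le> k" "k < n" and P: "P k t"
  shows "(\<Sum>v | v \<in> T \<and> tab_sim k v t. e_diag r u k v * h (c v k)) =
    (\<Sum>\<alpha>\<in>edge_nodes r (t ! (k - 1)). res_coeff r (edge_nodes r (t ! (k - 1))) (node_content r u (t ! (k - 1))) \<alpha> *
      h (node_content r u (t ! (k - 1)) \<alpha>))"
  unfolding sum_sim_edge_nodes[OF assms, symmetric]
proof (rule sum.cong[OF refl])
  fix v assume "v \<in> {v. v \<in> T \<and> tab_sim k v t}"
  hence v: "v \<in> T" "tab_sim k v t" by auto
  have k': "1 \<le> k" "k \<le> n" "k - 1 \<noteq> k" "k - 1 \<le> n" using k by auto
  have v1: "v ! (k - 1) = t ! (k - 1)" using sim_nth[OF t v(2) k'(3,4)] .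
  show "e_diag r u k v * h (c v k) = res_coeff r (edge_nodes r (t ! (k - 1))) (node_content r u (t ! (k - 1)))
      (v ! k \<ominus>\<^sub>b t ! (k - 1)) * h (node_content r u (t ! (k - 1)) (v ! k \<ominus>\<^sub>b t ! (k - 1)))"
    using e_diag_eq[OF v(1) k'(1,2)] step_edge_node(2)[OF v(1) k'(1,2)] unfolding v1 by simp
qed

lemma sum_e_diag_divide:
  assumes t: "t \<in> T" and k: "1 \<le> k" "k < n" and P: "P k t"
  shows "(\<Sum>v | v \<in> T \<and> tab_sim k v t. e_diag r u k v / (c v k + c t k)) = 1 + 1 / (2 * c t k)"
proof -
  have k': "1 \<le> k" "k \<le> n" using k by auto
  note f = edge_nodes_facts[OF t k'] and s = step_edge_node[OF t k']
  have "(\<Sum>v | v \<in> T \<and> tab_sim k v t. e_diag r u k v / (c v k + c t k)) =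
      (\<Sum>\<alpha>\<in>edge_nodes r (t ! (k - 1)). res_coeff r (edge_nodes r (t ! (k - 1))) (node_content r u (t ! (k - 1))) \<alpha> /
        (node_content r u (t ! (k - 1)) \<alpha> + c t k))"
    using sum_e_diag[OF assms, of "\<lambda>x. 1 / (x + c t k)"] by simp
  also have "\<dots> = 1 + 1 / (2 * c t k)"
    unfolding s(2)[symmetric] by (rule sum_res_coeff[OF two f(1) s(1) f(3,4,2)])
  finally show ?thesis .
qed

lemma generic_parameters:
  shows "inj_on u {1..r}" "\<And>i. i \<in> {1..r} \<Longrightarrow> u i \<noteq> 0"
proof -
  have g: "u i \<noteq> u j" if "i \<in> {1..r}" "j \<in> {1..r}" "i \<noteq> j" for i j
  proof
    assume "u i = u j"
    hence "u i - u j = of_int 0" by simp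
    hence "2 * int n \<le> \<bar>0\<bar>" using gen that unfolding generic_def by blast
    thus False using n_pos by simp
  qed
  thus "inj_on u {1..r}" by (meson inj_onI)
  show "u i \<noteq> 0" if "i \<in> {1..r}" for i
  proof
    assume "u i = 0"
    hence "2 * u i = of_int 0" by simp
    hence "2 * int n \<le> \<bar>0\<bar>" using gen that unfolding generic_def by blast
    thus False using n_pos by simp
  qed
qed

lemma edge_nodes_empty: "edge_nodes r (\<lambda>_ _. 0) = (\<lambda>s. (1, 1, s)) ` {1..r}"
proof (intro equalityI subsetI)
  let ?z = "(\<lambda>_ _. 0) :: mpart"
  have mp: "is_multipartition r ?z" by (simp add: is_multipartition_def is_partition_def)
  have bead: "bead ?z s d \<longleftrightarrow> d < 0" for s d
    unfolding bead_def by (auto intro!: exI[of _ "nat (- d)"])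
  fix \<alpha> assume "\<alpha> \<in> edge_nodes r ?z"
  then obtain \<epsilon> \<nu> where m: "move r ?z \<epsilon> \<alpha> \<nu>" using edge_nodes_move[OF mp] by blast
  obtain i j s where [simp]: "\<alpha> = (i, j, s)" by (cases \<alpha>)
  note p = move_position[OF m[simplified]]
  have "\<epsilon> = 1 \<and> j = 1" using moveD(3,5)[OF m[simplified]] p by auto
  moreover have "weight ?z (s, int j - int i) = \<epsilon>" using move_weight(1)[OF m] by (simp add: node_label_def)
  ultimately have "i = 1" using p by (auto simp: weight_def bead split: if_splits)
  thus "\<alpha> \<in> (\<lambda>s. (1, 1, s)) ` {1..r}" using p \<open>\<epsilon> = 1 \<and> j = 1\<close> by auto
next
  let ?z = "(\<lambda>_ _. 0) :: mpart"
  have mp: "is_multipartition r ?z" by (simp add: is_multipartition_def is_partition_def)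
  fix \<alpha> :: node assume "\<alpha> \<in> (\<lambda>s. (1, 1, s)) ` {1..r}"
  then obtain s where s: "s \<in> {1..r}" "\<alpha> = (1, 1, s)" by blast
  have bead: "bead ?z s d \<longleftrightarrow> d < 0" for d
    unfolding bead_def by (auto intro!: exI[of _ "nat (- d)"])
  have "weight ?z (s, 0) = 1" by (simp add: weight_def bead)
  then obtain \<beta> \<nu> where m: "move r ?z 1 \<beta> \<nu>" "node_label \<beta> = (s, 0)"
    using move_exists[OF mp s(1)] by (metis one_neq_zero)
  obtain i j where [simp]: "\<beta> = (i, j, s)" "i = j" using m(2) by (cases \<beta>) (auto simp: node_label_def)
  have "j = 1" using moveD(5)[OF m(1)[simplified]] by simp
  hence "\<beta> = \<alpha>" using s by simp
  thus "\<alpha> \<in> edge_nodes r ?z" using m(1) edge_nodes_move[OF mp] by blast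
qed

text \<open>For k = 1 the shape t_0 is empty. Its nodes are (1, 1, s) with contents u_s, and the sum
  is the one that admissibility evaluates.\<close>

lemma sum_e_diag_power:
  assumes t: "t \<in> T" and n: "1 < n" and P: "P 1 t"
  shows "(\<Sum>v | v \<in> T \<and> tab_sim 1 v t. e_diag r u 1 v * c v 1 ^ a) = \<omega> a"
proof -
  let ?z = "(\<lambda>_ _. 0) :: mpart"
  let ?A = "edge_nodes r ?z" and ?d = "node_content r u ?z"
  have t0: "t ! (1 - 1) = ?z" using T_0[OF t] by simp
  have mp: "is_multipartition r ?z" by (simp add: is_multipartition_def is_partition_def)
  have d: "?d (1, 1, s) = u s" if s: "s \<in> {1..r}" for s
  proof -
    have "(1, 1, s) \<in> ?A" using s by (simp add: edge_nodes_empty)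
    then obtain \<epsilon> \<nu> where m: "move r ?z \<epsilon> (1, 1, s) \<nu>" using edge_nodes_move[OF mp] by blast
    have "\<epsilon> = 1" using moveD(3,5)[OF m] by auto
    thus ?thesis using node_content_move[OF m, of u] by (simp add: label_content_def node_label_def)
  qed
  have inj: "inj_on (\<lambda>s. (1 :: nat, 1 :: nat, s)) X" for X by (simp add: inj_on_def)
  have SR: "(\<Sum>\<alpha>\<in>?A. F \<alpha>) = (\<Sum>s\<in>{1..r}. F (1, 1, s))" for F :: "node \<Rightarrow> 'a"
    unfolding edge_nodes_empty sum.reindex[OF inj] o_def ..
  have rc: "res_coeff r ?A ?d (1, 1, s) = res_coeff r {1..r} u s" if s: "s \<in> {1..r}" for s
  proof -
    have "?A - {(1, 1, s)} = (\<lambda>s. (1, 1, s)) ` ({1..r} - {s})" by (auto simp: edge_nodes_empty)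
    note A = this
    have "(\<Prod>\<alpha>\<in>?A - {(1, 1, s)}. (?d (1, 1, s) + ?d \<alpha>) / (?d (1, 1, s) - ?d \<alpha>)) =
        (\<Prod>j\<in>{1..r} - {s}. (u s + u j) / (u s - u j))"
      unfolding A prod.reindex[OF inj] o_def using d s by (intro prod.cong) auto
    thus ?thesis unfolding res_coeff_def d[OF s] by simp
  qed
  have "(\<Sum>v | v \<in> T \<and> tab_sim 1 v t. e_diag r u 1 v * c v 1 ^ a) = (\<Sum>\<alpha>\<in>?A. res_coeff r ?A ?d \<alpha> * ?d \<alpha> ^ a)"
    using sum_e_diag[OF t _ n P, of "\<lambda>x. x ^ a"] unfolding t0 by simp
  also have "\<dots> = (\<Sum>s\<in>{1..r}. res_coeff r ?A ?d (1, 1, s) * ?d (1, 1, s) ^ a)"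
    by (rule SR)
  also have "\<dots> = (\<Sum>s\<in>{1..r}. res_coeff r {1..r} u s * u s ^ a)"
    using rc d by (intro sum.cong) auto
  also have "\<dots> = \<omega> a" by (rule admissible_eq_sum_res_coeff[OF two adm generic_parameters])
  finally show ?thesis .
qed

section \<open>The operators and their relations with the X_j\<close>

text \<open>\<open>e_coeff\<close> extended by zero, with the diagonal entry written as a product of
  roots as well. On a class at k with t_{k-1} = t_{k+1} the matrix is then a column times its
  transpose.\<close>

definition cE :: "nat \<Rightarrow> tableau \<Rightarrow> tableau \<Rightarrow> 'a" where
  "cE k t v = (if P k t \<and> tab_sim k v t then rt t k * rt v k else 0)"

definition cS :: "nat \<Rightarrow> tableau \<Rightarrow> tableau \<Rightarrow> 'a" where
  "cS k t v = (if P k t then if tab_sim k v t then (cE k t v - (if t = v then 1 else 0)) / (c t k + c v k) else 0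
     else if v = t then a_coeff u k t else if swap_defined k t \<and> v = swap_tab r k t then b t k else 0)"

definition opE :: "nat \<Rightarrow> 'a endo" where "opE k = mat T (cE k)"
definition opS :: "nat \<Rightarrow> 'a endo" where "opS k = mat T (cS k)"
definition opX :: "nat \<Rightarrow> 'a endo" where "opX j = mat T (\<lambda>t v. if t = v then c t j else 0)"

lemma op_corner: "opE k \<in> corner" "opS k \<in> corner" "opX j \<in> corner"
  by (simp_all add: opE_def opS_def opX_def mat_corner)

lemma entry_opE: "t \<in> T \<Longrightarrow> v \<in> T \<Longrightarrow> entry (opE k) t v = cE k t v"
  and entry_opS: "t \<in> T \<Longrightarrow> v \<in> T \<Longrightarrow> entry (opS k) t v = cS k t v"
  and entry_opX: "t \<in> T \<Longrightarrow> v \<in> T \<Longrightarrow> entry (opX j) t v = (if t = v then c t j else 0)"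
  by (simp_all add: opE_def opS_def opX_def entry_mat finite_T)

lemma cE_eq_e_coeff:
  assumes "t \<in> T" "v \<in> T" "1 \<le> k" "k < n" "P k t" "tab_sim k v t"
  shows "cE k t v = e_coeff r u rt k t v"
  using assms root_rt by (auto simp: cE_def e_coeff_def power2_eq_square)

lemma cE_nonzero: "cE k t v \<noteq> 0 \<Longrightarrow> P k t \<and> tab_sim k v t"
  by (auto simp: cE_def split: if_splits)

lemma cS_nonzero:
  assumes "t \<in> T" "1 \<le> k" "k < n" "cS k t v \<noteq> 0" shows "tab_sim k v t"
  using assms swap_sim[OF assms(1-3)] by (auto simp: cS_def sim_refl split: if_splits)

lemma cE_sym: "t \<in> T \<Longrightarrow> v \<in> T \<Longrightarrow> 1 \<le> k \<Longrightarrow> k < n \<Longrightarrow> cE k t v = cE k v t"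
  using P_sim[of t k v] P_sim[of v k t] sim_sym[of k t v] by (auto simp: cE_def)

text \<open>For swap entries the symmetry is root condition (a); for the others it is inherited from
  \<open>cE\<close> or immediate. It yields the second skein relation from the first and allows
  later relations to be transposed.\<close>

lemma cS_sym:
  assumes t: "t \<in> T" "v \<in> T" and k: "1 \<le> k" "k < n"
  shows "cS k t v = cS k v t"
proof -
  have kk: "k \<in> {1..<n}" using k by simp
  have sw: "cS k w x = cS k x w" if "w \<in> T" "x \<in> T" "\<not> P k w" "swap_defined k w" "x = swap_tab r k w" for w x
  proof -
    note s = swap_facts[OF that(1) k that(4), folded that(5)]
    have "b x k = b w k" using root_swap that kk by blast
    thus ?thesis using s that by (auto simp: cS_def)
  qed
  show ?thesis
  proof (cases "tab_sim k v t")
    case False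
    hence "cS k t v = 0" "cS k v t = 0" using cS_nonzero[OF t(1) k] cS_nonzero[OF t(2) k] sim_sym by blast+
    thus ?thesis by simp
  next
    case sim: True
    have PP: "P k v \<longleftrightarrow> P k t" by (rule P_sim[OF t(1) sim k])
    show ?thesis
    proof (cases "P k t")
      case True
      thus ?thesis using PP sim sim_sym[of k t v] cE_sym[OF t k] by (simp add: cS_def add.commute)
    next
      case False
      consider "v = t" | "v \<noteq> t" "swap_defined k t" "v = swap_tab r k t" | "v \<noteq> t" "swap_defined k v" "t = swap_tab r k v"
        | "v \<noteq> t" "\<not> (swap_defined k t \<and> v = swap_tab r k t)" "\<not> (swap_defined k v \<and> t = swap_tab r k v)" by blast
      thus ?thesis
      proof cases
        case 2
        thus ?thesis using sw[OF t(1,2) False] by simp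
      next
        case 3
        thus ?thesis using sw[OF t(2,1)] False PP by simp
      next
        case 4
        have "\<not> P k v" using False PP by simp
        have "cS k t v = 0" using False 4(1,2) by (simp only: cS_def if_False)
        moreover have "cS k v t = 0" using \<open>\<not> P k v\<close> 4(1)[symmetric] 4(3) by (simp only: cS_def if_False)
        ultimately show ?thesis by simp
      qed simp
    qed
  qed
qed

lemma entry_times_opX: "t \<in> T \<Longrightarrow> M \<in> corner \<Longrightarrow> entry (M * opX j) t v = c t j * entry M t v"
  by (simp add: entry_times entry_opX finite_T if_distrib[of "\<lambda>x. x * _"] cong: if_cong)

lemma entry_opX_times: "v \<in> T \<Longrightarrow> entry (opX j * M) t v = c v j * entry M t v"
  by (simp add: entry_times op_corner entry_opX finite_T if_distrib[of "\<lambda>x. _ * x"] cong: if_cong)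

lemma skein:
  assumes k: "1 \<le> k" "k < n"
  shows "opS k * opX k - opX (k + 1) * opS k = opE k - proj"
    and "opX k * opS k - opS k * opX (k + 1) = opE k - proj"
proof -
  have key: "c t k * cS k t v - c v (k + 1) * cS k t v = cE k t v - (if t = v then 1 else 0)"
    if t: "t \<in> T" "v \<in> T" for t v
  proof (cases "P k t")
    case True
    show ?thesis
    proof (cases "tab_sim k v t")
      case sim: True
      \<comment> \<open>The step back has the opposite content, so the left side is s_tv(k) times
        its own denominator.\<close>
      have "c v (k + 1) = - c v k" using c_next[OF t(2) k] P_sim[OF t(1) sim k] True by simp
      moreover have "t ! (k - 1) = v ! (k - 1)" using sim_nth[OF t(1) sim, of "k - 1"] k by simp
      hence ne: "c t k + c v k \<noteq> 0" using c_sum_ne[OF t k(1)] k by simp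
      moreover have "cS k t v = (cE k t v - (if t = v then 1 else 0)) / (c t k + c v k)"
        using True sim by (simp add: cS_def)
      hence "(c t k + c v k) * cS k t v = cE k t v - (if t = v then 1 else 0)" using ne by simp
      ultimately show ?thesis by (simp add: distrib_right)
    next
      case False
      thus ?thesis using True by (auto simp: cS_def cE_def sim_refl)
    qed
  next
    case False
    note ne = c_ne[OF t(1) k False]
    have "v \<noteq> t \<Longrightarrow> swap_defined k t \<Longrightarrow> v = swap_tab r k t \<Longrightarrow> c v (k + 1) = c t k"
      using swap_c(2)[OF t(1) k] by blast
    \<comment> \<open>This is the diagonal entry. At the swapped tableau the two terms cancel,
      because the contents are exchanged.\<close>
    moreover have "(c t k - c t (k + 1)) * a_coeff u k t = - 1"
      using ne by (simp add: a_coeff_def field_simps)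
    ultimately show ?thesis using False by (auto simp: cS_def cE_def simp flip: left_diff_distrib)
  qed
  have key': "c v k * cS k t v - c t (k + 1) * cS k t v = cE k t v - (if t = v then 1 else 0)"
    if t: "t \<in> T" "v \<in> T" for t v
    using key[OF t(2,1)] unfolding cS_sym[OF t(2,1) k] cE_sym[OF t(2,1) k] by auto
  show "opS k * opX k - opX (k + 1) * opS k = opE k - proj"
    using key by (intro corner_eqI corner_intros op_corner)
      (simp_all add: entry_minus entry_times_opX entry_opX_times op_corner entry_opS entry_opE entry_proj)
  show "opX k * opS k - opS k * opX (k + 1) = opE k - proj"
    using key' by (intro corner_eqI corner_intros op_corner)
      (simp_all add: entry_minus entry_times_opX entry_opX_times op_corner entry_opS entry_opE entry_proj)
qed

lemma opE_opX_anti: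
  assumes k: "1 \<le> k" "k < n"
  shows "opE k * (opX k + opX (k + 1)) = 0" "(opX k + opX (k + 1)) * opE k = 0"
proof -
  have key: "c t k * cE k t v + c t (k + 1) * cE k t v = 0" if "t \<in> T" for t v
    using c_next[OF that k] by (cases "P k t") (auto simp: cE_def)
  show "opE k * (opX k + opX (k + 1)) = 0"
    unfolding distrib_left using key by (intro corner_eqI corner_intros op_corner)
      (simp_all add: entry_plus entry_times_opX op_corner entry_opE entry_0)
  have key': "c v k * cE k t v + c v (k + 1) * cE k t v = 0" if t: "t \<in> T" "v \<in> T" for t v
    using key[OF t(2), of t] unfolding cE_sym[OF t(2,1) k] .
  show "(opX k + opX (k + 1)) * opE k = 0"
    unfolding distrib_right using key' by (intro corner_eqI corner_intros op_corner)
      (simp_all add: entry_plus entry_opX_times op_corner entry_opE entry_0)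
qed

lemma opX_commute: "opX i * opX j = opX j * opX i"
  by (intro corner_eqI corner_intros op_corner) (simp_all add: entry_times_opX op_corner entry_opX)

lemma opX_far:
  assumes k: "1 \<le> k" "k < n" and j: "1 \<le> j" "j \<le> n" "j \<noteq> k" "j \<noteq> k + 1"
  shows "opS k * opX j = opX j * opS k" "opE k * opX j = opX j * opE k"
proof -
  have 1: "c t j * cS k t v = c v j * cS k t v" if "t \<in> T" for t v
    using cS_nonzero[OF that k, of v] c_sim[OF that, of k v j] j by (cases "cS k t v = 0") auto
  show "opS k * opX j = opX j * opS k"
    using 1 by (intro corner_eqI corner_intros op_corner)
      (simp_all add: entry_times_opX entry_opX_times op_corner entry_opS)
  have 2: "c t j * cE k t v = c v j * cE k t v" if "t \<in> T" for t v
    using cE_nonzero[of k t v] c_sim[OF that, of k v j] j by (cases "cE k t v = 0") auto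
  show "opE k * opX j = opX j * opE k"
    using 2 by (intro corner_eqI corner_intros op_corner)
      (simp_all add: entry_times_opX entry_opX_times op_corner entry_opE)
qed

section \<open>Commutation of distant operators\<close>

text \<open>The coefficients only involve the entries \<open>l - 1\<close>, \<open>l\<close>, \<open>l + 1\<close> of a tableau.\<close>

definition local_at :: "nat \<Rightarrow> (tableau \<Rightarrow> tableau \<Rightarrow> 'a) \<Rightarrow> bool" where
  "local_at l M \<longleftrightarrow> (\<forall>t\<in>T. \<forall>v\<in>T. M t v \<noteq> 0 \<longrightarrow> tab_sim l v t) \<and>
     (\<forall>k\<in>{1..<n}. k + 1 < l \<or> l + 1 < k \<longrightarrow> (\<forall>t\<in>T. \<forall>t'\<in>T. \<forall>v\<in>T. \<forall>v'\<in>T.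
        tab_sim k t' t \<longrightarrow> tab_sim k v' v \<longrightarrow> tab_sim l v t \<longrightarrow> tab_sim l v' t' \<longrightarrow> M t v = M t' v'))"

text \<open>Each product leads from t to w through a single intermediate tableau, in which just one
  of the entries k and l has been changed. Locality carries each coefficient across the other
  change, so both products have the same two factors.\<close>

lemma local_commute:
  assumes M: "local_at k M" and N: "local_at l N" and kl: "k \<in> {1..<n}" "l \<in> {1..<n}" "k + 1 < l \<or> l + 1 < k"
  shows "mat T M * mat T N = mat T N * mat T M"
proof (rule corner_eqI)
  fix t w assume t: "t \<in> T" "w \<in> T"
  define v0 where "v0 = t[l := w ! l]"
  define v1 where "v1 = t[k := w ! k]"
  have lk: "l \<le> n" "k \<le> n" using kl by auto
  have M0: "tab_sim k v t" if "M t v \<noteq> 0" "t \<in> T" "v \<in> T" for t v using M that unfolding local_at_def by blast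
  have N0: "tab_sim l v t" if "N t v \<noteq> 0" "t \<in> T" "v \<in> T" for t v using N that unfolding local_at_def by blast
  have nth0: "v0 ! j = (if j = l then w ! l else t ! j)" and nth1: "v1 ! j = (if j = k then w ! k else t ! j)" for j
    unfolding v0_def v1_def by (rule update_nth[OF t(1)], use lk in simp)+
  have only0: "v = v0 \<and> (\<forall>j\<le>n. j \<noteq> k \<and> j \<noteq> l \<longrightarrow> w ! j = t ! j)"
    if v: "v \<in> T" "tab_sim l v t" "tab_sim k w v" for v
  proof -
    have a: "v ! j = t ! j" if "j \<le> n" "j \<noteq> l" for j using v that t by (simp add: sim_iff)
    have b: "w ! j = v ! j" if "j \<le> n" "j \<noteq> k" for j using v that t by (simp add: sim_iff)
    have "v ! l = w ! l" using b[of l] kl lk by auto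
    hence "v = v0" using a length_T[OF v(1)] length_T[OF t(1)] nth0
      by (intro nth_equalityI) (auto simp: v0_def less_Suc_eq_le)
    thus ?thesis using a b by simp
  qed
  have only1: "v = v1 \<and> (\<forall>j\<le>n. j \<noteq> k \<and> j \<noteq> l \<longrightarrow> w ! j = t ! j)"
    if v: "v \<in> T" "tab_sim k v t" "tab_sim l w v" for v
  proof -
    have a: "v ! j = t ! j" if "j \<le> n" "j \<noteq> k" for j using v that t by (simp add: sim_iff)
    have b: "w ! j = v ! j" if "j \<le> n" "j \<noteq> l" for j using v that t by (simp add: sim_iff)
    have "v ! k = w ! k" using b[of k] kl lk by auto
    hence "v = v1" using a length_T[OF v(1)] length_T[OF t(1)] nth1
      by (intro nth_equalityI) (auto simp: v1_def less_Suc_eq_le)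
    thus ?thesis using a b by simp
  qed
  have "(\<Sum>v\<in>T. N t v * M v w) = (\<Sum>v\<in>T. M t v * N v w)"
  proof (cases "\<forall>j\<le>n. j \<noteq> k \<and> j \<noteq> l \<longrightarrow> w ! j = t ! j")
    case False
    have "N t v * M v w = 0" if "v \<in> T" for v
      using only0[of v] N0[of t v] M0[of v w] that t False by (cases "N t v = 0"; cases "M v w = 0") auto
    hence "(\<Sum>v\<in>T. N t v * M v w) = 0" by (intro sum.neutral ballI)
    moreover have "M t v * N v w = 0" if "v \<in> T" for v
      using only1[of v] M0[of t v] N0[of v w] that t False by (cases "M t v = 0"; cases "N v w = 0") auto
    hence "(\<Sum>v\<in>T. M t v * N v w) = 0" by (intro sum.neutral ballI)
    ultimately show ?thesis by simp
  next
    case True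
    have eq: "w ! (l - 1) = t ! (l - 1)" "w ! (l + 1) = t ! (l + 1)"
      "w ! (k - 1) = t ! (k - 1)" "w ! (k + 1) = t ! (k + 1)"
      by (rule True[rule_format], use kl in auto)+
    have v0: "v0 \<in> T" unfolding v0_def using kl by (intro splice_in_T t eq) auto
    have v1: "v1 \<in> T" unfolding v1_def using kl by (intro splice_in_T t eq) auto
    have "(\<Sum>v\<in>T. N t v * M v w) = N t v0 * M v0 w"
    proof (rule sum_single[OF finite_T v0])
      fix v assume "v \<in> T" "v \<noteq> v0"
      thus "N t v * M v w = 0"
        using only0[of v] N0[of t v] M0[of v w] t by (cases "N t v = 0"; cases "M v w = 0") auto
    qed
    also have "N t v0 = N v1 w"
    proof -
      have "tab_sim k v1 t" "tab_sim k w v0" "tab_sim l v0 t" "tab_sim l w v1"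
        using t v0 v1 True by (auto simp: sim_iff nth0 nth1)
      thus ?thesis using N t v0 v1 kl unfolding local_at_def by blast
    qed
    also have "M v0 w = M t v1"
    proof -
      have "tab_sim l t v0" "tab_sim l v1 w" "tab_sim k w v0" "tab_sim k v1 t"
        using t v0 v1 True by (auto simp: sim_iff nth0 nth1)
      thus ?thesis using M t v0 v1 kl unfolding local_at_def by blast
    qed
    also have "N v1 w * M t v1 = (\<Sum>v\<in>T. M t v * N v w)"
    proof (subst sum_single[OF finite_T v1])
      fix v assume "v \<in> T" "v \<noteq> v1"
      thus "M t v * N v w = 0"
        using only1[of v] M0[of t v] N0[of v w] t by (cases "M t v = 0"; cases "N v w = 0") auto
    qed (rule mult.commute)
    finally show ?thesis .
  qed
  thus "entry (mat T M * mat T N) t w = entry (mat T N * mat T M) t w"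
    using t by (simp add: entry_times mat_corner entry_mat finite_T)
qed (intro corner_intros)+

lemma far_nth:
  assumes "t \<in> T" "tab_sim k t' t" "k + 1 < l \<or> l + 1 < k" "l < n"
  shows "t' ! (l - 1) = t ! (l - 1)" "t' ! l = t ! l" "t' ! (l + 1) = t ! (l + 1)"
  using assms by (auto intro!: sim_nth[OF assms(1,2)])

text \<open>The residue e_tt(l) depends on the entries l - 1 and l alone, hence is unchanged;
  condition (e) transfers this to the chosen roots.\<close>

lemma local_cE: "l \<in> {1..<n} \<Longrightarrow> local_at l (cE l)"
  unfolding local_at_def
proof (intro conjI ballI impI)
  fix k t t' v v'
  assume l: "l \<in> {1..<n}" and k: "k \<in> {1..<n}" "k + 1 < l \<or> l + 1 < k"
    and t: "t \<in> T" "t' \<in> T" "v \<in> T" "v' \<in> T" "tab_sim k t' t" "tab_sim k v' v" "tab_sim l v t" "tab_sim l v' t'"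
  have rt: "rt x l = rt y l" if "x \<in> T" "y \<in> T" "tab_sim k y x" "P l x" for x y
  proof -
    note f = far_nth[OF that(1,3) k(2)]
    have "e_diag r u l x = e_diag r u l y"
      using f l by (simp add: e_diag_def W_fun_def c_local[of y l x])
    moreover have "P l y" using f l that by simp
    ultimately show ?thesis using root_rt_eq that l by blast
  qed
  have l': "l < n" "1 \<le> l" using l by auto
  note f = far_nth[OF t(1,5) k(2) l'(1)]
  have "P l t' \<longleftrightarrow> P l t" using f by simp
  moreover have "P l v \<longleftrightarrow> P l t" by (rule P_sim[OF t(1,7) l'(2,1)])
  ultimately show "cE l t v = cE l t' v'" using t rt[of t t'] rt[of v v'] by (simp add: cE_def)
qed (use cE_nonzero in blast)

text \<open>For the coefficients b this is condition (b). The other ingredients are determined by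
  the entries l - 1, l, l + 1 or covered by the case of \<open>cE\<close>.\<close>

lemma local_cS: "l \<in> {1..<n} \<Longrightarrow> local_at l (cS l)"
  unfolding local_at_def
proof (intro conjI ballI impI)
  fix k t t' v v'
  assume l: "l \<in> {1..<n}" and k: "k \<in> {1..<n}" "k + 1 < l \<or> l + 1 < k"
    and t: "t \<in> T" "t' \<in> T" "v \<in> T" "v' \<in> T" "tab_sim k t' t" "tab_sim k v' v" "tab_sim l v t" "tab_sim l v' t'"
  have l': "l < n" "1 \<le> l" "l \<le> n" using l by auto
  note f = far_nth[OF t(1,5) k(2) l'(1)] and g = far_nth[OF t(3,6) k(2) l'(1)]
  have P: "P l t' \<longleftrightarrow> P l t" using f by simp
  have E: "cE l t v = cE l t' v'" using local_cE[OF l] t k unfolding local_at_def by blast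
  have cc: "c t' l = c t l" "c t' (l + 1) = c t (l + 1)" "c v' l = c v l"
    using f g by (auto intro: c_local)
  have a: "a_coeff u l t = a_coeff u l t'" by (simp only: a_coeff_def cc)
  have eq: "t = v \<longleftrightarrow> t' = v'"
    using sim_eqI[OF t(1,3,7)] sim_eqI[OF t(2,4,8)] f(2) g(2) by auto
  have sd: "swap_defined l t' \<longleftrightarrow> swap_defined l t" unfolding swap_defined_def f ..
  have bb: "b t l = b t' l" if "\<not> P l t"
    using root_b_far t k l that sim_sym by blast
  have sw: "v = swap_tab r l t \<longleftrightarrow> v' = swap_tab r l t'" if d: "swap_defined l t"
  proof -
    have d': "swap_defined l t'" using sd d by simp
    note s = swap_facts[OF t(1) l'(2,1) d] and s' = swap_facts[OF t(2) l'(2,1) d']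
    have "swap_tab r l t' ! l = swap_tab r l t ! l"
      unfolding swap_tab_def f using length_T[OF t(1)] length_T[OF t(2)] l' by simp
    moreover have "tab_sim l v (swap_tab r l t)" "tab_sim l v' (swap_tab r l t')"
      using t s(2) s'(2) sim_trans sim_sym by blast+
    ultimately show ?thesis using sim_eqI[OF s(1) t(3)] sim_eqI[OF s'(1) t(4)] g(2) by metis
  qed
  show "cS l t v = cS l t' v'"
    unfolding cS_def P E cc a eq sd using bb sw t eq by auto
qed (use cS_nonzero in auto)

lemma far_commute:
  assumes "i \<in> {1..<n}" "j \<in> {1..<n}" "i + 1 < j \<or> j + 1 < i"
  shows "opS i * opS j = opS j * opS i" "opS i * opE j = opE j * opS i" "opE i * opE j = opE j * opE i"
  unfolding opS_def opE_def using assms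
  by (auto intro!: local_commute[of i _ j] local_cE local_cS)


section \<open>Relations between E_k, S_k and their neighbours\<close>

lemma rt_square: "t \<in> T \<Longrightarrow> 1 \<le> k \<Longrightarrow> k < n \<Longrightarrow> P k t \<Longrightarrow> rt t k * rt t k = e_diag r u k t"
  using root_rt by (auto simp: power2_eq_square)

lemma rt_nonzero: "t \<in> T \<Longrightarrow> 1 \<le> k \<Longrightarrow> k < n \<Longrightarrow> P k t \<Longrightarrow> rt t k \<noteq> 0"
  using rt_square[of t k] e_diag_nonzero[of t k] by auto

lemma sum_cE:
  assumes t: "t \<in> T" and P: "P k t"
  shows "(\<Sum>w\<in>T. cE k t w * f w) = rt t k * (\<Sum>w | w \<in> T \<and> tab_sim k w t. rt w k * f w)"
proof -
  have "(\<Sum>w\<in>T. cE k t w * f w) = (\<Sum>w\<in>T. if tab_sim k w t then rt t k * (rt w k * f w) else 0)"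
    using P by (intro sum.cong) (simp_all add: cE_def)
  also have "\<dots> = (\<Sum>w | w \<in> T \<and> tab_sim k w t. rt t k * (rt w k * f w))"
    using finite_T by (simp add: sum.inter_filter)
  finally show ?thesis by (simp add: sum_distrib_left)
qed

text \<open>With the roots of t and v factored out, an entry becomes the sum of e_ww(k) / (c_w(k) +
  c_v(k)) over the class, minus the term 1 / (2c_v(k)) caused by the delta in s_vv(k). By partial
  fractions the sum exceeds 1 by exactly that term.\<close>

lemma opS_opE:
  assumes k: "1 \<le> k" "k < n"
  shows "opS k * opE k = opE k"
proof (rule corner_eqI)
  fix t v assume t: "t \<in> T" "v \<in> T"
  have "entry (opS k * opE k) t v = (\<Sum>w\<in>T. cE k t w * cS k w v)"
    using t by (simp add: entry_times op_corner entry_opE entry_opS)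
  also have "\<dots> = cE k t v"
  proof (cases "P k t \<and> tab_sim k v t")
    case False
    have "cE k t w * cS k w v = 0" if "w \<in> T" for w
      using cE_nonzero[of k t w] cS_nonzero[OF that k, of v] False sim_trans[of k v w t] by auto
    thus ?thesis using False by (auto simp: cE_def intro: sum.neutral)
  next
    case True
    hence sim: "tab_sim k v t" and P: "P k t" by auto
    have Pv: "P k v" using P_sim[OF t(1) sim k] P by simp
    let ?N = "{w. w \<in> T \<and> tab_sim k w v}"
    have eqN: "{w. w \<in> T \<and> tab_sim k w t} = ?N" using sim sim_trans sim_sym by blast
    have fN: "finite ?N" using finite_T by simp
    have "(\<Sum>w\<in>T. cE k t w * cS k w v) = rt t k * (\<Sum>w\<in>?N. rt w k * cS k w v)"
      unfolding sum_cE[OF t(1) P] eqN ..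
    also have "(\<Sum>w\<in>?N. rt w k * cS k w v) =
        (\<Sum>w\<in>?N. rt v k * (e_diag r u k w / (c w k + c v k)) - (if w = v then rt v k / (2 * c v k) else 0))"
    proof (rule sum.cong[OF refl])
      fix w assume "w \<in> ?N"
      hence w: "w \<in> T" "tab_sim k w v" by auto
      have Pw: "P k w" using P_sim[OF t(2) w(2) k] Pv by simp
      have "cS k w v = (rt w k * rt v k - (if w = v then 1 else 0)) / (c w k + c v k)"
        using Pw w sim_sym[of k w v] by (simp add: cS_def cE_def)
      thus "rt w k * cS k w v = rt v k * (e_diag r u k w / (c w k + c v k)) - (if w = v then rt v k / (2 * c v k) else 0)"
        unfolding rt_square[OF w(1) k Pw, symmetric]
        by (cases "w = v") (simp_all add: right_diff_distrib diff_divide_distrib)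
    qed
    also have "\<dots> = rt v k * (\<Sum>w\<in>?N. e_diag r u k w / (c w k + c v k)) - rt v k / (2 * c v k)"
      using t(2) fN by (simp add: sum_subtractf sum_distrib_left sim_refl)
    also have "(\<Sum>w\<in>?N. e_diag r u k w / (c w k + c v k)) = 1 + 1 / (2 * c v k)"
      by (rule sum_e_diag_divide[OF t(2) k Pv])
    finally show ?thesis using True by (simp add: cE_def algebra_simps)
  qed
  finally show "entry (opS k * opE k) t v = entry (opE k) t v" using t by (simp add: entry_opE)
qed (intro corner_intros op_corner)+

lemma entry_transpose_times:
  assumes A: "A \<in> corner" "A' \<in> corner" "\<And>t v. t \<in> T \<Longrightarrow> v \<in> T \<Longrightarrow> entry A t v = entry A' v t"
    and B: "B \<in> corner" "B' \<in> corner" "\<And>t v. t \<in> T \<Longrightarrow> v \<in> T \<Longrightarrow> entry B t v = entry B' v t"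
    and t: "t \<in> T" "v \<in> T"
  shows "entry (A * B) t v = entry (B' * A') v t"
  using t by (simp add: entry_times A(1,2) B(1,2)) (auto intro!: sum.cong simp: A(3) B(3))

lemma entry_op_sym:
  assumes k: "1 \<le> k" "k < n" and t: "t \<in> T" "v \<in> T"
  shows "entry (opE k) t v = entry (opE k) v t" "entry (opS k) t v = entry (opS k) v t"
  using cE_sym[OF t k] cS_sym[OF t k] t by (simp_all add: entry_opE entry_opS)

lemma opE_opS:
  assumes k: "1 \<le> k" "k < n"
  shows "opE k * opS k = opE k"
proof (intro corner_eqI corner_intros op_corner)
  fix t v assume t: "t \<in> T" "v \<in> T"
  have "entry (opE k * opS k) t v = entry (opS k * opE k) v t"
    by (intro entry_transpose_times op_corner entry_op_sym k t)
  thus "entry (opE k * opS k) t v = entry (opE k) t v"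
    using entry_op_sym(1)[OF k t] by (simp add: opS_opE[OF k])
qed

lemma entry_times_opX_power:
  assumes "t \<in> T" "M \<in> corner"
  shows "M * opX j ^ a \<in> corner \<and> entry (M * opX j ^ a) t v = c t j ^ a * entry M t v"
proof (induction a)
  case (Suc a)
  have "M * opX j ^ Suc a = (M * opX j ^ a) * opX j" by (simp add: power_commutes mult.assoc)
  thus ?case using Suc assms by (simp add: entry_times_opX corner_times op_corner)
qed (use assms in simp)

lemma opE_opX_opE:
  assumes n: "1 < n"
  shows "opE 1 * opX 1 ^ a * opE 1 = scal (\<omega> a) * opE 1"
proof (rule corner_eqI)
  note EX = entry_times_opX_power[OF _ op_corner(1)]
  fix t v assume t: "t \<in> T" "v \<in> T"
  have EXc: "opE 1 * opX 1 ^ a \<in> corner" using EX[OF t(1)] by simp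
  have "entry (opE 1 * opX 1 ^ a * opE 1) t v = (\<Sum>w\<in>T. cE 1 t w * (c w 1 ^ a * cE 1 w v))"
    unfolding entry_times[OF EXc] using t EX by (intro sum.cong) (simp_all add: entry_opE)
  also have "\<dots> = \<omega> a * cE 1 t v"
  proof (cases "P 1 t \<and> tab_sim 1 v t")
    case False
    have "cE 1 t w * (c w 1 ^ a * cE 1 w v) = 0" if "w \<in> T" for w
      using cE_nonzero[of 1 t w] cE_nonzero[of 1 w v] False sim_trans[of 1 v w t] by auto
    hence "(\<Sum>w\<in>T. cE 1 t w * (c w 1 ^ a * cE 1 w v)) = 0" by (intro sum.neutral ballI)
    thus ?thesis using False by (auto simp: cE_def)
  next
    case True
    hence P: "P 1 t" and sim: "tab_sim 1 v t" by auto
    have "(\<Sum>w\<in>T. cE 1 t w * (c w 1 ^ a * cE 1 w v)) =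
        rt t 1 * (\<Sum>w | w \<in> T \<and> tab_sim 1 w t. rt w 1 * (c w 1 ^ a * cE 1 w v))"
      by (rule sum_cE[OF t(1) P])
    also have "(\<Sum>w | w \<in> T \<and> tab_sim 1 w t. rt w 1 * (c w 1 ^ a * cE 1 w v)) =
        (\<Sum>w | w \<in> T \<and> tab_sim 1 w t. e_diag r u 1 w * c w 1 ^ a * rt v 1)"
    proof (rule sum.cong[OF refl])
      fix w assume "w \<in> {w. w \<in> T \<and> tab_sim 1 w t}"
      hence w: "w \<in> T" "tab_sim 1 w t" by auto
      have Pw: "P 1 w" using P_sim[OF t(1) w(2) _ n] P by simp
      have "tab_sim 1 v w" using w sim sim_trans sim_sym by blast
      thus "rt w 1 * (c w 1 ^ a * cE 1 w v) = e_diag r u 1 w * c w 1 ^ a * rt v 1"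
        using Pw rt_square[OF w(1) _ n Pw] by (simp add: cE_def algebra_simps)
    qed
    also have "\<dots> = \<omega> a * rt v 1"
      unfolding sum_distrib_right[symmetric] sum_e_diag_power[OF t(1) n P] ..
    finally show ?thesis using True by (simp add: cE_def)
  qed
  finally show "entry (opE 1 * opX 1 ^ a * opE 1) t v = entry (scal (\<omega> a) * opE 1) t v"
    using t by (simp add: entry_scal entry_opE)
next
  show "opE 1 * opX 1 ^ a * opE 1 \<in> corner"
  \<comment> \<open>The lemma giving membership in the corner refers to a tableau. If there is none,
    E_1 is zero.\<close>
  proof (cases "T = {}")
    case True
    have "opE 1 = 0" using True by (intro corner_eqI op_corner corner_0) auto
    thus ?thesis by (simp add: corner_0)
  next
    case False
    then obtain t where "t \<in> T" by auto
    thus ?thesis using entry_times_opX_power[OF _ op_corner(1), of t 1 1 a] by (auto intro: corner_times op_corner)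
  qed
qed (intro corner_intros op_corner)

text \<open>In the class of t at k this is the tableau whose entries k and k + 2 agree, the only one
  on which E_{k+1} can act nontrivially. It exists since the step from t_{k+1} = t_{k-1} to t_{k+2}
  can be reversed.\<close>

lemma star_in_T:
  assumes t: "t \<in> T" and k: "1 \<le> k" "k + 1 < n" and P: "P k t"
  defines "z \<equiv> t[k := t ! (k + 2)]"
  shows "z \<in> T" "tab_sim k z t" "P k z" "P (k + 1) z"
proof -
  have k': "1 \<le> k" "k < n" "k \<le> n" "k - 1 \<noteq> k" using k by auto
  have m: "move r (t ! (k + 1)) (sg t (k + 2)) (t ! (k + 2) \<ominus>\<^sub>b t ! (k + 1)) (t ! (k + 2))"
    using T_move_Suc[OF t k(2)] by simp
  hence "move r (t ! (k - 1)) (sg t (k + 2)) (t ! (k + 2) \<ominus>\<^sub>b t ! (k + 1)) (t ! (k + 2))" using P by simp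
  from update_in_T[OF t k'(1,2) this move_sym[OF m]] show z: "z \<in> T" by (simp add: z_def)
  show sim: "tab_sim k z t" unfolding z_def by (rule update_sim)
  show "P k z" using P_sim[OF t sim k'(1,2)] P by simp
  show "P (k + 1) z" using update_nth[OF t k'(3), of "t ! (k + 2)"] unfolding z_def by simp
qed

text \<open>The product passes only through the tableau of \<open>star_in_T\<close>, and condition
  (d) cancels the two roots belonging to it.\<close>

lemma entry_opE_opE:
  assumes k: "1 \<le> k" "k + 1 < n" and t: "t \<in> T" "v \<in> T"
  shows "entry (opE (k + 1) * opE k) t v =
    (if P k t \<and> tab_sim (k + 1) v (t[k := t ! (k + 2)]) then rt t k * rt v (k + 1) else 0)"
proof -
  define z where "z = t[k := t ! (k + 2)]"
  have k': "1 \<le> k" "k < n" "k \<le> n" using k by auto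
  have "entry (opE (k + 1) * opE k) t v = (\<Sum>w\<in>T. cE k t w * cE (k + 1) w v)"
    using t by (simp add: entry_times op_corner entry_opE)
  also have "\<dots> = (if P k t \<and> tab_sim (k + 1) v z then rt t k * rt v (k + 1) else 0)"
  proof (cases "P k t")
    case False
    thus ?thesis by (simp add: cE_def)
  next
    case P: True
    note z = star_in_T[OF t(1) k P, folded z_def]
    have "(\<Sum>w\<in>T. cE k t w * cE (k + 1) w v) = cE k t z * cE (k + 1) z v"
    proof (rule sum_single[OF finite_T z(1)])
      fix w assume w: "w \<in> T" "w \<noteq> z"
      show "cE k t w * cE (k + 1) w v = 0"
      proof (rule ccontr)
        assume "\<not> ?thesis"
        hence 1: "tab_sim k w t" and 2: "P (k + 1) w" using cE_nonzero[of k t w] cE_nonzero[of "k + 1" w v] by auto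
        have "w ! k = t ! (k + 2)" using 2 sim_nth[OF t(1) 1, of "k + 2"] k by simp
        hence "w ! k = z ! k" unfolding z_def update_nth[OF t(1) k'(3)] by simp
        moreover have "tab_sim k w z" using 1 z(2) sim_trans sim_sym by blast
        ultimately show False using sim_eqI[OF z(1) w(1)] w(2) by blast
      qed
    qed
    also have "\<dots> = rt t k * (rt z k * rt z (k + 1)) * (if tab_sim (k + 1) v z then rt v (k + 1) else 0)"
      using P z by (simp add: cE_def)
    also have "rt z k * rt z (k + 1) = 1" using root_rt_mult z k by auto
    finally show ?thesis using P by simp
  qed
  finally show ?thesis by (simp add: z_def)
qed

lemma opE_opE_opE_up:
  assumes k: "1 \<le> k" "k + 1 < n"
  shows "opE k * (opE (k + 1) * opE k) = opE k"
proof (intro corner_eqI corner_intros op_corner)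
  fix t v assume t: "t \<in> T" "v \<in> T"
  have k': "1 \<le> k" "k < n" "k \<le> n" using k by auto
  define z where "z = t[k := t ! (k + 2)]"
  have "entry (opE k * (opE (k + 1) * opE k)) t v = (\<Sum>w\<in>T. entry (opE (k + 1) * opE k) t w * cE k w v)"
    using t by (simp add: entry_times[OF op_corner(1)[of k]] entry_opE)
  also have "\<dots> = (\<Sum>w\<in>T. (if P k t \<and> tab_sim (k + 1) w z then rt t k * rt w (k + 1) else 0) * cE k w v)"
    using entry_opE_opE[OF k t(1)] by (intro sum.cong) (simp_all add: z_def)
  also have "\<dots> = cE k t v"
  proof (cases "P k t")
    case False
    thus ?thesis by (simp add: cE_def)
  next
    case P: True
    note z = star_in_T[OF t(1) k P, folded z_def]
    have "(\<Sum>w\<in>T. (if P k t \<and> tab_sim (k + 1) w z then rt t k * rt w (k + 1) else 0) * cE k w v) =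
        rt t k * rt z (k + 1) * cE k z v"
    proof (subst sum_single[OF finite_T z(1)])
      fix w assume w: "w \<in> T" "w \<noteq> z"
      show "(if P k t \<and> tab_sim (k + 1) w z then rt t k * rt w (k + 1) else 0) * cE k w v = 0"
      proof (rule ccontr)
        assume "\<not> ?thesis"
        hence 1: "tab_sim (k + 1) w z" and 2: "P k w" using cE_nonzero[of k w v] by (auto split: if_splits)
        have "w ! (k + 1) = z ! (k + 1)" using 2 sim_nth[OF z(1) 1, of "k - 1"] z(3) k' by simp
        thus False using sim_eqI[OF z(1) w(1) 1] w(2) by blast
      qed
    qed (use P in \<open>simp add: sim_refl\<close>)
    also have "cE k z v = (if tab_sim k v t then rt z k * rt v k else 0)"
      using z sim_trans[of k v z t] sim_trans[of k v t z] sim_sym[of k z t] by (auto simp: cE_def)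
    also have "rt t k * rt z (k + 1) * (if tab_sim k v t then rt z k * rt v k else 0) =
        (rt z k * rt z (k + 1)) * cE k t v"
      using P by (simp add: cE_def)
    also have "rt z k * rt z (k + 1) = 1" using root_rt_mult z k by auto
    finally show ?thesis by simp
  qed
  finally show "entry (opE k * (opE (k + 1) * opE k)) t v = entry (opE k) t v"
    using t by (simp add: entry_opE)
qed

lemma opE_opE_opE_down:
  assumes k: "1 \<le> k" "k + 1 < n"
  shows "opE (k + 1) * opE k * opE (k + 1) = opE (k + 1)"
proof (intro corner_eqI corner_intros op_corner)
  fix t v assume t: "t \<in> T" "v \<in> T"
  have k': "1 \<le> k" "k < n" "k \<le> n" "k + 1 \<le> n" "k - 1 \<noteq> k" "k - 1 \<noteq> k + 1" using k by auto
  let ?g = "\<lambda>w. if P k w \<and> tab_sim (k + 1) v (w[k := w ! (k + 2)]) then rt w k * rt v (k + 1) else 0"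
  have "entry (opE (k + 1) * opE k * opE (k + 1)) t v = (\<Sum>w\<in>T. cE (k + 1) t w * entry (opE (k + 1) * opE k) w v)"
    using t by (simp add: entry_times[OF corner_times[OF op_corner(1) op_corner(1)]] entry_opE)
  also have "\<dots> = (\<Sum>w\<in>T. cE (k + 1) t w * ?g w)"
    using entry_opE_opE[OF k _ t(2)] by (intro sum.cong) simp_all
  also have "\<dots> = cE (k + 1) t v"
  proof (cases "P (k + 1) t")
    case False
    thus ?thesis by (simp add: cE_def)
  next
    case P: True
    \<comment> \<open>The mirror image of \<open>star_in_T\<close>: entry k + 1 is changed so as to
      agree with entry k - 1.\<close>
    define z where "z = t[k + 1 := t ! (k - 1)]"
    have nth: "z ! j = (if j = k + 1 then t ! (k - 1) else t ! j)" for j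
      unfolding z_def by (rule update_nth[OF t(1) k'(4)])
    have m: "move r (t ! (k - 1)) (sg t k) (t ! k \<ominus>\<^sub>b t ! (k - 1)) (t ! k)" by (rule T_move[OF t(1) k'(1,3)])
    have "z \<in> T" unfolding z_def
      using P m move_sym[OF m] by (intro update_in_T[OF t(1) _ k(2)]) auto
    have Pz: "P k z" "P (k + 1) z" using P k' by (simp_all add: nth)
    have sim: "tab_sim (k + 1) z t" unfolding z_def by (rule update_sim)
    have "(\<Sum>w\<in>T. cE (k + 1) t w * ?g w) = cE (k + 1) t z * ?g z"
    proof (rule sum_single[OF finite_T \<open>z \<in> T\<close>])
      fix w assume w: "w \<in> T" "w \<noteq> z"
      show "cE (k + 1) t w * ?g w = 0"
      proof (rule ccontr)
        assume "\<not> ?thesis"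
        hence 1: "tab_sim (k + 1) w t" and 2: "P k w" using cE_nonzero[of "k + 1" t w] by (auto split: if_splits)
        have "w ! (k + 1) = z ! (k + 1)" using 2 sim_nth[OF t(1) 1, of "k - 1"] k' by (simp add: nth)
        moreover have "tab_sim (k + 1) w z" using 1 sim sim_trans sim_sym by blast
        ultimately show False using sim_eqI[OF \<open>z \<in> T\<close> w(1)] w(2) by blast
      qed
    qed
    also have "?g z = (if tab_sim (k + 1) v t then rt z k * rt v (k + 1) else 0)"
    proof -
      have "z ! (k + 2) = z ! k" using P by (simp add: nth)
      hence "z[k := z ! (k + 2)] = z" by (metis list_update_id)
      moreover have "tab_sim (k + 1) v z \<longleftrightarrow> tab_sim (k + 1) v t" using sim sim_trans sim_sym by blast
      ultimately show ?thesis using Pz by (simp only: simp_thms)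
    qed
    also have "cE (k + 1) t z = rt t (k + 1) * rt z (k + 1)" using P sim by (simp add: cE_def)
    also have "rt t (k + 1) * rt z (k + 1) * (if tab_sim (k + 1) v t then rt z k * rt v (k + 1) else 0) =
        (rt z k * rt z (k + 1)) * cE (k + 1) t v"
      using P by (simp add: cE_def)
    also have "rt z k * rt z (k + 1) = 1" using root_rt_mult \<open>z \<in> T\<close> Pz k by auto
    finally show ?thesis by simp
  qed
  finally show "entry (opE (k + 1) * opE k * opE (k + 1)) t v = entry (opE (k + 1)) t v"
    using t by (simp add: entry_opE)
qed

text \<open>Matches the hypotheses of condition (f). In z the three labels are (m, m, m) and in w1
  they are (l, l, m); if either side holds, w2 has (m, l, l) and v has (l, m, l). Both swaps then
  exist because l and m are orthogonal.\<close>

lemma swap_across: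
  assumes z: "z \<in> T" "P k z" "P (k + 1) z" and k: "1 \<le> k" "k + 1 < n" and v: "v \<in> T"
    and w1: "w1 \<in> T" "tab_sim k w1 z" and w2: "w2 \<in> T" "tab_sim (k + 1) w2 z"
    and vw: "tab_sim (k + 1) v w1" "tab_sim k v w2"
  shows "swap_defined (k + 1) w1 \<and> v = swap_tab r (k + 1) w1 \<longleftrightarrow> swap_defined k w2 \<and> v = swap_tab r k w2"
proof -
  have k': "1 \<le> k" "k < n" "k \<le> n" "1 \<le> k + 1" "k + 1 \<le> n" "k - 1 \<noteq> k" "k - 1 \<noteq> k + 1" "k - 1 \<le> n"
    "1 \<le> k + 2" "k + 2 \<le> n" "k + 2 \<noteq> k" "k + 2 \<noteq> k + 1" using k by auto
  have w1': "w1 ! (k - 1) = z ! (k - 1)" "w1 ! (k + 1) = z ! (k + 1)" "w1 ! (k + 2) = z ! (k + 2)" "v ! (k - 1) = w1 ! (k - 1)" "v ! k = w1 ! k"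
    by (rule sim_nth[OF z(1) w1(2)] sim_nth[OF w1(1) vw(1)]; use k in simp)+
  have w2': "w2 ! (k - 1) = z ! (k - 1)" "w2 ! k = z ! k" "v ! (k + 1) = w2 ! (k + 1)" "v ! (k + 2) = w2 ! (k + 2)"
    by (rule sim_nth[OF z(1) w2(2)] sim_nth[OF w2(1) vw(2)]; use k in simp)+
  have Pw1: "P k w1" using w1' z by simp
  have Pw2: "P (k + 1) w2" using P_sim[OF z(1) w2(2) k'(4) k(2)] z(3) by simp
  have c1: "c w1 (k + 2) = c w2 k"
    using w1' w2' z k' by (auto simp: tab_content_def)
  have cv: "c v k = c w1 k" using w1' by (intro c_local) auto
  have cv2: "c v (k + 2) = c w2 (k + 2)" using w2' by (intro c_local) auto
  have n1: "c w1 (k + 1) = - c w1 k" by (rule c_next[OF w1(1) k'(1,2) Pw1])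
  have n2: "c w2 (k + 2) = - c w2 (k + 1)" using c_next[OF w2(1) k'(4) k(2) Pw2] by simp
  have two: "k + 2 = k + 1 + 1" by simp
  show ?thesis
  proof
    assume d: "swap_defined (k + 1) w1 \<and> v = swap_tab r (k + 1) w1"
    note s = swap_facts[OF w1(1) k'(4) k(2) d[THEN conjunct1], folded d[THEN conjunct2]]
    have "lab v k = lab w1 k" using cv c_eq_iff[OF v k'(1,3) w1(1) k'(1,3)] by simp
    moreover have "lab w1 k = lab w1 (k + 1)" using P_iff[OF w1(1) k'(1,2)] Pw1 by simp
    ultimately have "swap_defined k v"
      using d s(3) swap_defined_iff[OF v k'(1,2)] swap_defined_iff[OF w1(1) k'(4) k(2)] by simp
    moreover have "w2 = swap_tab r k v"
      using s(5) c1 vw(2) sim_sym[of k v w2] by (intro swap_eqI[OF v w2(1) k'(1,2) calculation]) auto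
    ultimately show "swap_defined k w2 \<and> v = swap_tab r k w2"
      using swap_facts[OF v k'(1,2)] by simp
  next
    assume d: "swap_defined k w2 \<and> v = swap_tab r k w2"
    note s = swap_facts[OF w2(1) k'(1,2) d[THEN conjunct1], folded d[THEN conjunct2]]
    have "lab v (k + 2) = lab w2 (k + 2)" using cv2 c_eq_iff[OF v k'(9,10) w2(1) k'(9,10)] by simp
    moreover have "lab w2 (k + 2) = lab w2 (k + 1)" using P_iff[OF w2(1) k'(4) k(2)] Pw2 by simp
    ultimately have "swap_defined (k + 1) v"
      using d s(4) swap_defined_iff[OF v k'(4) k(2)] swap_defined_iff[OF w2(1) k'(1,2)] by simp
    moreover have "c w1 (k + 1) = c v (k + 1 + 1)" using n1 cv s(5) n2 cv2 by simp
    hence "w1 = swap_tab r (k + 1) v"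
      using vw(1) sim_sym[of "k + 1" v w1] by (intro swap_eqI[OF v w1(1) k'(4) k(2) calculation]) auto
    ultimately show "swap_defined (k + 1) w1 \<and> v = swap_tab r (k + 1) w1"
      using swap_facts[OF v k'(4) k(2)] by simp
  qed
qed

text \<open>The entries of S_k E_{k+1} E_k = S_{k+1} E_k after the root of the source is removed.
  Each sum has at most one nonzero term: \<open>w1\<close> takes entry k from v, and
  \<open>w2\<close> takes entry k + 1. The terms are compared according to which of these entries v
  shares with z.\<close>

lemma sum_exchange:
  assumes z: "z \<in> T" "P k z" "P (k + 1) z" and k: "1 \<le> k" "k + 1 < n" and v: "v \<in> T"
  shows "(\<Sum>w | w \<in> T \<and> tab_sim k w z. rt w k * cS (k + 1) w v) =
    (\<Sum>w | w \<in> T \<and> tab_sim (k + 1) w z. rt w (k + 1) * cS k w v)"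
proof (cases "\<forall>j\<le>n. j \<noteq> k \<and> j \<noteq> k + 1 \<longrightarrow> v ! j = z ! j")
  case False
  have k': "1 \<le> k" "k < n" "1 \<le> k + 1" using k by auto
  have "rt w k * cS (k + 1) w v = 0" if w: "w \<in> T" "tab_sim k w z" for w
    using False sim_iff[OF z(1) w(1)] w(2) sim_iff[OF w(1) v] cS_nonzero[OF w(1) k'(3) k(2), of v] by auto
  moreover have "rt w (k + 1) * cS k w v = 0" if w: "w \<in> T" "tab_sim (k + 1) w z" for w
    using False sim_iff[OF z(1) w(1)] w(2) sim_iff[OF w(1) v] cS_nonzero[OF w(1) k'(1,2), of v] by auto
  ultimately have "(\<Sum>w | w \<in> T \<and> tab_sim k w z. rt w k * cS (k + 1) w v) = 0"
    "(\<Sum>w | w \<in> T \<and> tab_sim (k + 1) w z. rt w (k + 1) * cS k w v) = 0"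
    by (intro sum.neutral ballI; blast)+
  thus ?thesis by simp
next
  case True
  have k': "1 \<le> k" "k < n" "k \<le> n" "1 \<le> k + 1" "k + 1 \<le> n" "k - 1 \<noteq> k" "k - 1 \<noteq> k + 1" "k - 1 \<le> n"
    "k + 2 \<noteq> k" "k + 2 \<noteq> k + 1" "k + 2 \<le> n" using k by auto
  have agree: "v ! (k - 1) = z ! (k - 1)" "v ! (k + 2) = z ! (k + 2)" using True k' by blast+
  have z': "z ! (k + 1) = z ! (k - 1)" "z ! (k + 2) = z ! k" using z by auto
  define w1 where "w1 = z[k := v ! k]"
  define w2 where "w2 = z[k + 1 := v ! (k + 1)]"
  have nth1: "w1 ! j = (if j = k then v ! k else z ! j)" for j
    unfolding w1_def by (rule update_nth[OF z(1) k'(3)])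
  have nth2: "w2 ! j = (if j = k + 1 then v ! (k + 1) else z ! j)" for j
    unfolding w2_def by (rule update_nth[OF z(1) k'(5)])
  have m1: "move r (z ! (k - 1)) (sg v k) (v ! k \<ominus>\<^sub>b v ! (k - 1)) (v ! k)"
    using T_move[OF v k'(1,3)] agree by simp
  have m2: "move r (v ! (k + 1)) (sg v (k + 1 + 1)) (v ! (k + 1 + 1) \<ominus>\<^sub>b v ! (k + 1)) (z ! (k + 2))"
    using T_move_Suc[OF v k(2)] agree by simp
  have w1T: "w1 \<in> T" unfolding w1_def
    using m1 move_sym[OF m1] z' by (intro update_in_T[OF z(1) k'(1,2)]) auto
  have w2T: "w2 \<in> T" unfolding w2_def
    using m2 move_sym[OF m2] z' by (intro update_in_T[OF z(1) k'(4) k(2)]) auto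
  have sim1: "tab_sim k w1 z" and sim2: "tab_sim (k + 1) w2 z" unfolding w1_def w2_def by (rule update_sim)+
  have vw1: "tab_sim (k + 1) v w1" using True by (simp add: sim_iff[OF w1T v] nth1)
  have vw2: "tab_sim k v w2" using True by (simp add: sim_iff[OF w2T v] nth2)
  have fin: "finite {w. w \<in> T \<and> Q w}" for Q using finite_T by simp
  have "(\<Sum>w | w \<in> T \<and> tab_sim k w z. rt w k * cS (k + 1) w v) = rt w1 k * cS (k + 1) w1 v"
  proof (rule sum_single[OF fin])
    show "w1 \<in> {w. w \<in> T \<and> tab_sim k w z}" using w1T sim1 by simp
    fix w assume w: "w \<in> {w. w \<in> T \<and> tab_sim k w z}" "w \<noteq> w1"
    have "cS (k + 1) w v = 0"
    proof (rule ccontr)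
      assume "cS (k + 1) w v \<noteq> 0"
      hence "tab_sim (k + 1) v w" using w cS_nonzero[OF _ k'(4) k(2)] by blast
      hence "w ! k = w1 ! k" using sim_nth[of w "k + 1" v k] w k' by (simp add: nth1)
      moreover have "tab_sim k w w1" using w sim1 sim_trans sim_sym by blast
      ultimately show False using sim_eqI[OF w1T, of w k] w by blast
    qed
    thus "rt w k * cS (k + 1) w v = 0" by simp
  qed
  moreover have "(\<Sum>w | w \<in> T \<and> tab_sim (k + 1) w z. rt w (k + 1) * cS k w v) = rt w2 (k + 1) * cS k w2 v"
  proof (rule sum_single[OF fin])
    show "w2 \<in> {w. w \<in> T \<and> tab_sim (k + 1) w z}" using w2T sim2 by simp
    fix w assume w: "w \<in> {w. w \<in> T \<and> tab_sim (k + 1) w z}" "w \<noteq> w2"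
    have "cS k w v = 0"
    proof (rule ccontr)
      assume "cS k w v \<noteq> 0"
      hence "tab_sim k v w" using w cS_nonzero[OF _ k'(1,2)] by blast
      hence "w ! (k + 1) = w2 ! (k + 1)" using sim_nth[of w k v "k + 1"] w k' by (simp add: nth2)
      moreover have "tab_sim (k + 1) w w2" using w sim2 sim_trans sim_sym by blast
      ultimately show False using sim_eqI[OF w2T, of w "k + 1"] w by blast
    qed
    thus "rt w (k + 1) * cS k w v = 0" by simp
  qed
  moreover have "rt w1 k * cS (k + 1) w1 v = rt w2 (k + 1) * cS k w2 v"
  proof -
    have cn: "c z (k + 1) = - c z k" "c z (k + 2) = c z k"
      using c_next[OF z(1) k'(1,2) z(2)] c_next[OF z(1) k'(4) k(2) z(3)] by simp_all
    have rr: "rt z k * rt z (k + 1) = 1" using root_rt_mult z k by auto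
    have w1P: "P (k + 1) w1 \<longleftrightarrow> v ! k = z ! k" using z'(2) by (simp add: nth1)
    have w2P: "P k w2 \<longleftrightarrow> v ! (k + 1) = z ! (k + 1)" using z'(1) k' by (simp add: nth2) (metis)
    consider "v ! k = z ! k" "v ! (k + 1) = z ! (k + 1)" | "v ! k = z ! k" "v ! (k + 1) \<noteq> z ! (k + 1)"
      | "v ! k \<noteq> z ! k" "v ! (k + 1) = z ! (k + 1)" | "v ! k \<noteq> z ! k" "v ! (k + 1) \<noteq> z ! (k + 1)" by blast
    thus ?thesis
    proof cases
      \<comment> \<open>Here v = z. From qp = 1 follow q(p^2 - 1) = p - q and p(q^2 - 1) = q - p,
        and the sign is compensated by the opposite contents of steps k and k + 1.\<close>
      case 1
      hence eq: "w1 = z" "w2 = z" "v = z"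
        using True by (auto intro!: tab_eqI w1T w2T z v simp: nth1 nth2)
      define p q where "p = rt z (k + 1)" and "q = rt z k"
      have qp: "q * p = 1" using rr by (simp add: p_def q_def)
      have "cS (k + 1) z z = (p * p - 1) / (c z (k + 1) + c z (k + 1))" "cS k z z = (q * q - 1) / (c z k + c z k)"
        using z by (simp_all add: cS_def cE_def sim_refl p_def q_def)
      moreover have "q * (p * p - 1) = p - q"
      proof -
        have "q * (p * p - 1) = (q * p) * p - q" by (simp only: right_diff_distrib mult.assoc mult_1_right)
        thus ?thesis by (simp only: qp mult_1_left)
      qed
      moreover have "p * (q * q - 1) = q - p"
      proof -
        have "p * (q * q - 1) = (q * p) * q - p" by (simp add: right_diff_distrib ac_simps)
        thus ?thesis by (simp only: qp mult_1_left)
      qed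
      moreover have "c z (k + 1) + c z (k + 1) = - (c z k + c z k)" using cn(1) by simp
      ultimately have "q * cS (k + 1) z z = (p - q) / - (c z k + c z k)" "p * cS k z z = (q - p) / (c z k + c z k)"
        by (simp_all only: times_divide_eq_right)
      moreover have "(p - q) / - (c z k + c z k) = (q - p) / (c z k + c z k)"
        by (metis minus_diff_eq minus_divide_divide minus_minus)
      ultimately have "q * cS (k + 1) z z = p * cS k z z" by simp
      hence "rt z k * cS (k + 1) z z = rt z (k + 1) * cS k z z" by (simp add: p_def q_def)
      thus ?thesis unfolding eq .
    next
      \<comment> \<open>Only entry k + 1 changes: an off-diagonal s coefficient at k + 1 meets the a
        coefficient of v at k. Their denominators agree, and condition (d) removes the roots of z.
        The next case is the mirror image.\<close>
      case 2
      hence eq: "w1 = z" "w2 = v"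
        using True by (auto intro!: tab_eqI w1T w2T z v simp: nth1 nth2)
      have "v \<noteq> z" using 2 by auto
      have sim: "tab_sim (k + 1) v z" using sim2 eq by simp
      have "\<not> P k v" using 2 agree z'(1) by simp
      have "c v k = c z k" using 2 agree by (intro c_local) auto
      moreover have "cS (k + 1) z v = rt z (k + 1) * rt v (k + 1) / (c z (k + 1) + c v (k + 1))"
        using z sim \<open>v \<noteq> z\<close> by (simp add: cS_def cE_def)
      moreover have "cS k v v = 1 / (c v (k + 1) - c v k)" using \<open>\<not> P k v\<close> by (simp add: cS_def a_coeff_def)
      ultimately have "rt z k * cS (k + 1) z v = (rt z k * rt z (k + 1)) * (rt v (k + 1) * cS k v v)"
        using cn by (simp add: algebra_simps)
      thus ?thesis unfolding eq rr by simp
    next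
      case 3
      hence eq: "w2 = z" "w1 = v"
        using True by (auto intro!: tab_eqI w1T w2T z v simp: nth1 nth2)
      have "v \<noteq> z" using 3 by auto
      have sim: "tab_sim k v z" using sim1 eq by simp
      have nP: "\<not> P (k + 1) v" using 3 agree z'(2) by simp
      have "P k v" using 3 agree z'(1) by simp
      hence "c v (k + 1) = - c v k" by (rule c_next[OF v k'(1,2)])
      moreover have "c v (k + 2) = c z (k + 2)" using 3 agree by (intro c_local) auto
      moreover have "cS k z v = rt z k * rt v k / (c z k + c v k)"
        using z sim \<open>v \<noteq> z\<close> by (simp add: cS_def cE_def)
      moreover have "cS (k + 1) v v = 1 / (c v (k + 2) - c v (k + 1))" using nP by (simp add: cS_def a_coeff_def)
      ultimately have "rt z (k + 1) * cS k z v = (rt z k * rt z (k + 1)) * (rt v k * cS (k + 1) v v)"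
        using cn by (simp add: algebra_simps)
      thus ?thesis unfolding eq rr by simp
    next
      \<comment> \<open>Neither side is an s coefficient or a diagonal entry. Either both are b
        coefficients, related by condition (f), or both vanish.\<close>
      case 4
      hence ne: "v \<noteq> w1" "v \<noteq> w2" using nth1[of "k + 1"] nth2[of k] by auto
      note sw = swap_across[OF z k v w1T sim1 w2T sim2 vw1 vw2]
      show ?thesis
      proof (cases "swap_defined k w2 \<and> v = swap_tab r k w2")
        case True
        have "b w2 k * rt w2 (k + 1) = b w1 (k + 1) * rt w1 k"
          using root_b_rt z k k' w1T w2T sim1 sim2 True sw by auto
        moreover have "cS k w2 v = b w2 k" using 4 w2P ne True by (simp add: cS_def)
        moreover have "cS (k + 1) w1 v = b w1 (k + 1)"
          using 4 w1P ne True[folded sw] by (simp only: cS_def if_False if_True simp_thms)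
        ultimately show ?thesis by (simp add: mult.commute)
      next
        case False
        have "cS k w2 v = 0" using 4 w2P ne False by (simp only: cS_def if_False)
        moreover have "cS (k + 1) w1 v = 0" using 4 w1P ne False[folded sw] by (simp only: cS_def if_False)
        ultimately show ?thesis by simp
      qed
    qed
  qed
  ultimately show ?thesis by simp
qed

lemma opS_opE_opE:
  assumes k: "1 \<le> k" "k + 1 < n"
  shows "opS k * (opE (k + 1) * opE k) = opS (k + 1) * opE k"
proof (intro corner_eqI corner_intros op_corner)
  fix t v assume t: "t \<in> T" "v \<in> T"
  define z where "z = t[k := t ! (k + 2)]"
  have k': "1 \<le> k" "k < n" using k by auto
  have L: "entry (opS k * (opE (k + 1) * opE k)) t v =
      (\<Sum>w\<in>T. (if P k t \<and> tab_sim (k + 1) w z then rt t k * rt w (k + 1) else 0) * cS k w v)"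
    unfolding entry_times[OF op_corner(2)] using entry_opE_opE[OF k t(1)] t(2)
    by (intro sum.cong) (simp_all add: z_def entry_opS)
  have R: "entry (opS (k + 1) * opE k) t v = (\<Sum>w\<in>T. cE k t w * cS (k + 1) w v)"
    unfolding entry_times[OF op_corner(2)] using t by (intro sum.cong) (simp_all add: entry_opE entry_opS)
  show "entry (opS k * (opE (k + 1) * opE k)) t v = entry (opS (k + 1) * opE k) t v"
  proof (cases "P k t")
    case False
    thus ?thesis unfolding L R by (simp add: cE_def)
  next
    case P: True
    note z = star_in_T[OF t(1) k P, folded z_def]
    have eq: "tab_sim k w t \<longleftrightarrow> tab_sim k w z" for w using z(2) sim_trans sim_sym by blast
    have "entry (opS k * (opE (k + 1) * opE k)) t v =
        (\<Sum>w\<in>T. if tab_sim (k + 1) w z then rt t k * (rt w (k + 1) * cS k w v) else 0)"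
      unfolding L using P by (intro sum.cong) auto
    also have "\<dots> = (\<Sum>w | w \<in> T \<and> tab_sim (k + 1) w z. rt t k * (rt w (k + 1) * cS k w v))"
      by (rule sum.inter_filter[OF finite_T, symmetric])
    also have "\<dots> = rt t k * (\<Sum>w | w \<in> T \<and> tab_sim k w z. rt w k * cS (k + 1) w v)"
      unfolding sum_exchange[OF z(1,3,4) k t(2)] by (rule sum_distrib_left[symmetric])
    also have "\<dots> = entry (opS (k + 1) * opE k) t v"
      unfolding R sum_cE[OF t(1) P] eq ..
    finally show ?thesis .
  qed
qed

lemma opE_opE_opS:
  assumes k: "1 \<le> k" "k + 1 < n"
  shows "opE (k + 1) * (opE k * opS (k + 1)) = opE (k + 1) * opS k"
proof (intro corner_eqI corner_intros op_corner)
  have k': "1 \<le> k" "k < n" "1 \<le> k + 1" using k by auto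
  \<comment> \<open>The relation just proved, multiplied by E_{k+1} on the right and contracted. The
    claim is its transpose.\<close>
  have SF: "opS k * opE (k + 1) = (opS (k + 1) * opE k) * opE (k + 1)"
    using arg_cong[OF opS_opE_opE[OF k], of "\<lambda>x. x * opE (k + 1)"] opE_opE_opE_down[OF k] by (simp add: mult.assoc)
  fix t v assume t: "t \<in> T" "v \<in> T"
  have "entry (opE (k + 1) * (opE k * opS (k + 1))) t v = entry ((opS (k + 1) * opE k) * opE (k + 1)) v t"
    by (intro entry_transpose_times corner_intros op_corner entry_op_sym k k' t)
  also have "\<dots> = entry (opE (k + 1) * opS k) t v"
    unfolding SF[symmetric]
    by (rule sym, intro entry_transpose_times corner_intros op_corner entry_op_sym k k' t)
  finally show "entry (opE (k + 1) * (opE k * opS (k + 1))) t v = entry (opE (k + 1) * opS k) t v" .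
qed


section \<open>The quadratic and braid relations, and E_k^2\<close>

lemma opS_square:
  assumes k: "1 \<le> k" "k < n"
  shows "opS k * opS k = proj"
proof (intro corner_eqI corner_intros op_corner)
  let ?Q = "opS k * opS k"
  have Q: "?Q \<in> corner" by (intro corner_intros op_corner)
  note unit = corner_proj[OF op_corner(2)[of k]] corner_proj[OF op_corner(3)[of k]] corner_proj[OF op_corner(3)[of "k + 1"]]
  note sq = skein_square_commutes[OF unit opE_opS[OF k] opS_opE[OF k] skein[OF k]]
  have com: "?Q * opX j = opX j * ?Q" if j: "1 \<le> j" "j \<le> n" for j
  proof -
    consider "j = k" | "j = k + 1" | "j \<noteq> k" "j \<noteq> k + 1" by blast
    thus ?thesis
    proof cases
      case 3
      note a = opX_far(1)[OF k j 3]
      have "opS k * (opX j * w) = opX j * (opS k * w)" for w by (simp only: mult.assoc[symmetric] a)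
      thus ?thesis by (simp only: mult.assoc a)
    qed (use sq in simp_all)
  qed
  have off: "entry ?Q t v = 0" if t: "t \<in> T" "v \<in> T" and ne: "t \<noteq> v" for t v
  proof -
    obtain j where j: "1 \<le> j" "j \<le> n" "c t j \<noteq> c v j" using contents_eqI[OF t] ne by blast
    have "c t j * entry ?Q t v = c v j * entry ?Q t v"
      using arg_cong[OF com[OF j(1,2)], of "\<lambda>A. entry A t v"] t Q by (simp add: entry_times_opX entry_opX_times)
    thus ?thesis using j(3) by simp
  qed
  fix t v assume t: "t \<in> T" "v \<in> T"
  have "entry ?Q t t = 1"
  proof (cases "P k t")
    case True
    have "opE k * ?Q = opE k" by (simp only: mult.assoc[symmetric] opE_opS[OF k])
    hence "entry (opE k) t t = (\<Sum>w\<in>T. entry ?Q t w * entry (opE k) w t)"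
      using entry_times[OF op_corner(1), of k ?Q t t] by simp
    also have "\<dots> = entry ?Q t t * entry (opE k) t t"
      by (rule sum_single[OF finite_T t(1)]) (simp add: off t)
    finally have "entry (opE k) t t = entry ?Q t t * entry (opE k) t t" .
    moreover have "entry (opE k) t t \<noteq> 0"
      using t True rt_nonzero[OF t(1) k True] by (simp add: entry_opE cE_def sim_refl)
    ultimately show ?thesis by simp
  next
    \<comment> \<open>The diagonal entry is a^2 + b^2 if the swap exists, and otherwise a^2 with
      adjacent labels; both are 1.\<close>
    case False
    have kk: "k \<in> {1..<n}" using k by simp
    have ab: "b t k ^ 2 = 1 - a_coeff u k t ^ 2" using root_b t(1) kk False by blast
    have "entry ?Q t t = (\<Sum>w\<in>T. cS k t w * cS k t w)"
      unfolding entry_times[OF op_corner(2)] using cS_sym[OF _ t(1) k] t(1)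
      by (intro sum.cong) (simp_all add: entry_opS)
    also have "\<dots> = 1"
    proof (cases "swap_defined k t")
      case True
      note s = swap_facts[OF t(1) k True]
      have "(\<Sum>w\<in>T. cS k t w * cS k t w) = (\<Sum>w\<in>{t, swap_tab r k t}. cS k t w * cS k t w)"
        using s t finite_T False by (intro sum.mono_neutral_right) (auto simp: cS_def)
      also have "\<dots> = a_coeff u k t ^ 2 + b t k ^ 2"
        using s(11) False True by (simp add: cS_def power2_eq_square)
      finally show ?thesis using ab by simp
    next
      case nd: False
      have "(\<Sum>w\<in>T. cS k t w * cS k t w) = cS k t t * cS k t t"
        using False nd by (intro sum_single[OF finite_T t(1)]) (simp add: cS_def)
      also have "\<dots> = a_coeff u k t ^ 2" using False by (simp add: cS_def power2_eq_square)
      also have "\<dots> = 1" by (rule a_coeff_undefined[OF t(1) k False nd])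
      finally show ?thesis .
    qed
    finally show ?thesis .
  qed
  thus "entry ?Q t v = entry proj t v" using off[OF t] t by (cases "t = v") (simp_all add: entry_proj)
qed

lemma wenzl_triple_ops:
  assumes k: "1 \<le> k" "k + 1 < n"
  shows "wenzl_triple (opS k) (opS (k + 1)) (opE k) (opE (k + 1)) (opX k) (opX (k + 1)) (opX (k + 2)) proj"
proof -
  have k': "1 \<le> k" "k < n" "1 \<le> k + 1" using k by auto
  have 2: "k + 1 + 1 = k + 2" by simp
  note sk = skein[OF k'(3) k(2), unfolded 2]
  have far: "opS k * opX (k + 2) = opX (k + 2) * opS k" "opS (k + 1) * opX k = opX k * opS (k + 1)"
    using k by (intro opX_far; simp)+
  have down': "opE (k + 1) * (opE k * opE (k + 1)) = opE (k + 1)" using opE_opE_opE_down[OF k] by (simp only: mult.assoc)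
  show ?thesis
    by unfold_locales
      (rule corner_proj corner_intros op_corner proj_idem opS_square opE_opS skein sk far opE_opE_opE_up down' opS_opE_opE opE_opE_opS k k')+
qed

lemma lab_sim:
  assumes "t \<in> T" "tab_sim k v t" "1 \<le> j" "j \<le> n" "j \<noteq> k" "j \<noteq> k + 1"
  shows "lab v j = lab t j"
  using sim_nth[OF assms(1,2), of j] sim_nth[OF assms(1,2), of "j - 1"] assms by (simp add: step_label_def)

lemma entry_times_opS:
  assumes y: "y \<in> T" and k: "1 \<le> k" "k < n" and d: "swap_defined k y" and A: "A \<in> corner"
  shows "entry (A * opS k) y v = a_coeff u k y * entry A y v + b y k * entry A (swap_tab r k y) v"
proof -
  note s = swap_facts[OF y k d]
  have "entry (A * opS k) y v = (\<Sum>w\<in>T. cS k y w * entry A w v)"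
    unfolding entry_times[OF A] using y by (intro sum.cong) (simp_all add: entry_opS)
  also have "\<dots> = (\<Sum>w\<in>{y, swap_tab r k y}. cS k y w * entry A w v)"
    using s y finite_T by (intro sum.mono_neutral_right) (auto simp: cS_def)
  also have "\<dots> = a_coeff u k y * entry A y v + b y k * entry A (swap_tab r k y) v"
    using s d by (simp add: cS_def)
  finally show ?thesis .
qed

lemma entry_opS_zero:
  assumes "y \<in> T" "v \<in> T" "1 \<le> k" "k < n" "1 \<le> j" "j \<le> n" "j \<noteq> k" "j \<noteq> k + 1" "c y j \<noteq> c v j"
  shows "entry (opS k) y v = 0"
  using cS_nonzero[OF assms(1,3,4), of v] c_sim[OF assms(1) _ assms(5-8), of v] assms(9)
  by (cases "cS k y v = 0") (auto simp: entry_opS assms)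

lemma entry_opS_swap:
  assumes "y \<in> T" "1 \<le> k" "k < n" "swap_defined k y"
  shows "entry (opS k) y (swap_tab r k y) = b y k"
  using swap_facts[OF assms] assms by (simp add: entry_opS cS_def)

text \<open>The six orders of three commuting steps form a hexagon with t and v at opposite corners.
  Terms with an a coefficient miss v because a content is left in the wrong place, so each triple
  product follows one half of the hexagon.\<close>

lemma braid_entry_far:
  assumes t: "t \<in> T" "v \<in> T" and k: "1 \<le> k" "k + 1 < n"
    and far: "cartan (lab t k) (lab t (k + 1)) = 0" "cartan (lab t k) (lab t (k + 2)) = 0"
      "cartan (lab t (k + 1)) (lab t (k + 2)) = 0"
    and cv: "c v k = c t (k + 2)" "c v (k + 1) = c t (k + 1)" "c v (k + 2) = c t k"
      "\<And>j. 1 \<le> j \<Longrightarrow> j \<le> n \<Longrightarrow> j \<notin> {k, k + 1, k + 2} \<Longrightarrow> c v j = c t j"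
  shows "entry (opS k * (opS (k + 1) * opS k)) t v = entry (opS (k + 1) * (opS k * opS (k + 1))) t v"
proof -
  have k': "1 \<le> k" "k < n" "k \<le> n" "1 \<le> k + 1" "k + 1 \<le> n" "1 \<le> k + 2" "k + 2 \<le> n" using k by auto
  note K = k'(1,2) and L = k'(4) k(2)
  have two: "k + 1 + 1 = k + 2" by simp
  have ne: "lab t k \<noteq> lab t (k + 1)" "lab t k \<noteq> lab t (k + 2)" "lab t (k + 1) \<noteq> lab t (k + 2)" using far by auto
  have cne: "c t k \<noteq> c t (k + 1)" "c t k \<noteq> c t (k + 2)" "c t (k + 1) \<noteq> c t (k + 2)"
    using c_eq_iff[OF t(1) _ _ t(1)] k' ne by auto
  have at_k: "swap_defined k y \<longleftrightarrow> cartan (lab y k) (lab y (k + 1)) = 0" if "y \<in> T" for y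
    by (rule swap_defined_iff[OF that K])
  have at_k1: "swap_defined (k + 1) y \<longleftrightarrow> cartan (lab y (k + 1)) (lab y (k + 2)) = 0" if "y \<in> T" for y
    using swap_defined_iff[OF that L] by simp
  define sk sl where "sk y = swap_tab r k y" and "sl y = swap_tab r (k + 1) y" for y
  have sk: "sk y \<in> T \<and> lab (sk y) k = lab y (k + 1) \<and> lab (sk y) (k + 1) = lab y k \<and> lab (sk y) (k + 2) = lab y (k + 2) \<and>
      c (sk y) k = c y (k + 1) \<and> c (sk y) (k + 1) = c y k \<and> c (sk y) (k + 2) = c y (k + 2) \<and> sk (sk y) = y \<and> \<not> P k y \<and>
      (\<forall>j. 1 \<le> j \<longrightarrow> j \<le> n \<longrightarrow> j \<notin> {k, k + 1, k + 2} \<longrightarrow> c (sk y) j = c y j)"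
    if y: "y \<in> T" "swap_defined k y" for y
    using swap_facts[OF y(1) K y(2)] swap_c_other[OF y(1) K y(2)] lab_sim[OF y(1) swap_sim[OF y(1) K y(2)] k'(6,7)] k'
    by (auto simp: sk_def)
  have sl: "sl y \<in> T \<and> lab (sl y) (k + 1) = lab y (k + 2) \<and> lab (sl y) (k + 2) = lab y (k + 1) \<and> lab (sl y) k = lab y k \<and>
      c (sl y) (k + 1) = c y (k + 2) \<and> c (sl y) (k + 2) = c y (k + 1) \<and> c (sl y) k = c y k \<and> sl (sl y) = y \<and> \<not> P (k + 1) y \<and>
      (\<forall>j. 1 \<le> j \<longrightarrow> j \<le> n \<longrightarrow> j \<notin> {k, k + 1, k + 2} \<longrightarrow> c (sl y) j = c y j)"
    if y: "y \<in> T" "swap_defined (k + 1) y" for y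
    using swap_facts[OF y(1) L y(2)] swap_c_other[OF y(1) L y(2)] lab_sim[OF y(1) swap_sim[OF y(1) L y(2)] k'(1,3)] k'
    by (auto simp: sl_def)
  have dt: "swap_defined k t" "swap_defined (k + 1) t" using at_k at_k1 t far by auto
  define t1 t2 where "t1 = sk t" and "t2 = sl t"
  note s1 = sk[OF t(1) dt(1), folded t1_def] and s2 = sl[OF t(1) dt(2), folded t2_def]
  have d1: "swap_defined (k + 1) t1" using at_k1 s1 far by auto
  have d2: "swap_defined k t2" using at_k s2 far by auto
  define t12 t21 where "t12 = sl t1" and "t21 = sk t2"
  have s12: "t12 \<in> T" using sl[OF _ d1] s1 unfolding t12_def by blast
  note s12' = sl[OF s1[THEN conjunct1] d1, folded t12_def]
  note s21' = sk[OF s2[THEN conjunct1] d2, folded t21_def]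
  have d12: "swap_defined k t12" using at_k s12' s1 far by auto
  have d21: "swap_defined (k + 1) t21" using at_k1 s21' s2 far by auto
  have v12: "v = sk t12"
  proof (rule contents_eqI[OF t(2)])
    note q = sk[OF s12 d12]
    show "sk t12 \<in> T" using q by blast
    fix j assume j: "1 \<le> j" "j \<le> n"
    consider "j = k" | "j = k + 1" | "j = k + 2" | "j \<notin> {k, k + 1, k + 2}" by blast
    thus "c v j = c (sk t12) j"
    proof cases
      case 4
      thus ?thesis using q s12' s1 cv(4) j by metis
    qed (use q s12' s1 cv(1-3) in \<open>metis\<close>)+
  qed
  have v21: "v = sl t21"
  proof (rule contents_eqI[OF t(2)])
    note q = sl[OF s21'[THEN conjunct1] d21]
    show "sl t21 \<in> T" using q by blast
    fix j assume j: "1 \<le> j" "j \<le> n"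
    consider "j = k" | "j = k + 1" | "j = k + 2" | "j \<notin> {k, k + 1, k + 2}" by blast
    thus "c v j = c (sl t21) j"
    proof cases
      case 4
      thus ?thesis using q s21' s2 cv(4) j by metis
    qed (use q s21' s2 cv(1-3) in \<open>metis\<close>)+
  qed
  have T0: "t \<in> T" "t1 \<in> T" "t2 \<in> T" "t12 \<in> T" "t21 \<in> T" using t s1 s2 s12' s21' by auto
  \<comment> \<open>S_k does not touch the content of step k + 2, which must therefore be the one
    required by v already; likewise S_{k+1} and step k below.\<close>
  have zk: "entry (opS k) y v = 0" if "y \<in> T" "c y (k + 2) \<noteq> c t k" for y
    using that(2) cv(3) by (intro entry_opS_zero[OF that(1) t(2) K k'(6,7)]) simp_all
  have zl: "entry (opS (k + 1)) y v = 0" if "y \<in> T" "c y k \<noteq> c t (k + 2)" for y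
    using that(2) cv(1) by (intro entry_opS_zero[OF that(1) t(2) L k'(1,3)]) simp_all
  have "entry (opS k * (opS (k + 1) * opS k)) t v = entry (opS k * opS (k + 1) * opS k) t v"
    by (simp only: mult.assoc)
  also have "\<dots> = a_coeff u k t * entry (opS k * opS (k + 1)) t v + b t k * entry (opS k * opS (k + 1)) t1 v"
    unfolding t1_def sk_def by (intro entry_times_opS t K dt corner_intros op_corner)
  also have "entry (opS k * opS (k + 1)) t v = 0"
    using entry_times_opS[OF t(1) L dt(2) op_corner(2), of k v] zk[OF T0(1)] zk[OF T0(3)] s2 cne
    by (simp add: t2_def sl_def)
  also have "entry (opS k * opS (k + 1)) t1 v = b t1 (k + 1) * b t12 k"
    using entry_times_opS[OF T0(2) L d1 op_corner(2), of k v] zk[OF T0(2)] s1 cne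
      entry_opS_swap[OF T0(4) K d12] v12 by (simp add: t12_def sl_def sk_def)
  finally have STS: "entry (opS k * (opS (k + 1) * opS k)) t v = b t k * (b t1 (k + 1) * b t12 k)" by simp
  have "entry (opS (k + 1) * (opS k * opS (k + 1))) t v = entry (opS (k + 1) * opS k * opS (k + 1)) t v"
    by (simp only: mult.assoc)
  also have "\<dots> = a_coeff u (k + 1) t * entry (opS (k + 1) * opS k) t v + b t (k + 1) * entry (opS (k + 1) * opS k) t2 v"
    unfolding t2_def sl_def by (intro entry_times_opS t L dt corner_intros op_corner)
  also have "entry (opS (k + 1) * opS k) t v = 0"
    using entry_times_opS[OF t(1) K dt(1) op_corner(2), of "k + 1" v] zl[OF T0(1)] zl[OF T0(2)] s1 cne
    by (simp add: t1_def sk_def)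
  also have "entry (opS (k + 1) * opS k) t2 v = b t2 k * b t21 (k + 1)"
    using entry_times_opS[OF T0(3) K d2 op_corner(2), of "k + 1" v] zl[OF T0(3)] s2 cne
      entry_opS_swap[OF T0(5) L d21] v21 by (simp add: t21_def sl_def sk_def)
  finally have TST: "entry (opS (k + 1) * (opS k * opS (k + 1))) t v = b t (k + 1) * (b t2 k * b t21 (k + 1))" by simp
  have kk: "k \<in> {1..<n} \<and> k + 1 \<in> {1..<n}" using k by auto
  \<comment> \<open>The guards in condition (c) ask for unequal entries; each follows from the
    corresponding swap being defined.\<close>
  have br: "b (sl y) k = b (sk y) (k + 1)"
    if "y \<in> T" "swap_defined k y" "swap_defined (k + 1) y" "swap_defined k (sl y)" "swap_defined (k + 1) (sk y)" for y
  proof -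
    have nP: "\<not> P l x" if "swap_defined l x" for l x using that by (simp add: swap_defined_def)
    show ?thesis unfolding sl_def sk_def
      by (rule root_b_braid[rule_format, OF that(1) kk], intro conjI nP that(2-3) that(4,5)[unfolded sl_def sk_def])
  qed
  \<comment> \<open>Condition (c) at t, t2 and t1: opposite sides of the hexagon carry equal
    coefficients, so both halves have the same product.\<close>
  have "b t2 k = b t1 (k + 1)"
    using br[OF T0(1) dt] d1 d2 by (simp add: t1_def t2_def)
  moreover have "b t k = b t21 (k + 1)"
  proof -
    have "sl t2 = t" using s2 sl[OF t(1) dt(2)] by (simp add: t2_def)
    moreover have "swap_defined (k + 1) t2" using at_k1[OF T0(3)] s2 far by (simp add: cartan_commute)
    ultimately show ?thesis using br[OF T0(3) d2] dt d21 by (simp add: t21_def)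
  qed
  moreover have "b t12 k = b t (k + 1)"
  proof -
    have "sk t1 = t" using s1 sk[OF t(1) dt(1)] by (simp add: t1_def)
    moreover have "swap_defined k t1" using at_k[OF T0(2)] s1 far by (simp add: cartan_commute)
    ultimately show ?thesis using br[OF T0(2) _ d1] dt d12 by (simp add: t12_def)
  qed
  ultimately show ?thesis unfolding STS TST by simp
qed

lemma opS_braid:
  assumes k: "1 \<le> k" "k + 1 < n"
  shows "opS k * (opS (k + 1) * opS k) = opS (k + 1) * (opS k * opS (k + 1))"
proof -
  interpret W: wenzl_triple "opS k" "opS (k + 1)" "opE k" "opE (k + 1)" "opX k" "opX (k + 1)" "opX (k + 2)" proj
    by (rule wenzl_triple_ops[OF k])
  have k': "1 \<le> k" "k < n" "k \<le> n" "1 \<le> k + 1" "k + 1 \<le> n" "1 \<le> k + 2" "k + 2 \<le> n" using k by auto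
  have Bc: "W.B \<in> corner" unfolding W.B_def by (intro corner_intros op_corner)
  have contents: "c v k = c t (k + 2) \<and> c v (k + 1) = c t (k + 1) \<and> c v (k + 2) = c t k \<and>
      (\<forall>j. 1 \<le> j \<longrightarrow> j \<le> n \<longrightarrow> j \<notin> {k, k + 1, k + 2} \<longrightarrow> c v j = c t j)"
    if t: "t \<in> T" "v \<in> T" and nz: "entry W.B t v \<noteq> 0" for t v
  proof -
    have sw: "c t i = c v j" if "W.B * opX i = opX j * W.B" for i j
      using arg_cong[OF that, of "\<lambda>A. entry A t v"] t Bc nz by (simp add: entry_times_opX entry_opX_times)
    have "W.B * opX j = opX j * W.B" if "1 \<le> j" "j \<le> n" "j \<notin> {k, k + 1, k + 2}" for j
    proof -
      have a: "opS k * opX j = opX j * opS k" using that k' by (intro opX_far) auto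
      have b: "opS (k + 1) * opX j = opX j * opS (k + 1)" using that k by (intro opX_far) auto
      have "opS k * (opX j * w) = opX j * (opS k * w)" "opS (k + 1) * (opX j * w) = opX j * (opS (k + 1) * w)" for w
        by (simp_all only: mult.assoc[symmetric] a b)
      thus ?thesis by (simp only: W.B_def left_diff_distrib right_diff_distrib mult.assoc a b)
    qed
    thus ?thesis using sw W.braid_intertwines by metis
  qed
  have "W.B = 0"
  proof (intro corner_eqI Bc corner_0)
    fix t v assume t: "t \<in> T" "v \<in> T"
    show "entry W.B t v = entry 0 t v"
    proof (rule ccontr)
      assume "\<not> ?thesis"
      hence nz: "entry W.B t v \<noteq> 0" by (simp add: entry_0)
      note cv = contents[OF t nz]
      have sl: "sg v k = sg t (k + 2) \<and> lab v k = lab t (k + 2)" "sg v (k + 1) = sg t (k + 1) \<and> lab v (k + 1) = lab t (k + 1)"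
        "sg v (k + 2) = sg t k \<and> lab v (k + 2) = lab t k"
        using cv c_eq_iff[OF t(2) _ _ t(1)] k' by auto
      have start: "t ! (k - 1) = v ! (k - 1)"
        using cv k' by (intro contents_forward[OF t]) auto
      obtain \<alpha> where m1: "move r (t ! (k - 1)) (sg t k) \<alpha> (t ! k)" "node_label \<alpha> = lab t k"
        by (rule T_moveE[OF t(1) k'(1,3)])
      obtain \<beta> where m2: "move r (t ! k) (sg t (k + 1)) \<beta> (t ! (k + 1))" "node_label \<beta> = lab t (k + 1)"
        by (rule T_moveE_Suc[OF t(1) k'(2)])
      obtain \<gamma> where m3: "move r (t ! (k + 1)) (sg t (k + 2)) \<gamma> (t ! (k + 2))" "node_label \<gamma> = lab t (k + 2)"
        using T_moveE_Suc[OF t(1) k(2)] by auto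
      obtain \<gamma>' where m1': "move r (t ! (k - 1)) (sg t (k + 2)) \<gamma>' (v ! k)" "node_label \<gamma>' = lab t (k + 2)"
        using T_moveE[OF t(2) k'(1,3)] sl start by metis
      obtain \<beta>' where m2': "move r (v ! k) (sg t (k + 1)) \<beta>' (v ! (k + 1))" "node_label \<beta>' = lab t (k + 1)"
        using T_moveE_Suc[OF t(2) k'(2)] sl by metis
      obtain \<alpha>' where m3': "move r (v ! (k + 1)) (sg t k) \<alpha>' (v ! (k + 2))" "node_label \<alpha>' = lab t k"
        using T_moveE_Suc[OF t(2) k(2)] sl by auto
      consider "lab t k = lab t (k + 1)" "lab t (k + 1) = lab t (k + 2)"
        | "cartan (lab t k) (lab t (k + 1)) = 0" "cartan (lab t k) (lab t (k + 2)) = 0" "cartan (lab t (k + 1)) (lab t (k + 2)) = 0"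
        using reversed_path_labels[OF m1(1) m2(1) m3(1) m1'(1) m2'(1) m3'(1)] m1(2) m2(2) m3(2) m1'(2) m2'(2) m3'(2) by auto
      thus False
      proof cases
        \<comment> \<open>The contents of the three steps are c, -c, c. Reversal fixes them, so B
          has only a diagonal entry in row t, and comparing diagonal entries in E_k B = 0 makes it
          vanish.\<close>
        case 1
        have P: "P k t" "P (k + 1) t" using 1 P_iff[OF t(1) k'(1,2)] P_iff[OF t(1) k'(4) k(2)] by auto
        have cc: "c t (k + 2) = c t k"
          using c_next[OF t(1) k'(1,2) P(1)] c_next[OF t(1) k'(4) k(2) P(2)] by simp
        have diag: "w = t" if w: "w \<in> T" "entry W.B t w \<noteq> 0" for w
        proof (rule contents_eqI[OF w(1) t(1)])
          note q = contents[OF t(1) w]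
          fix j assume j: "1 \<le> j" "j \<le> n"
          consider "j = k" | "j = k + 1" | "j = k + 2" | "j \<notin> {k, k + 1, k + 2}" by blast
          thus "c w j = c t j"
          proof cases
            case 4
            thus ?thesis using q j by blast
          qed (use q cc in simp_all)
        qed
        have "0 = entry (opE k * W.B) t t" by (simp only: W.E_braid entry_0)
        also have "\<dots> = (\<Sum>w\<in>T. entry W.B t w * entry (opE k) w t)" by (rule entry_times[OF op_corner(1)])
        also have "\<dots> = entry W.B t t * entry (opE k) t t"
          using diag by (intro sum_single[OF finite_T t(1)]) auto
        finally have "entry W.B t t * entry (opE k) t t = 0" by simp
        moreover have "entry (opE k) t t \<noteq> 0"
          using t P(1) rt_nonzero[OF t(1) k'(1,2) P(1)] by (simp add: entry_opE cE_def sim_refl)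
        ultimately show False using nz diag[OF t(2) nz] by simp
      next
        case 2
        have "entry W.B t v = 0"
          unfolding W.B_def entry_minus using cv by (subst braid_entry_far[OF t k 2]) auto
        thus False using nz by simp
      qed
    qed
  qed
  thus ?thesis by (simp only: W.B_def right_minus_eq)
qed

lemma opE_square:
  assumes "1 \<le> k" "k < n"
  shows "opE k * opE k = scal (\<omega> 0) * opE k"
  using assms
proof (induction k rule: dec_induct)
  case base
  thus ?case using opE_opX_opE[of 0] by simp
next
  case (step k)
  hence k: "1 \<le> k" "k + 1 < n" by auto
  interpret W: wenzl_triple "opS k" "opS (k + 1)" "opE k" "opE (k + 1)" "opX k" "opX (k + 1)" "opX (k + 2)" proj
    by (rule wenzl_triple_ops[OF k])
  let ?S = "opS k" and ?T = "opS (k + 1)" and ?E = "opE k" and ?F = "opE (k + 1)"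
  note sfx = W.SS[THEN W.suffix2] W.TT[THEN W.suffix2] W.unit[THEN W.suffix2] W.unit
  \<comment> \<open>From S F S = T E T: E_{k+1} is the conjugate of E_k by S_k S_{k+1}, a product of
    involutions.\<close>
  have F: "?F = ?S * (?T * (?E * (?T * ?S)))"
  proof -
    have "?S * (?T * (?E * (?T * ?S))) = ?S * ((?T * (?E * ?T)) * ?S)" by (simp only: mult.assoc)
    also have "\<dots> = ?S * (?S * (?F * (?S * ?S)))" by (simp only: W.SFS[symmetric] mult.assoc)
    also have "\<dots> = ?F" by (simp only: W.SS sfx)
    finally show ?thesis by simp
  qed
  have E: "?E * (?E * w) = scal (\<omega> 0) * (?E * w)" for w
  proof -
    have "?E * ?E = scal (\<omega> 0) * ?E" using step by simp
    thus ?thesis by (simp only: mult.assoc[symmetric])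
  qed
  have sc: "A * (scal x * w) = scal x * (A * w)" for A w :: "'a endo" and x
    by (simp only: mult.assoc[symmetric] scal_commute[of A])
  have "?F * ?F = ?S * (?T * (?E * (?T * (?S * (?S * (?T * (?E * (?T * ?S))))))))"
    by (subst (1 2) F) (simp only: mult.assoc)
  also have "\<dots> = ?S * (?T * (?E * (?E * (?T * ?S))))" by (simp only: sfx)
  also have "\<dots> = scal (\<omega> 0) * ?F" by (simp only: E sc F[symmetric])
  finally show ?case by simp
qed

section \<open>The cyclotomic relation and the representation\<close>

text \<open>The first step adds a box (1, 1, s) to the empty shape, so X_1 acts on each basis vector
  by some u_s and one factor of the product kills it.\<close>

lemma cyclotomic_relation: "prod_list (map (\<lambda>i. opX 1 - scal (u i)) [1..<r + 1]) * proj = 0"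
proof (intro corner_eqI corner_0)
  have mem: "prod_list (map (\<lambda>i. opX 1 - scal (u i)) xs) * proj \<in> corner" for xs
    by (induction xs) (auto simp: left_diff_distrib mult.assoc intro: corner_intros op_corner)
  show "prod_list (map (\<lambda>i. opX 1 - scal (u i)) [1..<r + 1]) * proj \<in> corner" by (rule mem)
  fix t v assume t: "t \<in> T" "v \<in> T"
  have e: "entry (prod_list (map (\<lambda>i. opX 1 - scal (u i)) xs) * proj) t v =
      prod_list (map (\<lambda>i. c v 1 - u i) xs) * entry proj t v" for xs
  proof (induction xs)
    case (Cons x xs)
    thus ?case using t by (simp add: left_diff_distrib mult.assoc entry_minus entry_opX_times[OF t(2)] entry_scal)
  qed simp
  obtain s where s: "s \<in> {1..r}" "c v 1 = u s"
  proof -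
    have "v ! 1 \<ominus>\<^sub>b v ! (1 - 1) \<in> edge_nodes r (v ! (1 - 1))" using step_edge_node(1)[OF t(2), of 1] n_pos by simp
    then obtain s where s: "s \<in> {1..r}" "v ! 1 \<ominus>\<^sub>b v ! (1 - 1) = (1, 1, s)"
      using T_0[OF t(2)] by (auto simp: edge_nodes_empty)
    have m: "move r (v ! (1 - 1)) (sg v 1) (1, 1, s) (v ! 1)"
      using T_move[OF t(2), of 1] s n_pos by simp
    have "sg v 1 = 1" using moveD(3,5)[OF m] T_0[OF t(2)] by auto
    hence "c v 1 = u s" using tab_content_move[OF m, of u] by (simp add: label_content_def node_label_def)
    with s that show ?thesis by blast
  qed
  have "prod_list (map (\<lambda>i. c v 1 - u i) [1..<r + 1]) = 0"
    using s by (auto simp: prod_list_zero_iff simp del: upt_Suc)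
  thus "entry (prod_list (map (\<lambda>i. opX 1 - scal (u i)) [1..<r + 1]) * proj) t v = entry 0 t v"
    unfolding e by (simp add: entry_0)
qed


definition rep :: "wgen \<Rightarrow> 'a endo" where
  "rep g = (case g of GS k \<Rightarrow> opS k | GE k \<Rightarrow> opE k | GX j \<Rightarrow> opX j)"

lemma rep_simps: "rep (GS k) = opS k" "rep (GE k) = opE k" "rep (GX j) = opX j"
  by (simp_all add: rep_def)

lemma rep_hom: "eval_corner rep \<in> ring_hom (free_algebra (wgens n)) corner_ring"
  by (rule eval_corner_hom) (auto simp: rep_def op_corner split: wgen.split)

lemmas rep_eval = free_eval_times free_eval_plus free_eval_minus free_eval_power free_eval_1 free_eval_const
  free_eval_gen free_eval_0 rep_simps

lemma wenzl_rel_eval: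
  assumes "wenzl_rel n \<omega> x y"
  shows "eval_corner rep (x - y) = 0"
proof -
  \<comment> \<open>Evaluation in the corner appends a projection, which the last operator of each
    word absorbs.\<close>
  have proj: "opS k * proj = opS k" "opE k * proj = opE k" "opX j * proj = opX j"
    "A * (opS k * proj) = A * opS k" "A * (opE k * proj) = A * opE k" "A * (opX j * proj) = A * opX j" for k j A
    by (simp_all add: corner_proj(2) op_corner)
  from assms have "free_eval rep x * proj = free_eval rep y * proj"
  proof cases
    case (SS i)
    thus ?thesis using opS_square[of i] by (simp add: rep_eval power2_eq_square proj_idem)
  next
    case (SS_comm i j)
    thus ?thesis using far_commute(1)[of i j] by (simp add: rep_eval)
  next
    case (SS_braid i)
    thus ?thesis using opS_braid[of i] by (simp add: rep_eval mult.assoc proj)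
  next
    case (SX_comm i j)
    thus ?thesis using opX_far(1)[of i j] by (simp add: rep_eval)
  next
    case (EE i)
    thus ?thesis using opE_square[of i] by (simp add: rep_eval power2_eq_square)
  next
    case (SE_comm i j)
    thus ?thesis using far_commute(2)[of i j] by (simp add: rep_eval)
  next
    case (EE_comm i j)
    thus ?thesis using far_commute(3)[of i j] by (simp add: rep_eval)
  next
    case (EX_comm i j)
    thus ?thesis using opX_far(2)[of i j] by (simp add: rep_eval)
  next
    case (XX_comm i j)
    thus ?thesis using opX_commute[of i j] by (simp add: rep_eval)
  next
    case (skein_SX i)
    thus ?thesis using skein(1)[of i] by (simp add: rep_eval left_diff_distrib proj_idem proj)
  next
    case (skein_XS i)
    thus ?thesis using skein(2)[of i] by (simp add: rep_eval left_diff_distrib proj_idem proj)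
  next
    case (EXE a)
    thus ?thesis using opE_opX_opE[of a] by (simp add: rep_eval)
  next
    case (ES i)
    thus ?thesis using opE_opS[of i] by (simp add: rep_eval)
  next
    case (SE i)
    thus ?thesis using opS_opE[of i] by (simp add: rep_eval)
  next
    case (SEE i)
    thus ?thesis using opS_opE_opE[of i] by (simp add: rep_eval mult.assoc proj)
  next
    case (EES i)
    thus ?thesis using opE_opE_opS[of i] by (simp add: rep_eval mult.assoc proj)
  next
    case (EEE_down i)
    thus ?thesis using opE_opE_opE_down[of i] by (simp add: rep_eval)
  next
    case (EEE_up i)
    thus ?thesis using opE_opE_opE_up[of i] by (simp add: rep_eval mult.assoc proj)
  next
    case (EX_anti i)
    thus ?thesis using opE_opX_anti(1)[of i] by (simp add: rep_eval)
  next
    case (XE_anti i)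
    thus ?thesis using opE_opX_anti(2)[of i] by (simp add: rep_eval)
  qed
  thus ?thesis by (simp add: eval_corner_def free_eval_minus left_diff_distrib)
qed

lemma wenzl_rel_carrier:
  assumes "wenzl_rel n \<omega> x y"
  shows "x - y \<in> carrier (free_algebra (wgens n))"
proof -
  have gens: "fS i \<in> carrier (free_algebra (wgens n))" "fE i \<in> carrier (free_algebra (wgens n))"
    if "i \<in> {1..<n}" for i
    using that by (auto intro!: free_carrier_gen simp: wgens_def)
  have gensX: "fX i \<in> carrier (free_algebra (wgens n))" if "i \<in> {1..n}" for i
    using that by (auto intro!: free_carrier_gen simp: wgens_def)
  from assms show ?thesis
    by cases (auto intro!: free_carrier_0 free_carrier_1 free_carrier_const free_carrier_plus free_carrier_minus
        free_carrier_times free_carrier_power gens gensX)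
qed

text \<open>The cyclotomic algebra is a quotient of a quotient, so the evaluation is factored twice,
  the second time through the ideal generated by the class of the polynomial in X_1.\<close>

lemma representation:
  obtains h where "ring (cyclotomic_wenzl n r u \<omega>)" "h \<in> ring_hom (cyclotomic_wenzl n r u \<omega>) (corner_ring :: 'a endo ring)"
    "\<And>x. x \<in> carrier (free_algebra (wgens n)) \<Longrightarrow> h (cyclotomic_elem n r u \<omega> x) = eval_corner rep x"
proof -
  let ?F = "free_algebra (wgens n) :: (wgen list \<Rightarrow>\<^sub>0 'a) ring"
  let ?S = "{x - y |x y. wenzl_rel n \<omega> x y}"
  interpret F: ring ?F by (rule ring_free_algebra)
  have S: "?S \<subseteq> carrier ?F" using wenzl_rel_carrier by auto
  obtain h1 where h1: "h1 \<in> ring_hom (affine_wenzl n \<omega>) (corner_ring :: 'a endo ring)"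
    "\<And>x. x \<in> carrier ?F \<Longrightarrow> h1 (affine_elem n \<omega> x) = eval_corner rep x"
    unfolding affine_wenzl_def affine_elem_def affine_ideal_def
    using ring_hom_factor_ideal[OF ring_free_algebra ring_corner_ring rep_hom S] wenzl_rel_eval by auto
  have ideal1: "ideal (affine_ideal n \<omega>) ?F" unfolding affine_ideal_def by (rule F.genideal_ideal[OF S])
  interpret A: ring "affine_wenzl n \<omega>" unfolding affine_wenzl_def by (rule ideal.quotient_is_ring[OF ideal1])
  have elem: "affine_elem n \<omega> x \<in> carrier (affine_wenzl n \<omega>)" if "x \<in> carrier ?F" for x
    using that unfolding affine_elem_def affine_wenzl_def FactRing_def A_RCOSETS_def' by auto
  let ?p = "\<Prod>i\<leftarrow>[1..<r + 1]. fX 1 - free_const (u i) :: wgen list \<Rightarrow>\<^sub>0 'a"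
  have "1 \<in> {1..n}" using n_pos by simp
  hence p: "?p \<in> carrier ?F"
    by (intro free_carrier_prod_list free_carrier_minus free_carrier_const free_carrier_gen) (simp add: wgens_def)
  have "free_eval rep ?p = prod_list (map (\<lambda>i. opX 1 - scal (u i)) [1..<r + 1])"
    unfolding free_eval_prod_list map_map by (simp add: o_def rep_eval del: upt_Suc)
  hence zero: "eval_corner rep ?p = 0"
    using cyclotomic_relation by (simp add: eval_corner_def del: upt_Suc)
  have S2: "{affine_elem n \<omega> ?p} \<subseteq> carrier (affine_wenzl n \<omega>)" using elem[OF p] by simp
  obtain h2 where h2: "h2 \<in> ring_hom (cyclotomic_wenzl n r u \<omega>) (corner_ring :: 'a endo ring)"
    "\<And>X. X \<in> carrier (affine_wenzl n \<omega>) \<Longrightarrow> h2 (cyclotomic_ideal n r u \<omega> +>\<^bsub>affine_wenzl n \<omega>\<^esub> X) = h1 X"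
    unfolding cyclotomic_wenzl_def cyclotomic_ideal_def
    using ring_hom_factor_ideal[OF A.ring_axioms ring_corner_ring h1(1) S2] h1(2)[OF p] zero by auto
  have "ideal (cyclotomic_ideal n r u \<omega>) (affine_wenzl n \<omega>)"
    unfolding cyclotomic_ideal_def by (rule A.genideal_ideal[OF S2])
  hence "ring (cyclotomic_wenzl n r u \<omega>)" unfolding cyclotomic_wenzl_def by (rule ideal.quotient_is_ring)
  moreover have "h2 (cyclotomic_elem n r u \<omega> x) = eval_corner rep x" if "x \<in> carrier ?F" for x
    unfolding cyclotomic_elem_def using h2(2)[OF elem[OF that]] h1(2)[OF that] by simp
  ultimately show ?thesis using that h2(1) by blast
qed

lemma lookup_op: "t \<in> T \<Longrightarrow> M \<in> corner \<Longrightarrow> Poly_Mapping.lookup (app M (basis_vec t)) v = (if v \<in> T then entry M t v else 0)"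
  using entry_corner[of M t v] by (auto simp: entry_def)

lemma lookup_sum_basis:
  "Poly_Mapping.lookup (\<Sum>w | w \<in> T \<and> Q w. f w *\<^sub>v basis_vec w) v = (if v \<in> T \<and> Q v then f v else 0)"
  using finite_T by (simp add: lookup_sum lookup_vscale lookup_basis_vec if_distrib cong: if_cong)

lemma app_opE:
  assumes t: "t \<in> T" and k: "1 \<le> k" "k < n"
  shows "app (opE k) (basis_vec t) = (if P k t then \<Sum>v | v \<in> T \<and> tab_sim k v t. e_coeff r u rt k t v *\<^sub>v basis_vec v else 0)"
  by (rule poly_mapping_eqI)
    (auto simp: lookup_op[OF t op_corner(1)] entry_opE t lookup_sum_basis cE_eq_e_coeff[OF t _ k]
      intro: cE_def[THEN trans])

lemma app_opS:
  assumes t: "t \<in> T" and k: "1 \<le> k" "k < n"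
  shows "app (opS k) (basis_vec t) =
    (if P k t then \<Sum>v | v \<in> T \<and> tab_sim k v t. s_coeff r u rt k t v *\<^sub>v basis_vec v
     else a_coeff u k t *\<^sub>v basis_vec t + b t k *\<^sub>v (if swap_defined k t then basis_vec (swap_tab r k t) else 0))"
proof (rule poly_mapping_eqI)
  fix v
  have L: "Poly_Mapping.lookup (app (opS k) (basis_vec t)) v = (if v \<in> T then cS k t v else 0)"
    using lookup_op[OF t op_corner(2)] entry_opS[OF t] by simp
  show "Poly_Mapping.lookup (app (opS k) (basis_vec t)) v = Poly_Mapping.lookup
    (if P k t then \<Sum>v | v \<in> T \<and> tab_sim k v t. s_coeff r u rt k t v *\<^sub>v basis_vec v
     else a_coeff u k t *\<^sub>v basis_vec t + b t k *\<^sub>v (if swap_defined k t then basis_vec (swap_tab r k t) else 0)) v"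
  proof (cases "P k t")
    case True
    show ?thesis
      unfolding L if_P[OF True] lookup_sum_basis using True cE_eq_e_coeff[OF t _ k True, of v]
      by (auto simp: cS_def s_coeff_def)
  next
    case False
    show ?thesis
    proof (cases "swap_defined k t")
      case True
      note s = swap_facts[OF t k True]
      show ?thesis unfolding L using False True s t
        by (simp only: if_False if_True cS_def) (auto simp: lookup_add lookup_vscale lookup_basis_vec)
    next
      case nd: False
      show ?thesis unfolding L using False nd t
        by (simp only: if_False cS_def) (auto simp: lookup_add lookup_vscale lookup_basis_vec)
    qed
  qed
qed

lemma app_opX: "t \<in> T \<Longrightarrow> app (opX j) (basis_vec t) = c t j *\<^sub>v basis_vec t"
  by (rule poly_mapping_eqI) (auto simp: lookup_op op_corner entry_opX lookup_vscale lookup_basis_vec)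

end

theorem theorem4p13:
  fixes n r m :: nat
    and u \<omega> :: "nat \<Rightarrow> 'a::field"
    and lam :: mpart
    and rt b :: "tableau \<Rightarrow> nat \<Rightarrow> 'a"
  assumes "n \<ge> 1"
    and "CHAR('a) = 0 \<or> CHAR('a) > 2 * n"
    and "generic n r u"
    and "u_admissible r u \<omega>"
    and "m \<le> n div 2"
    and "is_multipartition r lam" and "mpart_size r lam = n - 2 * m"
    and "root_conditions n r u lam rt b"
  shows "\<exists>act.
    left_module (cyclotomic_wenzl n r u \<omega>) (seminormal_space n r lam) act \<and>
    (\<forall>c. \<forall>v\<in>seminormal_space n r lam. act (cyclotomic_elem n r u \<omega> (free_const c)) v = c *\<^sub>v v) \<and>
    (\<forall>\<tt>\<in>updown_tableaux n r lam.
      (\<forall>k\<in>{1..<n}.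
        act (cyclotomic_elem n r u \<omega> (fS k)) (basis_vec \<tt>) =
          (if \<tt> ! (k - 1) = \<tt> ! (k + 1)
           then \<Sum>\<uu> | \<uu> \<in> updown_tableaux n r lam \<and> tab_sim k \<uu> \<tt>. s_coeff r u rt k \<tt> \<uu> *\<^sub>v basis_vec \<uu>
           else a_coeff u k \<tt> *\<^sub>v basis_vec \<tt> +
                b \<tt> k *\<^sub>v (if swap_defined k \<tt> then basis_vec (swap_tab r k \<tt>) else 0))) \<and>
      (\<forall>k\<in>{1..<n}.
        act (cyclotomic_elem n r u \<omega> (fE k)) (basis_vec \<tt>) =
          (if \<tt> ! (k - 1) = \<tt> ! (k + 1)
           then \<Sum>\<uu> | \<uu> \<in> updown_tableaux n r lam \<and> tab_sim k \<uu> \<tt>. e_coeff r u rt k \<tt> \<uu> *\<^sub>v basis_vec \<uu>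
           else 0)) \<and>
      (\<forall>j\<in>{1..n}.
        act (cyclotomic_elem n r u \<omega> (fX j)) (basis_vec \<tt>) = tab_content u \<tt> j *\<^sub>v basis_vec \<tt>))"
proof -
  interpret seminormal n r u \<omega> lam rt b by unfold_locales fact+
  obtain h where A: "ring (cyclotomic_wenzl n r u \<omega>)"
    and h: "h \<in> ring_hom (cyclotomic_wenzl n r u \<omega>) (corner_ring :: 'a endo ring)"
    "\<And>x. x \<in> carrier (free_algebra (wgens n)) \<Longrightarrow> h (cyclotomic_elem n r u \<omega> x) = eval_corner rep x"
    by (rule representation) blast
  have gen_op: "app (h (cyclotomic_elem n r u \<omega> (free_gen g))) v = app (rep g) v" if "g \<in> wgens n" for g v
  proof -
    have "rep g * proj = rep g" by (cases g) (simp_all add: rep_simps corner_proj(2) op_corner)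
    thus ?thesis using h(2)[OF free_carrier_gen[OF that]] by (simp add: eval_corner_def free_eval_gen)
  qed
  show ?thesis
  proof (intro exI conjI ballI allI)
    show "left_module (cyclotomic_wenzl n r u \<omega>) (seminormal_space n r lam) (\<lambda>x. app (h x))"
      using left_module_of_corner_hom[OF A h(1)] by (simp add: seminormal_space_def)
    fix c and v :: "tableau \<Rightarrow>\<^sub>0 'a" assume "v \<in> seminormal_space n r lam"
    hence "app proj v = v"
      by (auto simp: seminormal_space_def poly_mapping_eq_iff fun_eq_iff lookup_proj in_keys_iff subset_iff)
    thus "app (h (cyclotomic_elem n r u \<omega> (free_const c))) v = c *\<^sub>v v"
      using h(2)[OF free_carrier_const] by (simp add: eval_corner_def free_eval_const app_times app_scal)
  next
    fix \<tt> k assume "\<tt> \<in> T" "k \<in> {1..<n}"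
    thus "app (h (cyclotomic_elem n r u \<omega> (fS k))) (basis_vec \<tt>) =
          (if \<tt> ! (k - 1) = \<tt> ! (k + 1)
           then \<Sum>\<uu> | \<uu> \<in> updown_tableaux n r lam \<and> tab_sim k \<uu> \<tt>. s_coeff r u rt k \<tt> \<uu> *\<^sub>v basis_vec \<uu>
           else a_coeff u k \<tt> *\<^sub>v basis_vec \<tt> +
                b \<tt> k *\<^sub>v (if swap_defined k \<tt> then basis_vec (swap_tab r k \<tt>) else 0))"
      using gen_op[of "GS k"] app_opS[of \<tt> k] by (simp add: rep_simps wgens_def)
  next
    fix \<tt> k assume "\<tt> \<in> T" "k \<in> {1..<n}"
    thus "app (h (cyclotomic_elem n r u \<omega> (fE k))) (basis_vec \<tt>) =
          (if \<tt> ! (k - 1) = \<tt> ! (k + 1)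
           then \<Sum>\<uu> | \<uu> \<in> updown_tableaux n r lam \<and> tab_sim k \<uu> \<tt>. e_coeff r u rt k \<tt> \<uu> *\<^sub>v basis_vec \<uu>
           else 0)"
      using gen_op[of "GE k"] app_opE[of \<tt> k] by (simp add: rep_simps wgens_def)
  next
    fix \<tt> j assume "\<tt> \<in> T" "j \<in> {1..n}"
    thus "app (h (cyclotomic_elem n r u \<omega> (fX j))) (basis_vec \<tt>) = tab_content u \<tt> j *\<^sub>v basis_vec \<tt>"
      using gen_op[of "GX j"] app_opX[of \<tt> j] by (simp add: rep_simps wgens_def)
  qed
qed

end
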